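(* Let $0<q<1$, and let $\mathcal{H}=\ell^2(\mathbb{N})\otimes\ell^2(\mathbb{Z})$ with the representation $\pi_0$ of $\mathcal{A}(\mathrm{SU}_q(2))$ and the operators $F$, $K$ given in the context. Then $(F,\pi_0,\mathcal{H})$ is a $3$-summable modular Fredholm module (for $\mathcal{A}(\mathrm{SU}_q(2))$) with respect to the von Neumann algebra $\mathcal{B}(\mathcal{H})$ and the weight $\Phi(T):=\mathrm{Tr}(K^{1/2}TK^{1/2})$ for $T\ge0$, where $Ke_{k,l}=q^{-2k}e_{k,l}$.
   Context: $\mathcal{A}(\mathrm{SU}_q(2))$ is the universal unital $*$-algebra generated by $a,b$ with relations $ba=qab$, $bb^*=b^*b$, $b^*a=qab^*$, $aa^*+bb^*=1$, $a^*a+q^2bb^*=1$. On $\mathcal{H}=\ell^2(\mathbb{N})\otimes\ell^2(\mathbb{Z})$ with standard orthonormal basis $e_{k,l}$, $k\ge0$, $l\in\mathbb{Z}$: $\pi_0(a)e_{k,l}=\sqrt{1-q^{2k+2}}\,e_{k+1,l}$, $\pi_0(b)e_{k,l}=q^ke_{k,l+1}$. $F e_{k,l}=\mathrm{sign}(l)e_{k,l}$ with $\mathrm{sign}(0)=1$. The algebra is identified with its image under $\pi_0$. Modular Fredholm modules. Let $\mathcal{N}$ be a von Neumann algebra on $\mathcal{H}$ and $\Phi$ a faithful normal semifinite weight on $\mathcal{N}$ with modular group $\sigma^\Phi$; $\mathrm{dom}(\Phi)$ is the linear span of positive elements of finite weight. $(\mathcal{A},\mathcal{H},F)$ is an $n$-summable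 unital modular Fredholm module with respect to $(\mathcal{N},\Phi)$ if: (o) $\mathcal{A}$ is a separable unital $*$-subalgebra of $\mathcal{N}$; (i) $\mathcal{A}$ is globally invariant under $\sigma^\Phi$ and consists of analytic vectors for it; (ii) $F=F^*$ lies in the fixed point algebra $\mathcal{N}^{\sigma^\Phi}$ and $F^2=1$; (iii) $[F,a]^n\in\mathrm{dom}(\Phi)$ for all $a\in\mathcal{A}$. *)

theory Defs
  imports "HOL-Analysis.Analysis" "HOL-Algebra.Module"
begin

section \<open>The complex Hilbert space of square-summable families\<close>

typedef 'i ell2 = "{f :: 'i \<Rightarrow> complex. (\<lambda>i. (cmod (f i))\<^sup>2) summable_on UNIV}"
  morphisms coord Abs_ell2
  by (rule exI[of _ "\<lambda>_. 0"]) simp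

setup_lifting type_definition_ell2

lemma ell2_mult_abs_summable:
  fixes f g :: "'i \<Rightarrow> complex"
  assumes "(\<lambda>i. (cmod (f i))\<^sup>2) summable_on UNIV" "(\<lambda>i. (cmod (g i))\<^sup>2) summable_on UNIV"
  shows "(\<lambda>i. norm (cnj (f i) * g i)) summable_on UNIV"
proof (rule summable_on_comparison_test)
  show "(\<lambda>i. (cmod (f i))\<^sup>2 + (cmod (g i))\<^sup>2) summable_on UNIV"
    using assms by (rule summable_on_add)
  show "norm (cnj (f i) * g i) \<le> (cmod (f i))\<^sup>2 + (cmod (g i))\<^sup>2" for i
  proof -
    have "2 * (cmod (f i) * cmod (g i)) \<le> (cmod (f i))\<^sup>2 + (cmod (g i))\<^sup>2"
      using sum_squares_bound[of "cmod (f i)" "cmod (g i)"] by (simp add: mult.assoc)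
    moreover have "0 \<le> cmod (f i) * cmod (g i)"
      by simp
    ultimately show ?thesis
      unfolding norm_mult complex_mod_cnj by linarith
  qed
qed auto

lemma ell2_add_closed:
  fixes f g :: "'i \<Rightarrow> complex"
  assumes "(\<lambda>i. (cmod (f i))\<^sup>2) summable_on UNIV" "(\<lambda>i. (cmod (g i))\<^sup>2) summable_on UNIV"
  shows "(\<lambda>i. (cmod (f i + g i))\<^sup>2) summable_on UNIV"
proof (rule summable_on_comparison_test)
  show "(\<lambda>i. 2 * (cmod (f i))\<^sup>2 + 2 * (cmod (g i))\<^sup>2) summable_on UNIV"
    using assms by (intro summable_on_add summable_on_cmult_right)
  show "(cmod (f i + g i))\<^sup>2 \<le> 2 * (cmod (f i))\<^sup>2 + 2 * (cmod (g i))\<^sup>2" for i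
  proof -
    have "(cmod (f i + g i))\<^sup>2 \<le> (cmod (f i) + cmod (g i))\<^sup>2"
      by (intro power_mono norm_triangle_ineq) auto
    also have "\<dots> \<le> 2 * (cmod (f i))\<^sup>2 + 2 * (cmod (g i))\<^sup>2"
      using sum_squares_bound[of "cmod (f i)" "cmod (g i)"] by (simp add: power2_sum)
    finally show ?thesis .
  qed
qed auto

lemma ell2_scale_closed:
  fixes f :: "'i \<Rightarrow> complex"
  assumes "(\<lambda>i. (cmod (f i))\<^sup>2) summable_on UNIV"
  shows "(\<lambda>i. (cmod (c * f i))\<^sup>2) summable_on UNIV"
  using summable_on_cmult_right[OF assms, of "(cmod c)\<^sup>2"]
  by (simp add: norm_mult power_mult_distrib)

lemma coord_summable: "(\<lambda>i. (cmod (coord \<xi> i))\<^sup>2) summable_on UNIV"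
  using coord by blast

lift_definition scaleC_ell2 :: "complex \<Rightarrow> 'i ell2 \<Rightarrow> 'i ell2" (infixr \<open>*\<^sub>C\<close> 75)
  is "\<lambda>c f i. c * f i"
  by (rule ell2_scale_closed)

lift_definition ket :: "'i \<Rightarrow> 'i ell2" is "\<lambda>i j. if j = i then 1 else 0"
proof -
  fix i :: 'i
  have "(\<lambda>j. (cmod (if j = i then 1 else 0))\<^sup>2) summable_on {i}"
    by simp
  then show "(\<lambda>j. (cmod (if j = i then 1 else 0))\<^sup>2) summable_on UNIV"
    by (rule summable_on_cong_neutral[THEN iffD1, rotated -1]) auto
qed

text \<open>The inner product is conjugate-linear in the first argument.\<close>

definition cinner :: "'i ell2 \<Rightarrow> 'i ell2 \<Rightarrow> complex" where
  "cinner \<xi> \<eta> = (\<Sum>\<^sub>\<infinity>i. cnj (coord \<xi> i) * coord \<eta> i)"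

lemma cinner_summable: "(\<lambda>i. cnj (coord \<xi> i) * coord \<eta> i) summable_on UNIV"
  by (rule abs_summable_summable[OF ell2_mult_abs_summable[OF coord_summable coord_summable]])

instantiation ell2 :: (type) real_vector
begin

lift_definition zero_ell2 :: "'i ell2" is "\<lambda>_. 0" by simp
lift_definition plus_ell2 :: "'i ell2 \<Rightarrow> 'i ell2 \<Rightarrow> 'i ell2" is "\<lambda>f g i. f i + g i"
  by (rule ell2_add_closed)
lift_definition uminus_ell2 :: "'i ell2 \<Rightarrow> 'i ell2" is "\<lambda>f i. - f i" by simp
lift_definition minus_ell2 :: "'i ell2 \<Rightarrow> 'i ell2 \<Rightarrow> 'i ell2" is "\<lambda>f g i. f i - g i"
proof -
  fix f g :: "'i \<Rightarrow> complex"
  assume "(\<lambda>i. (cmod (f i))\<^sup>2) summable_on UNIV" "(\<lambda>i. (cmod (g i))\<^sup>2) summable_on UNIV"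
  then show "(\<lambda>i. (cmod (f i - g i))\<^sup>2) summable_on UNIV"
    using ell2_add_closed[of f "\<lambda>i. - g i"] by simp
qed
definition scaleR_ell2 :: "real \<Rightarrow> 'i ell2 \<Rightarrow> 'i ell2" where
  "scaleR_ell2 r \<xi> = complex_of_real r *\<^sub>C \<xi>"

instance
  by standard (unfold scaleR_ell2_def, (transfer, simp add: algebra_simps fun_eq_iff)+)

end

lemma coord_simps [simp]:
  "coord 0 i = 0" "coord (\<xi> + \<eta>) i = coord \<xi> i + coord \<eta> i" "coord (- \<xi>) i = - coord \<xi> i"
  "coord (\<xi> - \<eta>) i = coord \<xi> i - coord \<eta> i" "coord (c *\<^sub>C \<xi>) i = c * coord \<xi> i"
  "coord (r *\<^sub>R \<xi>) i = complex_of_real r * coord \<xi> i"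
  "coord (ket j) i = (if i = j then 1 else 0)"
  by (simp_all add: zero_ell2.rep_eq plus_ell2.rep_eq uminus_ell2.rep_eq minus_ell2.rep_eq
    scaleC_ell2.rep_eq scaleR_ell2_def ket.rep_eq)

lemma ell2_eqI: "(\<And>i. coord \<xi> i = coord \<eta> i) \<Longrightarrow> \<xi> = \<eta>"
  by (simp add: coord_inject[symmetric] fun_eq_iff)

lemma cinner_self: "cinner \<xi> \<xi> = complex_of_real (\<Sum>\<^sub>\<infinity>i. (cmod (coord \<xi> i))\<^sup>2)"
proof -
  have "cinner \<xi> \<xi> = (\<Sum>\<^sub>\<infinity>i. complex_of_real ((cmod (coord \<xi> i))\<^sup>2))"
    unfolding cinner_def by (intro infsum_cong) (metis complex_norm_square mult.commute)
  also have "\<dots> = complex_of_real (\<Sum>\<^sub>\<infinity>i. (cmod (coord \<xi> i))\<^sup>2)"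
    using has_sum_of_real[OF has_sum_infsum[OF coord_summable[of \<xi>]]]
    by (rule infsumI)
  finally show ?thesis .
qed

lemma cinner_commute: "cinner \<xi> \<eta> = cnj (cinner \<eta> \<xi>)"
proof -
  have "cnj (cinner \<eta> \<xi>) = (\<Sum>\<^sub>\<infinity>i. cnj (cnj (coord \<eta> i) * coord \<xi> i))"
    unfolding cinner_def by (rule infsum_cnj[symmetric])
  also have "\<dots> = cinner \<xi> \<eta>"
    unfolding cinner_def by (intro infsum_cong) (simp add: mult.commute)
  finally show ?thesis
    by (rule HOL.sym)
qed

lemma cinner_add_left: "cinner (\<xi> + \<eta>) \<zeta> = cinner \<xi> \<zeta> + cinner \<eta> \<zeta>"
  using infsum_add[OF cinner_summable[of \<xi> \<zeta>] cinner_summable[of \<eta> \<zeta>]]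
  by (simp add: cinner_def distrib_right)

lemma cinner_add_right: "cinner \<zeta> (\<xi> + \<eta>) = cinner \<zeta> \<xi> + cinner \<zeta> \<eta>"
  using infsum_add[OF cinner_summable[of \<zeta> \<xi>] cinner_summable[of \<zeta> \<eta>]]
  by (simp add: cinner_def distrib_left)

lemma cinner_scaleC_right: "cinner \<xi> (c *\<^sub>C \<eta>) = c * cinner \<xi> \<eta>"
  by (simp add: cinner_def mult.left_commute infsum_cmult_right')

lemma cinner_scaleC_left: "cinner (c *\<^sub>C \<xi>) \<eta> = cnj c * cinner \<xi> \<eta>"
  by (simp add: cinner_def mult.assoc infsum_cmult_right')

instantiation ell2 :: (type) real_inner
begin

definition inner_ell2 :: "'i ell2 \<Rightarrow> 'i ell2 \<Rightarrow> real" where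
  "inner_ell2 \<xi> \<eta> = Re (cinner \<xi> \<eta>)"
definition norm_ell2 :: "'i ell2 \<Rightarrow> real" where
  "norm_ell2 \<xi> = sqrt (inner \<xi> \<xi>)"
definition dist_ell2 :: "'i ell2 \<Rightarrow> 'i ell2 \<Rightarrow> real" where
  "dist_ell2 \<xi> \<eta> = norm (\<xi> - \<eta>)"
definition sgn_ell2 :: "'i ell2 \<Rightarrow> 'i ell2" where
  "sgn_ell2 \<xi> = \<xi> /\<^sub>R norm \<xi>"
definition uniformity_ell2 :: "('i ell2 \<times> 'i ell2) filter" where
  "uniformity_ell2 = (INF e\<in>{0 <..}. principal {(x, y). dist x y < e})"
definition open_ell2 :: "'i ell2 set \<Rightarrow> bool" where
  "open_ell2 U \<longleftrightarrow> (\<forall>x\<in>U. eventually (\<lambda>(x', y). x' = x \<longrightarrow> y \<in> U) uniformity)"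

instance
proof
  fix \<xi> \<eta> \<zeta> :: "'i ell2" and r :: real
  show "inner \<xi> \<eta> = inner \<eta> \<xi>"
    unfolding inner_ell2_def by (subst cinner_commute) simp
  show "inner (\<xi> + \<eta>) \<zeta> = inner \<xi> \<zeta> + inner \<eta> \<zeta>"
    by (simp add: inner_ell2_def cinner_add_left)
  show "inner (r *\<^sub>R \<xi>) \<eta> = r * inner \<xi> \<eta>"
    by (simp add: inner_ell2_def scaleR_ell2_def cinner_scaleC_left)
  show "0 \<le> inner \<xi> \<xi>"
    by (simp add: inner_ell2_def cinner_self infsum_nonneg)
  show "inner \<xi> \<xi> = 0 \<longleftrightarrow> \<xi> = 0"
  proof
    assume "inner \<xi> \<xi> = 0"
    then have *: "(\<Sum>\<^sub>\<infinity>i. (cmod (coord \<xi> i))\<^sup>2) = 0"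
      by (simp add: inner_ell2_def cinner_self)
    have "(cmod (coord \<xi> i))\<^sup>2 = 0" for i
      by (rule nonneg_infsum_le_0D[where A = UNIV and f = "\<lambda>i. (cmod (coord \<xi> i))\<^sup>2"])
         (use * coord_summable in auto)
    then show "\<xi> = 0"
      by (intro ell2_eqI) auto
  qed (simp add: inner_ell2_def cinner_def)
qed (rule dist_ell2_def sgn_ell2_def norm_ell2_def uniformity_ell2_def open_ell2_def)+

end

lemma norm_ell2_sq: "(norm \<xi>)\<^sup>2 = (\<Sum>\<^sub>\<infinity>i. (cmod (coord \<xi> i))\<^sup>2)"
  by (simp add: norm_ell2_def inner_ell2_def cinner_self infsum_nonneg)

lemma norm_scaleC_ell2: "norm (c *\<^sub>C \<xi>) = cmod c * norm \<xi>"
proof -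
  have "(norm (c *\<^sub>C \<xi>))\<^sup>2 = (cmod c * norm \<xi>)\<^sup>2"
    by (simp add: norm_ell2_sq norm_mult power_mult_distrib infsum_cmult_right')
  then show ?thesis
    by (rule power2_eq_imp_eq) auto
qed


section \<open>Bounded operators\<close>

type_synonym 'i op = "'i ell2 \<Rightarrow>\<^sub>L 'i ell2"

text \<open>The elements of the type \<^typ>\<open>'i op\<close> are only real-linear.\<close>

definition BH :: "'i op set" where
  "BH = {T. \<forall>c \<xi>. blinfun_apply T (c *\<^sub>C \<xi>) = c *\<^sub>C blinfun_apply T \<xi>}"

lemma bounded_linear_scaleC_ell2: "bounded_linear (\<lambda>\<xi>::'i ell2. c *\<^sub>C \<xi>)"
  by (rule bounded_linear_intro[where K = "cmod c"])
     (auto intro!: ell2_eqI simp: algebra_simps norm_scaleC_ell2)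

definition op_scale :: "complex \<Rightarrow> 'i op \<Rightarrow> 'i op" where
  "op_scale c T = Blinfun (\<lambda>\<xi>. c *\<^sub>C T \<xi>)"

lemma op_scale_apply: "op_scale c T \<xi> = c *\<^sub>C T \<xi>"
  unfolding op_scale_def
  using bounded_linear_compose[OF bounded_linear_scaleC_ell2 blinfun.bounded_linear_right]
  by (subst bounded_linear_Blinfun_apply) (auto simp: o_def)

definition op_adj :: "'i op \<Rightarrow> 'i op" where
  "op_adj T = (THE S. S \<in> BH \<and> (\<forall>\<xi> \<eta>. cinner (S \<xi>) \<eta> = cinner \<xi> (T \<eta>)))"

definition op_pos :: "'i op \<Rightarrow> bool" where
  "op_pos T \<longleftrightarrow> T \<in> BH \<and> (\<forall>\<xi>. cinner \<xi> (T \<xi>) \<in> \<real>\<^sub>\<ge>\<^sub>0)"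

definition op_le :: "'i op \<Rightarrow> 'i op \<Rightarrow> bool" where
  "op_le S T \<longleftrightarrow> op_pos (T - S)"

definition op_power :: "'i op \<Rightarrow> nat \<Rightarrow> 'i op" where
  "op_power T n = ((\<lambda>S. T o\<^sub>L S) ^^ n) id_blinfun"

definition op_commutator :: "'i op \<Rightarrow> 'i op \<Rightarrow> 'i op" where
  "op_commutator S T = (S o\<^sub>L T) - (T o\<^sub>L S)"

definition unital_star_subalgebra :: "'i op set \<Rightarrow> bool" where
  "unital_star_subalgebra A \<longleftrightarrow>
     A \<subseteq> BH \<and> id_blinfun \<in> A \<and>
     (\<forall>x\<in>A. \<forall>y\<in>A. x + y \<in> A \<and> x o\<^sub>L y \<in> A) \<and>
     (\<forall>c. \<forall>x\<in>A. op_scale c x \<in> A) \<and> (\<forall>x\<in>A. op_adj x \<in> A)"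

definition commutant :: "'i op set \<Rightarrow> 'i op set" where
  "commutant A = {T\<in>BH. \<forall>S\<in>A. T o\<^sub>L S = S o\<^sub>L T}"

definition von_neumann_algebra :: "'i op set \<Rightarrow> bool" where
  "von_neumann_algebra N \<longleftrightarrow> unital_star_subalgebra N \<and> commutant (commutant N) = N"


section \<open>Weights and their modular groups\<close>

definition pos_part :: "'i op set \<Rightarrow> 'i op set" where
  "pos_part N = {x\<in>N. op_pos x}"

definition finite_pos :: "'i op set \<Rightarrow> ('i op \<Rightarrow> ennreal) \<Rightarrow> 'i op set" where
  "finite_pos N \<Phi> = {x \<in> pos_part N. \<Phi> x < \<infinity>}"

definition weight_dom :: "'i op set \<Rightarrow> ('i op \<Rightarrow> ennreal) \<Rightarrow> 'i op set" where
  "weight_dom N \<Phi> = module.span op_scale (finite_pos N \<Phi>)"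

definition weight :: "'i op set \<Rightarrow> ('i op \<Rightarrow> ennreal) \<Rightarrow> bool" where
  "weight N \<Phi> \<longleftrightarrow>
     (\<forall>x\<in>pos_part N. \<forall>y\<in>pos_part N. \<Phi> (x + y) = \<Phi> x + \<Phi> y) \<and>
     (\<forall>r\<ge>0. \<forall>x\<in>pos_part N. \<Phi> (r *\<^sub>R x) = ennreal r * \<Phi> x)"

definition faithful_weight :: "'i op set \<Rightarrow> ('i op \<Rightarrow> ennreal) \<Rightarrow> bool" where
  "faithful_weight N \<Phi> \<longleftrightarrow> (\<forall>x\<in>pos_part N. \<Phi> x = 0 \<longrightarrow> x = 0)"

text \<open>Suprema of bounded increasing nets of positive elements are preserved; the range of such
  a net is an upward directed set.\<close>

definition normal_weight :: "'i op set \<Rightarrow> ('i op \<Rightarrow> ennreal) \<Rightarrow> bool" where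
  "normal_weight N \<Phi> \<longleftrightarrow>
     (\<forall>D s. D \<noteq> {} \<and> D \<subseteq> pos_part N \<and>
            (\<forall>x\<in>D. \<forall>y\<in>D. \<exists>z\<in>D. op_le x z \<and> op_le y z) \<and>
            s \<in> pos_part N \<and> (\<forall>x\<in>D. op_le x s) \<and>
            (\<forall>u\<in>pos_part N. (\<forall>x\<in>D. op_le x u) \<longrightarrow> op_le s u)
        \<longrightarrow> \<Phi> s = (SUP x\<in>D. \<Phi> x))"

text \<open>The domain of the weight is dense in \<open>N\<close> for the weak operator topology. As the domain is
  convex, this is the same as density for the \<open>\<sigma>\<close>-weak topology.\<close>

definition semifinite_weight :: "'i op set \<Rightarrow> ('i op \<Rightarrow> ennreal) \<Rightarrow> bool" where
  "semifinite_weight N \<Phi> \<longleftrightarrow>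
     (\<forall>x\<in>N. \<forall>V. finite V \<longrightarrow> (\<forall>e>0. \<exists>y\<in>weight_dom N \<Phi>.
        \<forall>(\<xi>, \<eta>)\<in>V. cmod (cinner \<xi> ((x - y) \<eta>)) < e))"

definition fns_weight :: "'i op set \<Rightarrow> ('i op \<Rightarrow> ennreal) \<Rightarrow> bool" where
  "fns_weight N \<Phi> \<longleftrightarrow> weight N \<Phi> \<and> faithful_weight N \<Phi> \<and> normal_weight N \<Phi> \<and>
     semifinite_weight N \<Phi>"

text \<open>The linear extension of a weight to its domain.\<close>

definition weight_ext :: "'i op set \<Rightarrow> ('i op \<Rightarrow> ennreal) \<Rightarrow> 'i op \<Rightarrow> complex" where
  "weight_ext N \<Phi> x = (THE c. \<exists>x1\<in>finite_pos N \<Phi>. \<exists>x2\<in>finite_pos N \<Phi>.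
      \<exists>x3\<in>finite_pos N \<Phi>. \<exists>x4\<in>finite_pos N \<Phi>.
        x = (x1 - x2) + op_scale \<i> (x3 - x4) \<and>
        c = Complex (enn2real (\<Phi> x1) - enn2real (\<Phi> x2)) (enn2real (\<Phi> x3) - enn2real (\<Phi> x4)))"

text \<open>The intersection of the left ideal of \<open>\<Phi>\<close>-square-integrable elements with its adjoint.\<close>

definition square_int :: "'i op set \<Rightarrow> ('i op \<Rightarrow> ennreal) \<Rightarrow> 'i op set" where
  "square_int N \<Phi> = {x\<in>N. \<Phi> (op_adj x o\<^sub>L x) < \<infinity> \<and> \<Phi> (x o\<^sub>L op_adj x) < \<infinity>}"

definition star_automorphism :: "'i op set \<Rightarrow> ('i op \<Rightarrow> 'i op) \<Rightarrow> bool" where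
  "star_automorphism N \<theta> \<longleftrightarrow> bij_betw \<theta> N N \<and>
     (\<forall>x\<in>N. \<forall>y\<in>N. \<theta> (x + y) = \<theta> x + \<theta> y \<and> \<theta> (x o\<^sub>L y) = \<theta> x o\<^sub>L \<theta> y) \<and>
     (\<forall>c. \<forall>x\<in>N. \<theta> (op_scale c x) = op_scale c (\<theta> x)) \<and>
     (\<forall>x\<in>N. \<theta> (op_adj x) = op_adj (\<theta> x))"

definition one_parameter_automorphism_group ::
    "'i op set \<Rightarrow> (real \<Rightarrow> 'i op \<Rightarrow> 'i op) \<Rightarrow> bool" where
  "one_parameter_automorphism_group N \<sigma> \<longleftrightarrow>
     (\<forall>t. star_automorphism N (\<sigma> t)) \<and>
     (\<forall>x\<in>N. \<sigma> 0 x = x) \<and> (\<forall>s t. \<forall>x\<in>N. \<sigma> (s + t) x = \<sigma> s (\<sigma> t x)) \<and>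
     (\<forall>x\<in>N. \<forall>\<xi> \<eta>. continuous_on UNIV (\<lambda>t. cinner \<xi> (\<sigma> t x \<eta>)))"

text \<open>The modular group of a faithful normal semifinite weight is the unique one-parameter
  automorphism group leaving the weight invariant and satisfying the modular (KMS) condition,
  in the sign convention for which the modular group of \<open>Tr(K\<cdot>)\<close> is \<open>x \<mapsto> K\<^bsup>it\<^esup> x K\<^bsup>-it\<^esup>\<close>.\<close>

definition modular_group ::
    "'i op set \<Rightarrow> ('i op \<Rightarrow> ennreal) \<Rightarrow> (real \<Rightarrow> 'i op \<Rightarrow> 'i op) \<Rightarrow> bool" where
  "modular_group N \<Phi> \<sigma> \<longleftrightarrow>
     one_parameter_automorphism_group N \<sigma> \<and>
     (\<forall>t. \<forall>x\<in>pos_part N. \<Phi> (\<sigma> t x) = \<Phi> x) \<and>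
     (\<forall>x\<in>square_int N \<Phi>. \<forall>y\<in>square_int N \<Phi>. \<exists>G :: complex \<Rightarrow> complex.
        continuous_on {z. 0 \<le> Im z \<and> Im z \<le> 1} G \<and>
        bounded (G ` {z. 0 \<le> Im z \<and> Im z \<le> 1}) \<and>
        G holomorphic_on {z. 0 < Im z \<and> Im z < 1} \<and>
        (\<forall>t::real. G (of_real t) = weight_ext N \<Phi> (\<sigma> t x o\<^sub>L y) \<and>
                   G (of_real t + \<i>) = weight_ext N \<Phi> (y o\<^sub>L \<sigma> t x)))"

definition fixed_point_algebra :: "'i op set \<Rightarrow> (real \<Rightarrow> 'i op \<Rightarrow> 'i op) \<Rightarrow> 'i op set" where
  "fixed_point_algebra N \<sigma> = {x\<in>N. \<forall>t. \<sigma> t x = x}"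

text \<open>The orbit extends to an entire function. For functions on the complex plane, being
  holomorphic for the weak operator topology and for the norm are the same.\<close>

definition analytic_vector :: "'i op set \<Rightarrow> (real \<Rightarrow> 'i op \<Rightarrow> 'i op) \<Rightarrow> 'i op \<Rightarrow> bool" where
  "analytic_vector N \<sigma> x \<longleftrightarrow>
     (\<exists>f :: complex \<Rightarrow> 'i op. (\<forall>z. f z \<in> N) \<and> (\<forall>t. f (of_real t) = \<sigma> t x) \<and>
        (\<forall>\<xi> \<eta>. (\<lambda>z. cinner \<xi> (f z \<eta>)) holomorphic_on UNIV))"


section \<open>Modular Fredholm modules\<close>

record 'x star_algebra = "(complex, 'x) module" +
  star :: "'x \<Rightarrow> 'x"

definition star_representation :: "('x, 'm) star_algebra_scheme \<Rightarrow> ('x \<Rightarrow> 'i op) \<Rightarrow> bool" where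
  "star_representation A \<pi> \<longleftrightarrow>
     \<pi> ` carrier A \<subseteq> BH \<and> \<pi> \<one>\<^bsub>A\<^esub> = id_blinfun \<and>
     (\<forall>x\<in>carrier A. \<forall>y\<in>carrier A.
        \<pi> (x \<oplus>\<^bsub>A\<^esub> y) = \<pi> x + \<pi> y \<and> \<pi> (x \<otimes>\<^bsub>A\<^esub> y) = \<pi> x o\<^sub>L \<pi> y) \<and>
     (\<forall>c. \<forall>x\<in>carrier A. \<pi> (c \<odot>\<^bsub>A\<^esub> x) = op_scale c (\<pi> x)) \<and>
     (\<forall>x\<in>carrier A. \<pi> (star A x) = op_adj (\<pi> x))"

text \<open>The algebra is identified with its image under the representation. Separability refers to
  the norm topology.\<close>

definition modular_fredholm_module ::
    "nat \<Rightarrow> 'i op set \<Rightarrow> ('i op \<Rightarrow> ennreal) \<Rightarrow> ('x, 'm) star_algebra_scheme \<Rightarrow>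
     ('x \<Rightarrow> 'i op) \<Rightarrow> 'i op \<Rightarrow> bool" where
  "modular_fredholm_module n N \<Phi> A \<pi> F \<longleftrightarrow>
     von_neumann_algebra N \<and> fns_weight N \<Phi> \<and> star_representation A \<pi> \<and>
     \<pi> ` carrier A \<subseteq> N \<and> unital_star_subalgebra (\<pi> ` carrier A) \<and>
     separable_space (top_of_set (\<pi> ` carrier A)) \<and>
     (\<exists>\<sigma>. modular_group N \<Phi> \<sigma> \<and>
        (\<forall>t. \<sigma> t ` \<pi> ` carrier A = \<pi> ` carrier A) \<and>
        (\<forall>x\<in>\<pi> ` carrier A. analytic_vector N \<sigma> x) \<and>
        F \<in> fixed_point_algebra N \<sigma>) \<and>
     op_adj F = F \<and> F o\<^sub>L F = id_blinfun \<and>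
     (\<forall>x\<in>\<pi> ` carrier A. op_power (op_commutator F x) n \<in> weight_dom N \<Phi>)"


section \<open>The algebra of functions on quantum SU(2)\<close>

text \<open>The universal algebra is the term algebra on two generators modulo the congruence generated
  by the axioms of complex unital \<open>*\<close>-algebras and the defining relations.\<close>

datatype suq2_term =
    Gen_a | Gen_b | Tm_zero | Tm_one
  | Tm_plus suq2_term suq2_term | Tm_times suq2_term suq2_term
  | Tm_scale complex suq2_term | Tm_star suq2_term

inductive suq2_eq :: "real \<Rightarrow> suq2_term \<Rightarrow> suq2_term \<Rightarrow> bool" for q where
  refl: "suq2_eq q x x"
| sym: "suq2_eq q x y \<Longrightarrow> suq2_eq q y x"
| trans: "suq2_eq q x y \<Longrightarrow> suq2_eq q y z \<Longrightarrow> suq2_eq q x z"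
| plus_cong: "suq2_eq q x x' \<Longrightarrow> suq2_eq q y y' \<Longrightarrow> suq2_eq q (Tm_plus x y) (Tm_plus x' y')"
| times_cong: "suq2_eq q x x' \<Longrightarrow> suq2_eq q y y' \<Longrightarrow> suq2_eq q (Tm_times x y) (Tm_times x' y')"
| scale_cong: "suq2_eq q x x' \<Longrightarrow> suq2_eq q (Tm_scale c x) (Tm_scale c x')"
| star_cong: "suq2_eq q x x' \<Longrightarrow> suq2_eq q (Tm_star x) (Tm_star x')"
| plus_assoc: "suq2_eq q (Tm_plus (Tm_plus x y) z) (Tm_plus x (Tm_plus y z))"
| plus_commute: "suq2_eq q (Tm_plus x y) (Tm_plus y x)"
| plus_zero: "suq2_eq q (Tm_plus Tm_zero x) x"
| scale_plus_right: "suq2_eq q (Tm_scale c (Tm_plus x y)) (Tm_plus (Tm_scale c x) (Tm_scale c y))"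
| scale_plus_left: "suq2_eq q (Tm_scale (c + d) x) (Tm_plus (Tm_scale c x) (Tm_scale d x))"
| scale_scale: "suq2_eq q (Tm_scale c (Tm_scale d x)) (Tm_scale (c * d) x)"
| scale_one: "suq2_eq q (Tm_scale 1 x) x"
| scale_zero: "suq2_eq q (Tm_scale 0 x) Tm_zero"
| times_assoc: "suq2_eq q (Tm_times (Tm_times x y) z) (Tm_times x (Tm_times y z))"
| one_times: "suq2_eq q (Tm_times Tm_one x) x"
| times_one: "suq2_eq q (Tm_times x Tm_one) x"
| times_plus_left: "suq2_eq q (Tm_times (Tm_plus x y) z) (Tm_plus (Tm_times x z) (Tm_times y z))"
| times_plus_right: "suq2_eq q (Tm_times x (Tm_plus y z)) (Tm_plus (Tm_times x y) (Tm_times x z))"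
| scale_times_left: "suq2_eq q (Tm_times (Tm_scale c x) y) (Tm_scale c (Tm_times x y))"
| scale_times_right: "suq2_eq q (Tm_times x (Tm_scale c y)) (Tm_scale c (Tm_times x y))"
| star_star: "suq2_eq q (Tm_star (Tm_star x)) x"
| star_plus: "suq2_eq q (Tm_star (Tm_plus x y)) (Tm_plus (Tm_star x) (Tm_star y))"
| star_scale: "suq2_eq q (Tm_star (Tm_scale c x)) (Tm_scale (cnj c) (Tm_star x))"
| star_times: "suq2_eq q (Tm_star (Tm_times x y)) (Tm_times (Tm_star y) (Tm_star x))"
| rel_ba: "suq2_eq q (Tm_times Gen_b Gen_a) (Tm_scale (of_real q) (Tm_times Gen_a Gen_b))"
| rel_b_normal: "suq2_eq q (Tm_times Gen_b (Tm_star Gen_b)) (Tm_times (Tm_star Gen_b) Gen_b)"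
| rel_bstar_a: "suq2_eq q (Tm_times (Tm_star Gen_b) Gen_a)
                          (Tm_scale (of_real q) (Tm_times Gen_a (Tm_star Gen_b)))"
| rel_sphere: "suq2_eq q (Tm_plus (Tm_times Gen_a (Tm_star Gen_a))
                                  (Tm_times Gen_b (Tm_star Gen_b))) Tm_one"
| rel_sphere': "suq2_eq q (Tm_plus (Tm_times (Tm_star Gen_a) Gen_a)
                   (Tm_scale (of_real (q\<^sup>2)) (Tm_times Gen_b (Tm_star Gen_b)))) Tm_one"

definition suq2_class :: "real \<Rightarrow> suq2_term \<Rightarrow> suq2_term set" where
  "suq2_class q x = {y. suq2_eq q x y}"

definition suq2 :: "real \<Rightarrow> suq2_term set star_algebra" where
  "suq2 q = \<lparr>carrier = range (suq2_class q),
     mult = (\<lambda>X Y. \<Union>x\<in>X. \<Union>y\<in>Y. suq2_class q (Tm_times x y)),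
     one = suq2_class q Tm_one,
     zero = suq2_class q Tm_zero,
     add = (\<lambda>X Y. \<Union>x\<in>X. \<Union>y\<in>Y. suq2_class q (Tm_plus x y)),
     smult = (\<lambda>c X. \<Union>x\<in>X. suq2_class q (Tm_scale c x)),
     star = (\<lambda>X. \<Union>x\<in>X. suq2_class q (Tm_star x))\<rparr>"


section \<open>The representation, the phase and the weight\<close>

text \<open>The Hilbert space \<open>\<ell>\<^sup>2(\<nat>) \<otimes> \<ell>\<^sup>2(\<int>)\<close> is the type \<^typ>\<open>(nat \<times> int) ell2\<close>, with
  orthonormal basis \<open>e\<^bsub>k,l\<^esub> = ket (k, l)\<close>.\<close>

definition basis_op :: "('i \<Rightarrow> 'i ell2) \<Rightarrow> 'i op" where
  "basis_op g = (THE T. T \<in> BH \<and> (\<forall>i. T (ket i) = g i))"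

definition op_a :: "real \<Rightarrow> (nat \<times> int) op" where
  "op_a q = basis_op (\<lambda>(k, l). complex_of_real (sqrt (1 - q ^ (2 * k + 2))) *\<^sub>C ket (k + 1, l))"

definition op_b :: "real \<Rightarrow> (nat \<times> int) op" where
  "op_b q = basis_op (\<lambda>(k, l). complex_of_real (q ^ k) *\<^sub>C ket (k, l + 1))"

definition op_F :: "(nat \<times> int) op" where
  "op_F = basis_op (\<lambda>(k, l). (if 0 \<le> l then 1 else - 1) *\<^sub>C ket (k, l))"

primrec pi0_term :: "real \<Rightarrow> suq2_term \<Rightarrow> (nat \<times> int) op" where
  "pi0_term q Gen_a = op_a q"
| "pi0_term q Gen_b = op_b q"
| "pi0_term q Tm_zero = 0"
| "pi0_term q Tm_one = id_blinfun"
| "pi0_term q (Tm_plus x y) = pi0_term q x + pi0_term q y"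
| "pi0_term q (Tm_times x y) = pi0_term q x o\<^sub>L pi0_term q y"
| "pi0_term q (Tm_scale c x) = op_scale c (pi0_term q x)"
| "pi0_term q (Tm_star x) = op_adj (pi0_term q x)"

definition pi0 :: "real \<Rightarrow> suq2_term set \<Rightarrow> (nat \<times> int) op" where
  "pi0 q X = the_elem (pi0_term q ` X)"

text \<open>Diagonal operators, possibly unbounded; the value is meaningful only for vectors \<open>\<xi>\<close>
  with \<open>(d i * coord \<xi> i)\<^sub>i\<close> square-summable. For \<open>d \<ge> 0\<close> the square root is obtained by taking the
  square root of \<open>d\<close>.\<close>

definition diag_op :: "('i \<Rightarrow> real) \<Rightarrow> 'i ell2 \<Rightarrow> 'i ell2" where
  "diag_op d \<xi> = Abs_ell2 (\<lambda>i. complex_of_real (d i) * coord \<xi> i)"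

definition K_eigenvalue :: "real \<Rightarrow> nat \<times> int \<Rightarrow> real" where
  "K_eigenvalue q = (\<lambda>(k, l). q powi (- 2 * int k))"

definition op_K :: "real \<Rightarrow> (nat \<times> int) ell2 \<Rightarrow> (nat \<times> int) ell2" where
  "op_K q = diag_op (K_eigenvalue q)"

definition op_sqrt_K :: "real \<Rightarrow> (nat \<times> int) ell2 \<Rightarrow> (nat \<times> int) ell2" where
  "op_sqrt_K q = diag_op (\<lambda>i. sqrt (K_eigenvalue q i))"

text \<open>\<open>Tr(K\<^bsup>1/2\<^esup> T K\<^bsup>1/2\<^esup>)\<close>, the trace being computed in the standard basis. Since \<open>K\<^bsup>1/2\<^esup>\<close> is
  unbounded, the diagonal entries of \<open>K\<^bsup>1/2\<^esup> T K\<^bsup>1/2\<^esup>\<close> are understood in the sense of forms.\<close>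

definition weight_K :: "real \<Rightarrow> (nat \<times> int) op \<Rightarrow> ennreal" where
  "weight_K q T = (\<Sum>\<^sub>\<infinity>i. ennreal (Re (cinner (op_sqrt_K q (ket i)) (T (op_sqrt_K q (ket i))))))"


subsection \<open>Well-definedness of the operators\<close>

lemma diag_op_ket: "diag_op d (ket i) = complex_of_real (d i) *\<^sub>C ket i"
proof -
  have "(\<lambda>j. complex_of_real (d j) * coord (ket i) j) = coord (complex_of_real (d i) *\<^sub>C ket i)"
    by auto
  then show ?thesis
    unfolding diag_op_def by (simp only: coord_inverse)
qed

lemma op_K_ket: "op_K q (ket (k, l)) = complex_of_real (q powi (- 2 * int k)) *\<^sub>C ket (k, l)"
  unfolding op_K_def diag_op_ket K_eigenvalue_def by simp

lemma op_sqrt_K_ket: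
  "op_sqrt_K q (ket i) = complex_of_real (sqrt (K_eigenvalue q i)) *\<^sub>C ket i"
  unfolding op_sqrt_K_def by (rule diag_op_ket)

lemma op_sqrt_K_sqrt_K_ket:
  assumes "0 < q"
  shows "op_sqrt_K q (op_sqrt_K q (ket i)) = op_K q (ket i)"
proof -
  have "0 \<le> K_eigenvalue q i"
    using assms by (simp add: K_eigenvalue_def case_prod_beta)
  then have "complex_of_real (sqrt (K_eigenvalue q i)) * complex_of_real (sqrt (K_eigenvalue q i)) =
      complex_of_real (K_eigenvalue q i)"
    by (simp flip: of_real_mult)
  then have "(\<lambda>j. complex_of_real (sqrt (K_eigenvalue q j)) *
      coord (complex_of_real (sqrt (K_eigenvalue q i)) *\<^sub>C ket i) j) =
    coord (complex_of_real (K_eigenvalue q i) *\<^sub>C ket i)"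
    by auto
  then show ?thesis
    unfolding op_sqrt_K_ket op_K_def diag_op_ket
    unfolding op_sqrt_K_def diag_op_def by (simp only: coord_inverse)
qed

lemma wshift_summable:
  fixes p :: "'i \<Rightarrow> 'i" and w :: "'i \<Rightarrow> complex"
  assumes p: "inj p" and w: "\<And>i. cmod (w i) \<le> C"
  defines "g \<equiv> \<lambda>\<xi> j. if j \<in> range p then w (inv_into UNIV p j) * coord \<xi> (inv_into UNIV p j) else 0"
  shows "(\<lambda>j. (cmod (g \<xi> j))\<^sup>2) summable_on UNIV"
    and "(\<Sum>\<^sub>\<infinity>j. (cmod (g \<xi> j))\<^sup>2) \<le> (C * norm \<xi>)\<^sup>2"
proof -
  have C: "0 \<le> C"
    using w[of undefined] norm_ge_zero order_trans by blast
  have gp: "g \<xi> (p i) = w i * coord \<xi> i" for i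
    by (simp add: g_def p)
  have le: "(cmod (w i * coord \<xi> i))\<^sup>2 \<le> C\<^sup>2 * (cmod (coord \<xi> i))\<^sup>2" for i
    unfolding norm_mult power_mult_distrib using w[of i] by (intro mult_right_mono power_mono) auto
  have sC: "(\<lambda>i. C\<^sup>2 * (cmod (coord \<xi> i))\<^sup>2) summable_on UNIV"
    by (rule summable_on_cmult_right[OF coord_summable])
  have s: "(\<lambda>i. (cmod (w i * coord \<xi> i))\<^sup>2) summable_on UNIV"
    by (rule summable_on_comparison_test[OF sC]) (use le in auto)
  have comp: "(\<lambda>j. (cmod (g \<xi> j))\<^sup>2) \<circ> p = (\<lambda>i. (cmod (w i * coord \<xi> i))\<^sup>2)"
    by (simp add: fun_eq_iff gp)
  have sr: "(\<lambda>j. (cmod (g \<xi> j))\<^sup>2) summable_on range p"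
    using s summable_on_reindex[OF p, of "\<lambda>j. (cmod (g \<xi> j))\<^sup>2"] comp by simp
  show "(\<lambda>j. (cmod (g \<xi> j))\<^sup>2) summable_on UNIV"
    by (rule summable_on_cong_neutral[THEN iffD1, OF _ _ _ sr]) (auto simp: g_def)
  have "(\<Sum>\<^sub>\<infinity>j. (cmod (g \<xi> j))\<^sup>2) = (\<Sum>\<^sub>\<infinity>j\<in>range p. (cmod (g \<xi> j))\<^sup>2)"
    by (rule infsum_cong_neutral) (auto simp: g_def)
  also have "\<dots> = (\<Sum>\<^sub>\<infinity>i. (cmod (w i * coord \<xi> i))\<^sup>2)"
    using infsum_reindex[OF p, of "\<lambda>j. (cmod (g \<xi> j))\<^sup>2"] comp by simp
  also have "\<dots> \<le> (\<Sum>\<^sub>\<infinity>i. C\<^sup>2 * (cmod (coord \<xi> i))\<^sup>2)"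
    by (rule infsum_mono[OF s sC le])
  also have "\<dots> = (C * norm \<xi>)\<^sup>2"
    by (simp add: power_mult_distrib norm_ell2_sq infsum_cmult_right')
  finally show "(\<Sum>\<^sub>\<infinity>j. (cmod (g \<xi> j))\<^sup>2) \<le> (C * norm \<xi>)\<^sup>2" .
qed

lemma ex_wshift:
  fixes p :: "'i \<Rightarrow> 'i" and w :: "'i \<Rightarrow> complex"
  assumes p: "inj p" and w: "\<And>i. cmod (w i) \<le> C"
  shows "\<exists>T\<in>BH. \<forall>i. blinfun_apply T (ket i) = w i *\<^sub>C ket (p i)"
proof -
  define g where "g = (\<lambda>\<xi> j. if j \<in> range p then w (inv_into UNIV p j) * coord \<xi> (inv_into UNIV p j) else 0)"
  define f where "f = (\<lambda>\<xi>. Abs_ell2 (g \<xi>))"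
  have C: "0 \<le> C"
    using w[of undefined] norm_ge_zero order_trans by blast
  have coord_f: "coord (f \<xi>) = g \<xi>" for \<xi>
    unfolding f_def
    by (rule Abs_ell2_inverse) (use wshift_summable(1)[OF p w, where \<xi> = \<xi>] in \<open>simp add: g_def\<close>)
  have norm_f: "norm (f \<xi>) \<le> C * norm \<xi>" for \<xi>
  proof (rule power2_le_imp_le)
    show "(norm (f \<xi>))\<^sup>2 \<le> (C * norm \<xi>)\<^sup>2"
      unfolding norm_ell2_sq[of "f \<xi>"] coord_f
      using wshift_summable(2)[OF p w, where \<xi> = \<xi>] by (simp add: g_def)
  qed (use C in simp)
  have "bounded_linear f"
    by (rule bounded_linear_intro[where K = C])
       (auto intro!: ell2_eqI simp: coord_f g_def algebra_simps norm_f)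
  then have app: "blinfun_apply (Blinfun f) = f"
    by (rule bounded_linear_Blinfun_apply)
  have "Blinfun f \<in> BH"
    unfolding BH_def by (auto intro!: ell2_eqI simp: app coord_f g_def)
  moreover have "f (ket i) = w i *\<^sub>C ket (p i)" for i
    by (rule ell2_eqI) (auto simp: coord_f g_def p)
  ultimately show ?thesis
    using app by (intro bexI[of _ "Blinfun f"]) auto
qed

lemma coord_sum: "coord (\<Sum>a\<in>A. h a) i = (\<Sum>a\<in>A. coord (h a) i)"
  by (induction A rule: infinite_finite_induct) auto

lemma BH_eqI:
  fixes S T :: "'i op"
  assumes S: "S \<in> BH" and T: "T \<in> BH" and eq: "\<And>i. blinfun_apply S (ket i) = blinfun_apply T (ket i)"
  shows "S = T"
proof (rule blinfun_eqI)
  fix \<xi> :: "'i ell2"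
  define tr where "tr = (\<lambda>A. \<Sum>i\<in>A. coord \<xi> i *\<^sub>C ket i)"
  have lim: "(tr \<longlongrightarrow> \<xi>) (finite_subsets_at_top UNIV)"
  proof (rule Lim_null[THEN iffD2], rule tendsto_norm_zero_cancel)
    have sq: "(norm (tr A - \<xi>))\<^sup>2 =
      (\<Sum>\<^sub>\<infinity>i. (cmod (coord \<xi> i))\<^sup>2) - (\<Sum>i\<in>A. (cmod (coord \<xi> i))\<^sup>2)" if A: "finite A" for A
    proof -
      have c: "coord (tr A) i = (if i \<in> A then coord \<xi> i else 0)" for i
        using A by (simp add: tr_def coord_sum if_distrib cong: if_cong)
      have "(norm (tr A - \<xi>))\<^sup>2 = (\<Sum>\<^sub>\<infinity>i\<in>UNIV - A. (cmod (coord \<xi> i))\<^sup>2)"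
        unfolding norm_ell2_sq by (rule infsum_cong_neutral) (auto simp: c)
      also have "\<dots> = (\<Sum>\<^sub>\<infinity>i. (cmod (coord \<xi> i))\<^sup>2) - (\<Sum>\<^sub>\<infinity>i\<in>A. (cmod (coord \<xi> i))\<^sup>2)"
        by (rule infsum_Diff) (use A coord_summable in auto)
      finally show ?thesis
        using A by simp
    qed
    have "((\<lambda>A. \<Sum>i\<in>A. (cmod (coord \<xi> i))\<^sup>2) \<longlongrightarrow> (\<Sum>\<^sub>\<infinity>i. (cmod (coord \<xi> i))\<^sup>2))
        (finite_subsets_at_top UNIV)"
      by (rule infsum_tendsto[OF coord_summable])
    then have "((\<lambda>A. sqrt ((\<Sum>\<^sub>\<infinity>i. (cmod (coord \<xi> i))\<^sup>2) - (\<Sum>i\<in>A. (cmod (coord \<xi> i))\<^sup>2)))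
        \<longlongrightarrow> sqrt ((\<Sum>\<^sub>\<infinity>i. (cmod (coord \<xi> i))\<^sup>2) - (\<Sum>\<^sub>\<infinity>i. (cmod (coord \<xi> i))\<^sup>2)))
        (finite_subsets_at_top UNIV)"
      by (intro tendsto_intros)
    moreover have ev: "sqrt ((\<Sum>\<^sub>\<infinity>i. (cmod (coord \<xi> i))\<^sup>2) - (\<Sum>i\<in>A. (cmod (coord \<xi> i))\<^sup>2)) =
        norm (tr A - \<xi>)" if "finite A" for A
      using sq[OF that] by (metis norm_ge_zero real_sqrt_unique)
    ultimately show "((\<lambda>A. norm (tr A - \<xi>)) \<longlongrightarrow> 0) (finite_subsets_at_top UNIV)"
      by (simp add: tendsto_cong[OF eventually_finite_subsets_at_top_weakI, OF ev])
  qed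
  have fin: "S (tr A) = T (tr A)" for A
    using S T eq by (simp add: tr_def blinfun.sum_right BH_def)
  have "((\<lambda>A. S (tr A)) \<longlongrightarrow> S \<xi>) (finite_subsets_at_top UNIV)"
    "((\<lambda>A. S (tr A)) \<longlongrightarrow> T \<xi>) (finite_subsets_at_top UNIV)"
    using blinfun.tendsto[OF tendsto_const lim, of S] blinfun.tendsto[OF tendsto_const lim, of T] fin
    by simp_all
  then show "S \<xi> = T \<xi>"
    using tendsto_unique finite_subsets_at_top_neq_bot by blast
qed

lemma basis_op_wshift:
  assumes "inj p" and "\<And>i. cmod (w i) \<le> C"
  shows "basis_op (\<lambda>i. w i *\<^sub>C ket (p i)) \<in> BH"
    and "blinfun_apply (basis_op (\<lambda>i. w i *\<^sub>C ket (p i))) (ket i) = w i *\<^sub>C ket (p i)"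
proof -
  have "\<exists>!T. T \<in> BH \<and> (\<forall>i. blinfun_apply T (ket i) = w i *\<^sub>C ket (p i))"
    using ex_wshift[of p w C, OF assms] by (auto intro!: BH_eqI)
  from theI'[OF this] show "basis_op (\<lambda>i. w i *\<^sub>C ket (p i)) \<in> BH"
    "blinfun_apply (basis_op (\<lambda>i. w i *\<^sub>C ket (p i))) (ket i) = w i *\<^sub>C ket (p i)"
    unfolding basis_op_def by auto
qed

lemma op_a:
  assumes "0 < q" "q < 1"
  shows "op_a q \<in> BH"
    and "op_a q (ket (k, l)) = complex_of_real (sqrt (1 - q ^ (2 * k + 2))) *\<^sub>C ket (k + 1, l)"
proof -
  let ?w = "\<lambda>(k, l::int). complex_of_real (sqrt (1 - q ^ (2 * k + 2)))"
  let ?p = "\<lambda>(k::nat, l::int). (k + 1, l)"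
  have eq: "op_a q = basis_op (\<lambda>i. ?w i *\<^sub>C ket (?p i))"
    unfolding op_a_def by (rule arg_cong[where f = basis_op]) auto
  have w: "cmod (?w i) \<le> 1" for i
    using assms power_le_one[of q "2 * fst i + 2"] by (auto simp: case_prod_beta abs_le_iff real_sqrt_ge_0_iff)
  have p: "inj ?p"
    by (auto simp: inj_on_def)
  show "op_a q \<in> BH"
    unfolding eq by (rule basis_op_wshift(1)[OF p w])
  show "op_a q (ket (k, l)) = complex_of_real (sqrt (1 - q ^ (2 * k + 2))) *\<^sub>C ket (k + 1, l)"
    unfolding eq basis_op_wshift(2)[OF p w] by simp
qed

lemma op_b:
  assumes "0 < q" "q < 1"
  shows "op_b q \<in> BH"
    and "op_b q (ket (k, l)) = complex_of_real (q ^ k) *\<^sub>C ket (k, l + 1)"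
proof -
  let ?w = "\<lambda>(k, l::int). complex_of_real (q ^ k)"
  let ?p = "\<lambda>(k::nat, l::int). (k, l + 1)"
  have eq: "op_b q = basis_op (\<lambda>i. ?w i *\<^sub>C ket (?p i))"
    unfolding op_b_def by (rule arg_cong[where f = basis_op]) auto
  have w: "cmod (?w i) \<le> 1" for i
    using assms by (auto simp: case_prod_beta norm_power power_le_one)
  have p: "inj ?p"
    by (auto simp: inj_on_def)
  show "op_b q \<in> BH"
    unfolding eq by (rule basis_op_wshift(1)[OF p w])
  show "op_b q (ket (k, l)) = complex_of_real (q ^ k) *\<^sub>C ket (k, l + 1)"
    unfolding eq basis_op_wshift(2)[OF p w] by simp
qed

lemma op_F:
  shows "op_F \<in> BH" and "op_F (ket (k, l)) = (if 0 \<le> l then 1 else - 1) *\<^sub>C ket (k, l)"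
proof -
  let ?w = "\<lambda>(k::nat, l::int). if 0 \<le> l then 1 else - 1 :: complex"
  have eq: "op_F = basis_op (\<lambda>i. ?w i *\<^sub>C ket (id i))"
    unfolding op_F_def by (rule arg_cong[where f = basis_op]) auto
  have w: "cmod (?w i) \<le> 1" for i
    by (auto simp: case_prod_beta)
  show "op_F \<in> BH"
    unfolding eq by (rule basis_op_wshift(1)[OF inj_on_id w])
  show "op_F (ket (k, l)) = (if 0 \<le> l then 1 else - 1) *\<^sub>C ket (k, l)"
    unfolding eq basis_op_wshift(2)[OF inj_on_id w] by simp
qed

end

theory Submission
  imports Defs "HOL-Complex_Analysis.Cauchy_Integral_Formula"
begin

text \<open>With respect to the standard basis the weight is diagonal with positive eigenvalues
  \<open>\<lambda>\<^sub>i\<close>. For every such weight \<open>\<Phi>\<close>, polarization writes \<open>X\<^sup>*Y\<close> as a combination of four positive elements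
  of finite weight as soon as \<open>\<Phi>(X\<^sup>*X)\<close> and \<open>\<Phi>(Y\<^sup>*Y)\<close> are finite, and
  \<open>\<sigma>\<^sub>t(x) = K\<^bsup>it\<^esup> x K\<^bsup>-it\<^esup>\<close> is the modular group, the KMS function being the absolutely convergent double
  series \<open>\<Sum> \<lambda>\<^sub>i (\<lambda>\<^sub>i / \<lambda>\<^sub>j)\<^bsup>iz\<^esup> x\<^sub>i\<^sub>j y\<^sub>j\<^sub>i\<close>.

  The image of \<open>\<A>(SU\<^sub>q(2))\<close> is spanned by weighted shifts of the basis. On a shift by \<open>m\<close> in the
  direction \<open>k\<close> the modular group acts by a character, which gives invariance and analyticity.
  A shift by \<open>n \<noteq> 0\<close> in the direction \<open>l\<close> has weights \<open>O(q\<^sup>k)\<close>, and its commutator with \<open>F\<close> lives on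
  \<open>\<bar>l\<bar> \<le> \<bar>n\<bar>\<close>; a shift with \<open>n = 0\<close> commutes with \<open>F\<close>. So \<open>[F, x]\<^sup>3\<close> is a sum of shifts with weights
  \<open>O(q\<^bsup>3k\<^esup>)\<close> on finitely many \<open>l\<close>, against which the growth \<open>q\<^bsup>-2k\<^esup>\<close> of \<open>K\<close> is summable.\<close>

section \<open>Operators and their matrix entries\<close>

text \<open>Two features of the definitions shape the proof. The adjoint and the linear extension of
  the weight are definite descriptions, so each needs unique existence before any use; and normality
  speaks of order suprema, so a weak limit has to be built and compared with the given supremum. The
  universal algebra enters only through terms: the relations are checked on operators, and the rest
  is induction on terms. A normal form for algebra elements is avoided because homogeneous operators
  are closed under products and adjoints. The domain of the weight is a span of positive elements,
  while a shift is in general not positive; it is reached by factoring the shift into two elements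
  of the left ideal of the weight, each carrying half of the decay. The exponent 3 fits this
  estimate: \<open>q^(3 k)\<close> against \<open>q^(-2 k)\<close> leaves a geometric series,
  whereas the bound for a square would leave a constant.\<close>

lemma cinner_minus_right: "cinner \<xi> (- \<eta>) = - cinner \<xi> \<eta>"
  by (simp add: cinner_def infsum_uminus)

lemma cinner_minus_left: "cinner (- \<xi>) \<eta> = - cinner \<xi> \<eta>"
  by (simp add: cinner_def infsum_uminus)

lemma cinner_diff_right: "cinner \<xi> (\<eta> - \<zeta>) = cinner \<xi> \<eta> - cinner \<xi> \<zeta>"
  using cinner_add_right[of \<xi> \<eta> "- \<zeta>"] by (simp add: cinner_minus_right)

lemma cinner_diff_left: "cinner (\<eta> - \<zeta>) \<xi> = cinner \<eta> \<xi> - cinner \<zeta> \<xi>"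
  using cinner_add_left[of \<eta> "- \<zeta>" \<xi>] by (simp add: cinner_minus_left)

lemma cinner_zero [simp]: "cinner \<xi> 0 = 0" "cinner 0 \<xi> = 0"
  by (simp_all add: cinner_def)

lemma cinner_scaleR_right: "cinner \<xi> (r *\<^sub>R \<eta>) = of_real r * cinner \<xi> \<eta>"
  by (simp add: scaleR_ell2_def cinner_scaleC_right)

lemma cinner_self_norm: "cinner \<xi> \<xi> = complex_of_real ((norm \<xi>)\<^sup>2)"
  by (simp only: cinner_self norm_ell2_sq)

lemma cmod_cinner_le: "cmod (cinner \<xi> \<eta>) \<le> norm \<xi> * norm \<eta>"
proof (cases "cinner \<xi> \<eta> = 0")
  case False
  define c where "c = cinner \<xi> \<eta>"
  \<comment> \<open>Multiplying \<eta> by the phase \<open>u\<close> makes the inner product real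
    and nonnegative, so that the Cauchy-Schwarz inequality of the underlying real inner product
    applies.\<close>
  define u where "u = cnj c / of_real (cmod c)"
  have c: "c \<noteq> 0" using False by (simp add: c_def)
  have "u * c = of_real (cmod c)"
    using c unfolding u_def by (simp add: complex_norm_square[symmetric] power2_eq_square field_simps)
  then have "cmod c = Re (cinner \<xi> (u *\<^sub>C \<eta>))"
    by (simp add: cinner_scaleC_right c_def)
  also have "\<dots> \<le> norm \<xi> * norm (u *\<^sub>C \<eta>)"
    using norm_cauchy_schwarz[of \<xi> "u *\<^sub>C \<eta>"] by (simp add: inner_ell2_def)
  also have "norm (u *\<^sub>C \<eta>) = norm \<eta>"
    using c by (simp add: norm_scaleC_ell2 u_def norm_divide)
  finally show ?thesis by (simp add: c_def)
qed simp

lemma norm_ket [simp]: "norm (ket i) = 1"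
proof -
  have "(norm (ket i))\<^sup>2 = (\<Sum>\<^sub>\<infinity>j. if j = i then 1 else 0)"
    unfolding norm_ell2_sq by (intro infsum_cong) auto
  also have "\<dots> = (\<Sum>\<^sub>\<infinity>j\<in>{i}. 1)"
    by (rule infsum_cong_neutral) auto
  finally show ?thesis
    using norm_ge_zero[of "ket i"] by (simp add: power2_eq_1_iff)
qed

lemma cinner_ket_left: "cinner (ket i) \<xi> = coord \<xi> i"
proof -
  have "cinner (ket i) \<xi> = (\<Sum>\<^sub>\<infinity>j\<in>{i}. coord \<xi> j)"
    unfolding cinner_def by (rule infsum_cong_neutral) auto
  then show ?thesis by simp
qed

lemma cinner_ket_right: "cinner \<xi> (ket i) = cnj (coord \<xi> i)"
  by (subst cinner_commute) (simp add: cinner_ket_left)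

lemma cmod_coord_le: "cmod (coord \<xi> i) \<le> norm \<xi>"
  using cmod_cinner_le[of "ket i" \<xi>] by (simp add: cinner_ket_left)

lemma scaleC_simps:
  fixes \<xi> :: "'i ell2"
  shows "c *\<^sub>C (\<xi> + \<eta>) = c *\<^sub>C \<xi> + c *\<^sub>C \<eta>" "(c + d) *\<^sub>C \<xi> = c *\<^sub>C \<xi> + d *\<^sub>C \<xi>"
    "c *\<^sub>C (d *\<^sub>C \<xi>) = (c * d) *\<^sub>C \<xi>" "1 *\<^sub>C \<xi> = \<xi>" "0 *\<^sub>C \<xi> = 0" "c *\<^sub>C (0 :: 'i ell2) = 0"
    "c *\<^sub>C (\<xi> - \<eta>) = c *\<^sub>C \<xi> - c *\<^sub>C \<eta>" "c *\<^sub>C (- \<xi>) = - (c *\<^sub>C \<xi>)"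
    "c *\<^sub>C (r *\<^sub>R \<xi>) = r *\<^sub>R (c *\<^sub>C \<xi>)"
  by (rule ell2_eqI, simp add: algebra_simps)+

section \<open>Truncations to finitely many coordinates\<close>

definition trunc :: "'i set \<Rightarrow> 'i ell2 \<Rightarrow> 'i ell2" where
  "trunc A \<xi> = (\<Sum>i\<in>A. coord \<xi> i *\<^sub>C ket i)"

lemma coord_trunc: "finite A \<Longrightarrow> coord (trunc A \<xi>) i = (if i \<in> A then coord \<xi> i else 0)"
  by (simp add: trunc_def coord_sum if_distrib cong: if_cong)

text \<open>The squared error is the tail of the convergent series for the squared norm.\<close>

lemma trunc_tendsto: "((\<lambda>A. trunc A \<xi>) \<longlongrightarrow> \<xi>) (finite_subsets_at_top UNIV)"
proof (rule Lim_null[THEN iffD2], rule tendsto_norm_zero_cancel)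
  let ?s = "\<lambda>A. \<Sum>i\<in>A. (cmod (coord \<xi> i))\<^sup>2"
  have sq: "sqrt ((norm \<xi>)\<^sup>2 - ?s A) = norm (trunc A \<xi> - \<xi>)" if A: "finite A" for A
  proof -
    have "(norm (trunc A \<xi> - \<xi>))\<^sup>2 = (\<Sum>\<^sub>\<infinity>i\<in>UNIV - A. (cmod (coord \<xi> i))\<^sup>2)"
      unfolding norm_ell2_sq by (rule infsum_cong_neutral) (auto simp: coord_trunc[OF A])
    also have "\<dots> = (norm \<xi>)\<^sup>2 - ?s A"
      unfolding norm_ell2_sq using A infsum_Diff[OF coord_summable summable_on_finite, of A \<xi>] by simp
    finally show ?thesis
      by (metis norm_ge_zero real_sqrt_unique)
  qed
  have "((\<lambda>A. sqrt ((norm \<xi>)\<^sup>2 - ?s A)) \<longlongrightarrow> sqrt ((norm \<xi>)\<^sup>2 - (norm \<xi>)\<^sup>2))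
      (finite_subsets_at_top UNIV)"
    using infsum_tendsto[OF coord_summable[of \<xi>]] unfolding norm_ell2_sq
    by (intro tendsto_intros)
  then show "((\<lambda>A. norm (trunc A \<xi> - \<xi>)) \<longlongrightarrow> 0) (finite_subsets_at_top UNIV)"
    by (simp add: tendsto_cong[OF eventually_finite_subsets_at_top_weakI, OF sq])
qed

lemma tendsto_cinner:
  assumes "(f \<longlongrightarrow> \<xi>) G" "(g \<longlongrightarrow> \<eta>) G"
  shows "((\<lambda>x. cinner (f x) (g x)) \<longlongrightarrow> cinner \<xi> \<eta>) G"
proof (rule Lim_null[THEN iffD2], rule Lim_null_comparison)
  have "((\<lambda>x. norm (f x - \<xi>) * norm (g x) + norm \<xi> * norm (g x - \<eta>)) \<longlongrightarrow>
      norm (\<xi> - \<xi>) * norm \<eta> + norm \<xi> * norm (\<eta> - \<eta>)) G"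
    by (intro tendsto_intros assms)
  then show "((\<lambda>x. norm (f x - \<xi>) * norm (g x) + norm \<xi> * norm (g x - \<eta>)) \<longlongrightarrow> 0) G" by simp
  have "cmod (cinner (f x) (g x) - cinner \<xi> \<eta>) \<le> norm (f x - \<xi>) * norm (g x) + norm \<xi> * norm (g x - \<eta>)" for x
  proof -
    have "cinner (f x) (g x) - cinner \<xi> \<eta> = cinner (f x - \<xi>) (g x) + cinner \<xi> (g x - \<eta>)"
      by (simp add: cinner_diff_left cinner_diff_right)
    then have "cmod (cinner (f x) (g x) - cinner \<xi> \<eta>) = cmod (cinner (f x - \<xi>) (g x) + cinner \<xi> (g x - \<eta>))"
      by simp
    then show ?thesis
      using norm_triangle_ineq[of "cinner (f x - \<xi>) (g x)" "cinner \<xi> (g x - \<eta>)"]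
        cmod_cinner_le[of "f x - \<xi>" "g x"] cmod_cinner_le[of \<xi> "g x - \<eta>"] by linarith
  qed
  then show "\<forall>\<^sub>F x in G. cmod (cinner (f x) (g x) - cinner \<xi> \<eta>)
      \<le> norm (f x - \<xi>) * norm (g x) + norm \<xi> * norm (g x - \<eta>)"
    by simp
qed

section \<open>Matrix entries of operators\<close>

definition entry :: "'i op \<Rightarrow> 'i \<Rightarrow> 'i \<Rightarrow> complex" where
  "entry T i j = coord (T (ket j)) i"

lemma op_eqI: "S \<in> BH \<Longrightarrow> T \<in> BH \<Longrightarrow> (\<And>i j. entry S i j = entry T i j) \<Longrightarrow> S = T"
  by (rule BH_eqI) (auto simp: entry_def intro!: ell2_eqI)

lemma BH_scaleC: "T \<in> BH \<Longrightarrow> blinfun_apply T (c *\<^sub>C \<xi>) = c *\<^sub>C T \<xi>"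
  by (simp add: BH_def)

lemma BH_closed [simp, intro]:
  "0 \<in> BH" "id_blinfun \<in> BH" "S \<in> BH \<Longrightarrow> T \<in> BH \<Longrightarrow> S + T \<in> BH"
  "S \<in> BH \<Longrightarrow> T \<in> BH \<Longrightarrow> S - T \<in> BH" "S \<in> BH \<Longrightarrow> T \<in> BH \<Longrightarrow> S o\<^sub>L T \<in> BH"
  "T \<in> BH \<Longrightarrow> op_scale c T \<in> BH" "T \<in> BH \<Longrightarrow> r *\<^sub>R T \<in> BH"
  by (simp_all add: BH_def op_scale_apply scaleC_simps blinfun.add_left blinfun.diff_left
      blinfun.scaleR_left mult.commute)

lemma entry_simps [simp]:
  "entry 0 i j = 0" "entry id_blinfun i j = (if i = j then 1 else 0)"
  "entry (S + T) i j = entry S i j + entry T i j" "entry (S - T) i j = entry S i j - entry T i j"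
  "entry (op_scale c T) i j = c * entry T i j" "entry (r *\<^sub>R T) i j = of_real r * entry T i j"
  by (simp_all add: entry_def blinfun.add_left blinfun.diff_left op_scale_apply blinfun.scaleR_left)

lemma cmod_entry_le: "cmod (entry T i j) \<le> norm T"
proof -
  have "cmod (entry T i j) \<le> norm (T (ket j))"
    unfolding entry_def by (rule cmod_coord_le)
  also have "\<dots> \<le> norm T"
    using norm_blinfun[of T "ket j"] by simp
  finally show ?thesis .
qed

text \<open>Riesz representation for forms: \<open>T \<eta>\<close> must have the coordinates
  \<open>B (ket i) \<eta>\<close>, and boundedness of \<open>B\<close> makes them square-summable.
  It produces the adjoint and, later, the weak limit of a directed set.\<close>

lemma bounded_form_operator:
  fixes B :: "'i ell2 \<Rightarrow> 'i ell2 \<Rightarrow> complex"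
  assumes addr: "\<And>\<xi> \<eta> \<zeta>. B \<xi> (\<eta> + \<zeta>) = B \<xi> \<eta> + B \<xi> \<zeta>"
    and scr: "\<And>\<xi> \<eta> c. B \<xi> (c *\<^sub>C \<eta>) = c * B \<xi> \<eta>"
    and addl: "\<And>\<xi> \<eta> \<zeta>. B (\<xi> + \<zeta>) \<eta> = B \<xi> \<eta> + B \<zeta> \<eta>"
    and scl: "\<And>\<xi> \<eta> c. B (c *\<^sub>C \<xi>) \<eta> = cnj c * B \<xi> \<eta>"
    and bd: "\<And>\<xi> \<eta>. cmod (B \<xi> \<eta>) \<le> C * norm \<xi> * norm \<eta>"
  shows "\<exists>T\<in>BH. \<forall>\<xi> \<eta>. cinner \<xi> (blinfun_apply T \<eta>) = B \<xi> \<eta>"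
proof -
  define D where "D = max C 0"
  have D: "0 \<le> D" by (simp add: D_def)
  have bdD: "cmod (B \<xi> \<eta>) \<le> D * norm \<xi> * norm \<eta>" for \<xi> \<eta>
    using bd[of \<xi> \<eta>] mult_right_mono[of C D "norm \<xi> * norm \<eta>"]
    by (simp add: D_def mult.assoc)
  have Bzero: "B 0 \<eta> = 0" for \<eta>
    using scl[of 0 0 \<eta>] by (simp add: scaleC_simps)
  have Bsum: "B (\<Sum>i\<in>A. c i *\<^sub>C ket i) \<eta> = (\<Sum>i\<in>A. cnj (c i) * B (ket i) \<eta>)" for A c \<eta>
    by (induction A rule: infinite_finite_induct) (auto simp: Bzero addl scl)
  have fin: "(\<Sum>i\<in>A. (cmod (B (ket i) \<eta>))\<^sup>2) \<le> (D * norm \<eta>)\<^sup>2" if A: "finite A" for A \<eta>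
  proof -
    \<comment> \<open>Testing \<open>B\<close> on the vector of its own coefficients gives
      \<open>s \<le> D * sqrt s * norm \<eta>\<close>, from which a factor \<open>sqrt s\<close>
      cancels.\<close>
    define \<zeta> where "\<zeta> = (\<Sum>i\<in>A. B (ket i) \<eta> *\<^sub>C ket i)"
    define s where "s = (\<Sum>i\<in>A. (cmod (B (ket i) \<eta>))\<^sup>2)"
    have s0: "0 \<le> s" by (simp add: s_def sum_nonneg)
    have c: "coord \<zeta> i = (if i \<in> A then B (ket i) \<eta> else 0)" for i
      using A by (simp add: \<zeta>_def coord_sum if_distrib cong: if_cong)
    have "(norm \<zeta>)\<^sup>2 = (\<Sum>\<^sub>\<infinity>i\<in>A. (cmod (B (ket i) \<eta>))\<^sup>2)"
      unfolding norm_ell2_sq by (rule infsum_cong_neutral) (auto simp: c)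
    then have n: "norm \<zeta> = sqrt s"
      using A by (simp add: s_def real_sqrt_unique)
    have "B \<zeta> \<eta> = of_real s"
      unfolding \<zeta>_def Bsum s_def of_real_sum complex_norm_square
      by (simp add: mult.commute)
    then have "s \<le> D * sqrt s * norm \<eta>"
      using bdD[of \<zeta> \<eta>] s0 by (simp add: n)
    then have "sqrt s * sqrt s \<le> (D * norm \<eta>) * sqrt s"
      using s0 by (simp add: algebra_simps)
    then have "sqrt s \<le> D * norm \<eta>"
      using s0 D by (cases "s = 0") (simp, metis mult_right_le_imp_le less_eq_real_def real_sqrt_gt_zero)
    then have "(sqrt s)\<^sup>2 \<le> (D * norm \<eta>)\<^sup>2"
      using s0 by (intro power_mono) auto
    then show ?thesis using s0 by (simp add: s_def)
  qed
  have sm: "(\<lambda>i. (cmod (B (ket i) \<eta>))\<^sup>2) summable_on UNIV" for \<eta>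
    using fin[of _ \<eta>] by (intro nonneg_bdd_above_summable_on bdd_aboveI2[where M = "(D * norm \<eta>)\<^sup>2"]) auto
  define f where "f = (\<lambda>\<eta>. Abs_ell2 (\<lambda>i. B (ket i) \<eta>))"
  have cf: "coord (f \<eta>) i = B (ket i) \<eta>" for \<eta> i
    unfolding f_def using sm[of \<eta>] by (subst Abs_ell2_inverse) auto
  have nf: "norm (f \<eta>) \<le> norm \<eta> * D" for \<eta>
  proof (rule power2_le_imp_le)
    show "(norm (f \<eta>))\<^sup>2 \<le> (norm \<eta> * D)\<^sup>2"
      unfolding norm_ell2_sq[of "f \<eta>"] cf
      using fin[of _ \<eta>] by (intro infsum_le_finite_sums sm) (auto simp: mult.commute)
  qed (use D in simp)
  have "bounded_linear f"
    by (rule bounded_linear_intro[where K = D])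
       (auto intro!: ell2_eqI simp: cf addr scr nf scaleR_ell2_def)
  then have app: "blinfun_apply (Blinfun f) = f"
    by (rule bounded_linear_Blinfun_apply)
  have "cinner \<xi> (f \<eta>) = B \<xi> \<eta>" for \<xi> \<eta>
  proof (rule tendsto_unique[OF finite_subsets_at_top_neq_bot])
    show "((\<lambda>A. cinner (trunc A \<xi>) (f \<eta>)) \<longlongrightarrow> cinner \<xi> (f \<eta>)) (finite_subsets_at_top UNIV)"
      by (intro tendsto_cinner trunc_tendsto tendsto_const)
    have tr: "cinner (trunc A \<xi>) (f \<eta>) = B (trunc A \<xi>) \<eta>" for A
    proof -
      have "cinner (\<Sum>i\<in>A. c i *\<^sub>C ket i) (f \<eta>) = (\<Sum>i\<in>A. cnj (c i) * B (ket i) \<eta>)" for c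
        by (induction A rule: infinite_finite_induct)
           (auto simp: cinner_add_left cinner_scaleC_left cinner_ket_left cf)
      then show ?thesis by (simp add: trunc_def Bsum)
    qed
    \<comment> \<open>Sesquilinearity covers only finite combinations of basis vectors; boundedness
      of \<open>B\<close> in its first argument carries the identity to the limit.\<close>
    have "((\<lambda>A. B (trunc A \<xi>) \<eta>) \<longlongrightarrow> B \<xi> \<eta>) (finite_subsets_at_top UNIV)"
    proof (rule Lim_null[THEN iffD2], rule Lim_null_comparison)
      have "((\<lambda>A. D * norm (trunc A \<xi> - \<xi>) * norm \<eta>) \<longlongrightarrow> D * norm (\<xi> - \<xi>) * norm \<eta>) (finite_subsets_at_top UNIV)"
        by (intro tendsto_intros trunc_tendsto)
      then show "((\<lambda>A. D * norm (trunc A \<xi> - \<xi>) * norm \<eta>) \<longlongrightarrow> 0) (finite_subsets_at_top UNIV)"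
        by simp
      have "B x \<eta> - B \<xi> \<eta> = B (x - \<xi>) \<eta>" for x
        using addl[of "x - \<xi>" \<xi> \<eta>] by simp
      then show "\<forall>\<^sub>F A in finite_subsets_at_top UNIV.
          cmod (B (trunc A \<xi>) \<eta> - B \<xi> \<eta>) \<le> D * norm (trunc A \<xi> - \<xi>) * norm \<eta>"
        using bdD by simp
    qed
    then show "((\<lambda>A. cinner (trunc A \<xi>) (f \<eta>)) \<longlongrightarrow> B \<xi> \<eta>) (finite_subsets_at_top UNIV)"
      by (simp add: tr)
  qed
  moreover have "Blinfun f \<in> BH"
    unfolding BH_def by (auto intro!: ell2_eqI simp: app cf scr)
  ultimately show ?thesis
    using app by (intro bexI[of _ "Blinfun f"]) auto
qed

lemma ell2_eq_cinnerI: "(\<And>\<zeta>. cinner \<zeta> \<xi> = cinner \<zeta> \<eta>) \<Longrightarrow> \<xi> = \<eta>"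
  by (rule ell2_eqI) (metis cinner_ket_left)

text \<open>The form \<open>cinner (T \<xi>) \<eta>\<close> is represented by an operator in
  \<open>BH\<close>, and inner products determine that operator, so the definite description
  denotes.\<close>

lemma op_adj:
  assumes T: "T \<in> BH"
  shows op_adj_BH [simp, intro]: "op_adj T \<in> BH"
    and cinner_adj_left: "cinner (op_adj T \<xi>) \<eta> = cinner \<xi> (T \<eta>)"
proof -
  have "\<exists>S\<in>BH. \<forall>\<xi> \<eta>. cinner \<xi> (blinfun_apply S \<eta>) = cinner (T \<xi>) \<eta>"
  proof (rule bounded_form_operator[where C = "norm T"])
    show "cmod (cinner (T \<xi>) \<eta>) \<le> norm T * norm \<xi> * norm \<eta>" for \<xi> \<eta>
      using cmod_cinner_le[of "T \<xi>" \<eta>] mult_right_mono[OF norm_blinfun[of T \<xi>], of "norm \<eta>"]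
      by simp
  qed (simp_all add: cinner_add_right cinner_scaleC_right cinner_add_left cinner_scaleC_left
      blinfun.add_right BH_scaleC[OF T])
  then obtain S where S: "S \<in> BH" "\<And>\<xi> \<eta>. cinner \<xi> (S \<eta>) = cinner (T \<xi>) \<eta>" by blast
  have "\<exists>!S. S \<in> BH \<and> (\<forall>\<xi> \<eta>. cinner (blinfun_apply S \<xi>) \<eta> = cinner \<xi> (T \<eta>))"
  proof (rule ex1I[of _ S])
    show "S \<in> BH \<and> (\<forall>\<xi> \<eta>. cinner (S \<xi>) \<eta> = cinner \<xi> (T \<eta>))"
      using S by (metis cinner_commute)
    fix R assume R: "R \<in> BH \<and> (\<forall>\<xi> \<eta>. cinner (blinfun_apply R \<xi>) \<eta> = cinner \<xi> (T \<eta>))"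
    show "R = S"
    proof (rule blinfun_eqI, rule ell2_eq_cinnerI)
      fix \<xi> \<zeta>
      show "cinner \<zeta> (R \<xi>) = cinner \<zeta> (S \<xi>)"
        using R S by (metis cinner_commute)
    qed
  qed
  from theI'[OF this] show "op_adj T \<in> BH" "cinner (op_adj T \<xi>) \<eta> = cinner \<xi> (T \<eta>)"
    unfolding op_adj_def by auto
qed

lemma cinner_adj_right: "T \<in> BH \<Longrightarrow> cinner \<xi> (op_adj T \<eta>) = cinner (T \<xi>) \<eta>"
  by (metis cinner_adj_left cinner_commute)

lemma entry_adj: "T \<in> BH \<Longrightarrow> entry (op_adj T) i j = cnj (entry T j i)"
  unfolding entry_def by (simp add: cinner_ket_left[symmetric] cinner_adj_right cinner_ket_right)

lemma op_adj_eqI: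
  assumes "T \<in> BH" "S \<in> BH" "\<And>\<xi> \<eta>. cinner (S \<xi>) \<eta> = cinner \<xi> (T \<eta>)"
  shows "op_adj T = S"
  by (rule blinfun_eqI, rule ell2_eq_cinnerI) (metis assms cinner_adj_left cinner_commute)

lemma op_adj_eq_entryI:
  assumes "T \<in> BH" "S \<in> BH" "\<And>i j. entry S i j = cnj (entry T j i)"
  shows "op_adj T = S"
  by (rule op_eqI) (use assms in \<open>auto simp: entry_adj\<close>)

lemma op_adj_add: "S \<in> BH \<Longrightarrow> T \<in> BH \<Longrightarrow> op_adj (S + T) = op_adj S + op_adj T"
  and op_adj_diff: "S \<in> BH \<Longrightarrow> T \<in> BH \<Longrightarrow> op_adj (S - T) = op_adj S - op_adj T"
  and op_adj_scale: "T \<in> BH \<Longrightarrow> op_adj (op_scale c T) = op_scale (cnj c) (op_adj T)"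
  and op_adj_adj: "T \<in> BH \<Longrightarrow> op_adj (op_adj T) = T"
  by (rule op_adj_eq_entryI; simp add: entry_adj)+

lemma op_adj_comp: "S \<in> BH \<Longrightarrow> T \<in> BH \<Longrightarrow> op_adj (S o\<^sub>L T) = op_adj T o\<^sub>L op_adj S"
  by (rule op_adj_eqI) (auto simp: cinner_adj_left)

lemmas op_adj_simps = op_adj_add op_adj_diff op_adj_scale op_adj_adj op_adj_comp

lemma op_adj_zero: "op_adj 0 = 0"
  by (rule op_adj_eq_entryI) auto

text \<open>A factor \<open>norm (op_adj T \<xi>)\<close> cancels from the estimate of its square.
  The bound lets the adjoint pass to norm limits in the separability argument.\<close>

lemma norm_op_adj_le: assumes T: "T \<in> BH" shows "norm (op_adj T) \<le> norm T"
proof (rule norm_blinfun_bound)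
  fix \<xi>
  have "cinner (op_adj T \<xi>) (op_adj T \<xi>) = cinner \<xi> (T (op_adj T \<xi>))"
    using T by (rule cinner_adj_left)
  then have "(norm (op_adj T \<xi>))\<^sup>2 = cmod (cinner \<xi> (T (op_adj T \<xi>)))"
    by (metis cinner_self_norm norm_of_real abs_of_nonneg zero_le_power2)
  also have "\<dots> \<le> norm \<xi> * (norm T * norm (op_adj T \<xi>))"
    by (intro order_trans[OF cmod_cinner_le] mult_left_mono norm_blinfun) auto
  finally show "norm (op_adj T \<xi>) \<le> norm T * norm \<xi>"
    by (cases "norm (op_adj T \<xi>) = 0") (auto simp: power2_eq_square mult_ac)
qed auto

text \<open>Row \<open>i\<close> of the matrix is the conjugate of the vector
  \<open>op_adj T (ket i)\<close>, hence square-summable, and the series is an inner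
  product.\<close>

lemma coord_apply_has_sum:
  assumes T: "T \<in> BH"
  shows "((\<lambda>j. entry T i j * coord \<xi> j) has_sum coord (T \<xi>) i) UNIV"
proof -
  have "cnj (coord (op_adj T (ket i)) j) = entry T i j" for j
    using entry_adj[OF T, of j i] by (simp add: entry_def)
  then have "cinner (op_adj T (ket i)) \<xi> = (\<Sum>\<^sub>\<infinity>j. entry T i j * coord \<xi> j)"
    by (simp add: cinner_def)
  then have "coord (T \<xi>) i = (\<Sum>\<^sub>\<infinity>j. entry T i j * coord \<xi> j)"
    by (simp add: cinner_adj_left[OF T] cinner_ket_left)
  moreover have "(\<lambda>j. entry T i j * coord \<xi> j) summable_on UNIV"
    using cinner_summable[of "op_adj T (ket i)" \<xi>]
    by (simp add: \<open>\<And>j. cnj (coord (op_adj T (ket i)) j) = entry T i j\<close>)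
  ultimately show ?thesis by (simp add: has_sum_infsum)
qed

lemma entry_comp_has_sum:
  assumes "S \<in> BH"
  shows "((\<lambda>m. entry S i m * entry T m j) has_sum entry (S o\<^sub>L T) i j) UNIV"
  using coord_apply_has_sum[OF assms, of i "T (ket j)"] by (simp add: entry_def)

text \<open>In matrix products with a diagonal operator or a shift a single summand survives; this
  evaluates them.\<close>

lemma has_sum_single:
  fixes f :: "'a \<Rightarrow> 'b :: {topological_comm_monoid_add, t2_space}"
  assumes "(f has_sum s) UNIV" "\<And>j. j \<noteq> i \<Longrightarrow> f j = 0"
  shows "s = f i"
proof -
  have "(f has_sum f i) {i}"
    by (simp add: has_sum_finiteI)
  then have "(f has_sum f i) UNIV"
    by (rule has_sum_cong_neutral[THEN iffD1, rotated -1]) (use assms(2) in auto)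
  then show ?thesis
    using assms(1) has_sum_unique by blast
qed

definition mult_op :: "('i \<Rightarrow> complex) \<Rightarrow> 'i op" where
  "mult_op w = basis_op (\<lambda>i. w i *\<^sub>C ket i)"

lemma mult_op:
  assumes "\<And>i. cmod (w i) \<le> C"
  shows mult_op_BH: "mult_op w \<in> BH" and entry_mult_op: "entry (mult_op w) i j = (if i = j then w i else 0)"
    and coord_mult_op: "coord (mult_op w \<xi>) i = w i * coord \<xi> i"
proof -
  have *: "mult_op w = basis_op (\<lambda>i. w i *\<^sub>C ket (id i))"
    by (simp add: mult_op_def)
  show B: "mult_op w \<in> BH" and e: "entry (mult_op w) i j = (if i = j then w i else 0)" for i j
    unfolding * entry_def using basis_op_wshift[OF inj_on_id, of w C] assms by auto
  show "coord (mult_op w \<xi>) i = w i * coord \<xi> i"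
    using has_sum_single[OF coord_apply_has_sum[OF B, of i \<xi>], of i] by (simp add: e)
qed

section \<open>Complex scalars and the bicommutant of all operators\<close>

lemma op_scale_comp: 
  "op_scale c S o\<^sub>L T = op_scale c (S o\<^sub>L T)"
  "S \<in> BH \<Longrightarrow> S o\<^sub>L op_scale c T = op_scale c (S o\<^sub>L T)"
  by (auto intro!: blinfun_eqI simp: op_scale_apply BH_scaleC)

lemma comp_add: "(S + T) o\<^sub>L R = (S o\<^sub>L R) + (T o\<^sub>L R)" "R o\<^sub>L (S + T) = (R o\<^sub>L S) + (R o\<^sub>L T)"
  "(S - T) o\<^sub>L R = (S o\<^sub>L R) - (T o\<^sub>L R)" "R o\<^sub>L (S - T) = (R o\<^sub>L S) - (R o\<^sub>L T)"
  by (auto intro!: blinfun_eqI simp: blinfun.bilinear_simps)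

lemma comp_assoc: "(S o\<^sub>L T) o\<^sub>L R = S o\<^sub>L (T o\<^sub>L R)"
  by (rule blinfun_eqI) simp

text \<open>\<open>weight_dom\<close> is a span in this module. Scalars act on the values, so the
  axioms hold for all real-linear operators.\<close>

interpretation op_module: Modules.module op_scale
  by unfold_locales (rule blinfun_eqI, simp add: op_scale_apply scaleC_simps blinfun.add_left)+

lemma unital_star_subalgebra_BH: "unital_star_subalgebra BH"
  by (simp add: unital_star_subalgebra_def)

lemma ex_matrix_unit: "\<exists>E\<in>BH. \<forall>\<xi>. blinfun_apply E \<xi> = coord \<xi> j *\<^sub>C ket i"
proof -
  \<comment> \<open>A weighted shift needs an injective index map; the transposition of
    \<open>i\<close> and \<open>j\<close> is one, and the weight kills every basis vector except
    \<open>ket j\<close>.\<close>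
  have "\<exists>E\<in>BH. \<forall>k. blinfun_apply E (ket k) = (if k = j then 1 else 0) *\<^sub>C ket (Transposition.transpose i j k)"
    by (rule ex_wshift[where C = 1]) (auto intro: involuntory_imp_bij[THEN bij_is_inj])
  then obtain E where E: "E \<in> BH"
      "\<forall>k. blinfun_apply E (ket k) = (if k = j then 1 else 0) *\<^sub>C ket (Transposition.transpose i j k)"
    by (rule bexE)
  have e: "entry E k m = (if m = j \<and> k = i then 1 else 0)" for k m
    by (simp add: entry_def E)
  have "coord (E \<xi>) k = coord (coord \<xi> j *\<^sub>C ket i) k" for \<xi> k
    using has_sum_single[OF coord_apply_has_sum[OF E(1), of k \<xi>], of j] by (simp add: e)
  then show ?thesis
    using E(1) by (intro bexI[of _ E]) (auto intro!: ell2_eqI)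
qed

text \<open>Commuting with the matrix units that send one fixed basis vector to each
  \<open>ket i\<close> forces the same eigenvalue everywhere. The fixed vector is
  \<open>ket undefined\<close>; any index would do.\<close>

lemma commutant_BH:
  assumes "T \<in> commutant BH"
  obtains c where "T = op_scale c id_blinfun"
proof -
  have T: "T \<in> BH" and comm: "\<And>S. S \<in> BH \<Longrightarrow> T o\<^sub>L S = S o\<^sub>L T"
    using assms by (auto simp: commutant_def)
  define c where "c = coord (T (ket undefined)) undefined"
  have "T (ket i) = c *\<^sub>C ket i" for i
  proof -
    obtain E where E: "E \<in> BH" "\<And>\<xi>. E \<xi> = coord \<xi> undefined *\<^sub>C ket i"
      using bexE[OF ex_matrix_unit[of undefined i]] by metis
    have "T (E (ket undefined)) = E (T (ket undefined))"
      using arg_cong[OF comm[OF E(1)], of "\<lambda>S. blinfun_apply S (ket undefined)"] by simp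
    then show ?thesis
      by (simp add: E(2) c_def scaleC_simps)
  qed
  then have "T = op_scale c id_blinfun"
    by (intro op_eqI T) (auto simp: entry_def op_scale_apply)
  then show ?thesis using that by blast
qed

lemma von_neumann_algebra_BH: "von_neumann_algebra BH"
proof -
  have "T \<in> commutant (commutant BH)" if T: "T \<in> BH" for T :: "'a op"
    unfolding commutant_def[of "commutant BH"]
    using T by (auto elim!: commutant_BH simp: op_scale_comp op_scale_apply intro!: blinfun_eqI)
  then show ?thesis
    by (auto simp: von_neumann_algebra_def unital_star_subalgebra_BH commutant_def)
qed

section \<open>Positive operators\<close>

lemma op_pos_BH: "op_pos T \<Longrightarrow> T \<in> BH"
  by (simp add: op_pos_def)

lemma op_pos_iff: "op_pos T \<longleftrightarrow> T \<in> BH \<and> (\<forall>\<xi>. 0 \<le> Re (cinner \<xi> (T \<xi>)) \<and> Im (cinner \<xi> (T \<xi>)) = 0)"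
  by (simp add: op_pos_def complex_nonneg_Reals_iff)

lemma op_pos_Re_nonneg: "op_pos T \<Longrightarrow> 0 \<le> Re (cinner \<xi> (T \<xi>))"
  by (simp add: op_pos_iff)

lemma op_pos_form_real: "op_pos T \<Longrightarrow> cinner \<xi> (T \<xi>) = of_real (Re (cinner \<xi> (T \<xi>)))"
  by (simp add: op_pos_iff complex_eq_iff)

lemma entry_eq_cinner: "entry T i j = cinner (ket i) (T (ket j))"
  by (simp add: entry_def cinner_ket_left)

lemma op_pos_entry_nonneg: "op_pos T \<Longrightarrow> 0 \<le> Re (entry T i i)"
  by (simp add: entry_eq_cinner op_pos_Re_nonneg)

lemma op_pos_add: "op_pos S \<Longrightarrow> op_pos T \<Longrightarrow> op_pos (S + T)"
  by (simp add: op_pos_iff blinfun.add_left cinner_add_right)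

lemma op_pos_scaleR: "op_pos T \<Longrightarrow> 0 \<le> r \<Longrightarrow> op_pos (r *\<^sub>R T)"
  by (simp add: op_pos_iff blinfun.scaleR_left cinner_scaleR_right)

lemma op_pos_adj_comp: "X \<in> BH \<Longrightarrow> op_pos (op_adj X o\<^sub>L X)"
  by (simp add: op_pos_iff cinner_adj_right cinner_self_norm)

lemma op_le_trans: "op_le R S \<Longrightarrow> op_le S T \<Longrightarrow> op_le R T"
  using op_pos_add[of "T - S" "S - R"] by (simp add: op_le_def)

lemma op_le_form: "op_le S T \<Longrightarrow> Re (cinner \<xi> (S \<xi>)) \<le> Re (cinner \<xi> (T \<xi>))"
  using op_pos_Re_nonneg[of "T - S" \<xi>] by (simp add: op_le_def blinfun.diff_left cinner_diff_right)

text \<open>Reality of the form at \<xi> + \<eta> and at \<xi> + \<i> \<eta> settles the imaginary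
  and the real part of the claim.\<close>

lemma op_pos_hermitian:
  assumes "op_pos T"
  shows "cinner \<eta> (T \<xi>) = cnj (cinner \<xi> (T \<eta>))"
proof -
  have T: "T \<in> BH" using assms by (simp add: op_pos_iff)
  have im: "Im (cinner \<zeta> (T \<zeta>)) = 0" for \<zeta>
    using assms by (simp add: op_pos_iff)
  show ?thesis
    using im[of "\<xi> + \<eta>"] im[of "\<xi> + \<i> *\<^sub>C \<eta>"] im[of \<xi>] im[of \<eta>]
    by (simp add: complex_eq_iff blinfun.add_right BH_scaleC[OF T] cinner_add_left cinner_add_right
        cinner_scaleC_left cinner_scaleC_right)
qed

lemma op_adj_pos: "op_pos T \<Longrightarrow> op_adj T = T"
  by (rule op_adj_eqI) (simp_all add: op_pos_BH op_pos_hermitian[of T _ _, symmetric] cinner_commute[of "T _"])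

lemma op_pos_Cauchy_Schwarz:
  assumes "op_pos T"
  shows "(cmod (cinner \<xi> (T \<eta>)))\<^sup>2 \<le> Re (cinner \<xi> (T \<xi>)) * Re (cinner \<eta> (T \<eta>))"
proof -
  have T: "T \<in> BH" using assms by (simp add: op_pos_iff)
  define a b c where "a = Re (cinner \<xi> (T \<xi>))" and "b = Re (cinner \<eta> (T \<eta>))" and "c = cinner \<xi> (T \<eta>)"
  have ab: "0 \<le> a" "0 \<le> b" using assms by (auto simp: a_def b_def op_pos_Re_nonneg)
  \<comment> \<open>The form is evaluated at \<xi> + t * cnj c * \<eta>; the phase of
    \<open>c\<close> makes the cross terms real.\<close>
  have quad: "0 \<le> a + 2 * t * (cmod c)\<^sup>2 + t\<^sup>2 * (cmod c)\<^sup>2 * b" for t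
  proof -
    define z where "z = of_real t * cnj c"
    have "0 \<le> Re (cinner (\<xi> + z *\<^sub>C \<eta>) (T (\<xi> + z *\<^sub>C \<eta>)))"
      by (rule op_pos_Re_nonneg[OF assms])
    also have "cinner (\<xi> + z *\<^sub>C \<eta>) (T (\<xi> + z *\<^sub>C \<eta>)) =
        of_real a + z * c + cnj (z * c) + cnj z * z * of_real b"
      unfolding a_def b_def c_def op_pos_form_real[OF assms, symmetric]
      by (simp add: blinfun.add_right BH_scaleC[OF T] cinner_add_left cinner_add_right
        cinner_scaleC_left cinner_scaleC_right op_pos_hermitian[OF assms, of \<eta> \<xi>] algebra_simps)
    also have "z * c = of_real (t * (cmod c)\<^sup>2)"
      by (simp only: z_def of_real_mult complex_norm_square mult_ac)
    also have "cnj z * z = of_real (t\<^sup>2 * (cmod c)\<^sup>2)"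
      by (simp only: z_def of_real_mult complex_norm_square complex_cnj_mult complex_cnj_complex_of_real
          complex_cnj_cnj power2_eq_square[of t] mult_ac)
    finally show ?thesis by simp
  qed
  have "(cmod c)\<^sup>2 \<le> a * b"
  proof (cases "b = 0 \<or> c = 0")
    case True
    show ?thesis
    proof (cases "c = 0")
      case False
      then have b: "b = 0" and c: "0 < (cmod c)\<^sup>2" using True by auto
      \<comment> \<open>For \<open>b = 0\<close> the quadratic degenerates to a nonconstant linear
        function of \<open>t\<close>; this value of \<open>t\<close> makes it negative.\<close>
      have "0 \<le> a + 2 * (- (a + 1) / (cmod c)\<^sup>2) * (cmod c)\<^sup>2"
        using quad[of "- (a + 1) / (cmod c)\<^sup>2"] b by simp
      also have "\<dots> = - a - 2"
        using c by simp
      finally show ?thesis using ab by simp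
    qed (use ab in simp)
  next
    case False
    then have b: "0 < b" using ab by auto
    \<comment> \<open>The choice \<open>t = - 1 / b\<close> minimises the quadratic.\<close>
    have "0 \<le> (a + 2 * (- 1 / b) * (cmod c)\<^sup>2 + (- 1 / b)\<^sup>2 * (cmod c)\<^sup>2 * b) * b"
      using quad[of "- 1 / b"] b by (intro mult_nonneg_nonneg) auto
    also have "\<dots> = a * b - (cmod c)\<^sup>2"
      using b by (simp add: field_simps power2_eq_square)
    finally show ?thesis by simp
  qed
  then show ?thesis by (simp add: a_def b_def c_def)
qed

text \<open>Cauchy-Schwarz for the form dominates every off-diagonal entry by diagonal ones.\<close>

lemma op_pos_zeroI:
  assumes "op_pos T" "\<And>i. entry T i i = 0"
  shows "T = 0"
proof (rule op_eqI)
  fix i j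
  have "(cmod (entry T i j))\<^sup>2 \<le> 0"
    using op_pos_Cauchy_Schwarz[OF assms(1), of "ket i" "ket j"] assms(2)[of j]
    by (simp add: entry_eq_cinner)
  then show "entry T i j = entry 0 i j" by simp
qed (use assms in \<open>auto simp: op_pos_BH\<close>)

lemma polarization_identity:
  assumes T: "T \<in> BH"
  shows "cinner \<xi> (T \<eta>) = (cinner (\<eta> + \<xi>) (T (\<eta> + \<xi>)) - cinner (\<eta> - \<xi>) (T (\<eta> - \<xi>))
    + \<i> * cinner (\<eta> + \<i> *\<^sub>C \<xi>) (T (\<eta> + \<i> *\<^sub>C \<xi>)) - \<i> * cinner (\<eta> - \<i> *\<^sub>C \<xi>) (T (\<eta> - \<i> *\<^sub>C \<xi>))) / 4"
  by (simp add: blinfun.add_right blinfun.diff_right BH_scaleC[OF T] cinner_add_left cinner_add_right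
     cinner_diff_left cinner_diff_right cinner_scaleC_left cinner_scaleC_right algebra_simps)

text \<open>The supremum of a bounded directed set is its limit in the weak operator topology: the limit
  of the quadratic forms is the form of an upper bound.\<close>

lemma directed_sup_form:
  fixes D :: "'i op set"
  assumes ne: "D \<noteq> {}" and pos: "D \<subseteq> pos_part BH"
    and dir: "\<And>x y. x \<in> D \<Longrightarrow> y \<in> D \<Longrightarrow> \<exists>z\<in>D. op_le x z \<and> op_le y z"
    and s: "s \<in> pos_part BH" and ub: "\<And>x. x \<in> D \<Longrightarrow> op_le x s"
    and least: "\<And>u. u \<in> pos_part BH \<Longrightarrow> (\<And>x. x \<in> D \<Longrightarrow> op_le x u) \<Longrightarrow> op_le s u"
  obtains F where "F \<noteq> bot" "\<forall>\<^sub>F x in F. x \<in> D"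
    "\<And>\<xi>. ((\<lambda>x. Re (cinner \<xi> (blinfun_apply x \<xi>))) \<longlongrightarrow> Re (cinner \<xi> (s \<xi>))) F"
proof -
  \<comment> \<open>The filter generated by the tails of the directed set turns suprema into
    limits.\<close>
  define F where "F = (INF x\<in>D. principal {y\<in>D. op_le x y})"
  have ev: "eventually P F \<longleftrightarrow> (\<exists>x\<in>D. \<forall>y\<in>D. op_le x y \<longrightarrow> P y)" for P
    unfolding F_def
  proof (subst eventually_INF_base)
    fix a b assume "a \<in> D" "b \<in> D"
    then obtain c where "c \<in> D" "op_le a c" "op_le b c"
      using dir by blast
    then show "\<exists>x\<in>D. principal {y \<in> D. op_le x y}
        \<le> inf (principal {y \<in> D. op_le a y}) (principal {y \<in> D. op_le b y})"
      by (auto intro: op_le_trans)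
  qed (use ne in \<open>auto simp: eventually_principal\<close>)
  have op_le_refl: "op_le x x" for x :: "'i op"
    by (simp add: op_le_def op_pos_iff)
  have F: "F \<noteq> bot"
    unfolding trivial_limit_def ev using op_le_refl by blast
  have evD: "\<forall>\<^sub>F x in F. x \<in> D"
    unfolding ev using ne by blast
  have Dpos: "op_pos x" if "x \<in> D" for x
    using pos that by (auto simp: pos_part_def)
  have spos: "op_pos s" using s by (simp add: pos_part_def)
  define g :: "'i ell2 \<Rightarrow> 'i op \<Rightarrow> real" where "g = (\<lambda>\<xi> x. Re (cinner \<xi> (blinfun_apply x \<xi>)))"
  define L where "L = (\<lambda>\<xi>. SUP x\<in>D. g \<xi> x)"
  have gs: "g \<xi> x \<le> g \<xi> s" if "x \<in> D" for \<xi> x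
    using op_le_form[OF ub[OF that]] by (simp add: g_def)
  have bdd: "bdd_above (g \<xi> ` D)" for \<xi>
    using gs by (auto intro!: bdd_aboveI2)
  have gL: "g \<xi> x \<le> L \<xi>" if "x \<in> D" for \<xi> x
    unfolding L_def using that bdd by (intro cSUP_upper)
  have Ls: "L \<xi> \<le> g \<xi> s" for \<xi>
    unfolding L_def using ne gs by (intro cSUP_least)
  have lim: "(g \<xi> \<longlongrightarrow> L \<xi>) F" for \<xi>
  proof (rule increasing_tendsto)
    show "\<forall>\<^sub>F x in F. g \<xi> x \<le> L \<xi>"
      using evD by eventually_elim (rule gL)
    fix r assume "r < L \<xi>"
    then obtain x where x: "x \<in> D" "r < g \<xi> x"
      unfolding L_def using ne bdd by (auto simp: less_cSUP_iff)
    show "\<forall>\<^sub>F x in F. r < g \<xi> x"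
      unfolding ev using x op_le_form[of x _ \<xi>] by (fastforce simp: g_def)
  qed
  have limc: "((\<lambda>x. cinner \<xi> (blinfun_apply x \<xi>)) \<longlongrightarrow> of_real (L \<xi>)) F" for \<xi>
  proof (rule Lim_transform_eventually)
    show "((\<lambda>x. of_real (g \<xi> x)) \<longlongrightarrow> (of_real (L \<xi>) :: complex)) F"
      by (intro tendsto_intros lim)
    show "\<forall>\<^sub>F x in F. of_real (g \<xi> x) = cinner \<xi> (blinfun_apply x \<xi>)"
      using evD by eventually_elim (simp add: g_def op_pos_form_real[OF Dpos, symmetric])
  qed
  \<comment> \<open>Only the quadratic forms are monotone along \<open>D\<close>; polarization
    combines their limits into a candidate for a sesquilinear form.\<close>
  define B where "B = (\<lambda>\<xi> \<eta>. (of_real (L (\<eta> + \<xi>)) - of_real (L (\<eta> - \<xi>))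
    + \<i> * of_real (L (\<eta> + \<i> *\<^sub>C \<xi>)) - \<i> * of_real (L (\<eta> - \<i> *\<^sub>C \<xi>))) / 4)"
  have limB: "((\<lambda>x. cinner \<xi> (blinfun_apply x \<eta>)) \<longlongrightarrow> B \<xi> \<eta>) F" for \<xi> \<eta>
  proof (rule Lim_transform_eventually)
    show "((\<lambda>T. (cinner (\<eta> + \<xi>) (blinfun_apply T (\<eta> + \<xi>)) - cinner (\<eta> - \<xi>) (T (\<eta> - \<xi>))
      + \<i> * cinner (\<eta> + \<i> *\<^sub>C \<xi>) (T (\<eta> + \<i> *\<^sub>C \<xi>)) - \<i> * cinner (\<eta> - \<i> *\<^sub>C \<xi>) (T (\<eta> - \<i> *\<^sub>C \<xi>))) / 4)
      \<longlongrightarrow> B \<xi> \<eta>) F"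
      unfolding B_def by (intro tendsto_intros limc) auto
    show "\<forall>\<^sub>F T in F. (cinner (\<eta> + \<xi>) (blinfun_apply T (\<eta> + \<xi>)) - cinner (\<eta> - \<xi>) (T (\<eta> - \<xi>))
      + \<i> * cinner (\<eta> + \<i> *\<^sub>C \<xi>) (T (\<eta> + \<i> *\<^sub>C \<xi>)) - \<i> * cinner (\<eta> - \<i> *\<^sub>C \<xi>) (T (\<eta> - \<i> *\<^sub>C \<xi>))) / 4
       = cinner \<xi> (T \<eta>)"
      using evD by eventually_elim (rule polarization_identity[OF op_pos_BH[OF Dpos], symmetric])
  qed
  have limB_eqI: "B \<xi> \<eta> = z" if "\<And>x. x \<in> D \<Longrightarrow> f x = cinner \<xi> (blinfun_apply x \<eta>)" "(f \<longlongrightarrow> z) F" for f z \<xi> \<eta>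
  proof (rule tendsto_unique[OF F limB])
    show "((\<lambda>x. cinner \<xi> (blinfun_apply x \<eta>)) \<longlongrightarrow> z) F"
      by (rule Lim_transform_eventually[OF that(2)], rule eventually_mono[OF evD])
         (use that(1) in auto)
  qed
  \<comment> \<open>Sesquilinearity is not visible from the formula for \<open>B\<close>; it is
    inherited from the forms of which \<open>B\<close> is the limit. The bound is uniform because
    all of \<open>D\<close> lies below \<open>s\<close>.\<close>
  have "\<exists>u\<in>BH. \<forall>\<xi> \<eta>. cinner \<xi> (blinfun_apply u \<eta>) = B \<xi> \<eta>"
  proof (rule bounded_form_operator[where C = "norm s"])
    fix \<xi> \<eta> \<zeta> c
    show "B \<xi> (\<eta> + \<zeta>) = B \<xi> \<eta> + B \<xi> \<zeta>"
      by (rule limB_eqI[rotated], rule tendsto_add[OF limB limB])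
         (simp add: blinfun.add_right cinner_add_right)
    show "B (\<xi> + \<zeta>) \<eta> = B \<xi> \<eta> + B \<zeta> \<eta>"
      by (rule limB_eqI[rotated], rule tendsto_add[OF limB limB])
         (simp add: cinner_add_left)
    show "B \<xi> (c *\<^sub>C \<eta>) = c * B \<xi> \<eta>"
      by (rule limB_eqI[rotated], rule tendsto_mult[OF tendsto_const limB])
         (simp add: BH_scaleC[OF op_pos_BH[OF Dpos]] cinner_scaleC_right)
    show "B (c *\<^sub>C \<xi>) \<eta> = cnj c * B \<xi> \<eta>"
      by (rule limB_eqI[rotated], rule tendsto_mult[OF tendsto_const limB])
         (simp add: cinner_scaleC_left)
    show "cmod (B \<xi> \<eta>) \<le> norm s * norm \<xi> * norm \<eta>"
    proof (rule tendsto_upperbound[OF tendsto_norm[OF limB] _ F])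
      have gn: "g \<xi> s \<le> norm s * (norm \<xi>)\<^sup>2" for \<xi>
      proof -
        have "g \<xi> s \<le> norm \<xi> * norm (s \<xi>)"
          unfolding g_def using complex_Re_le_cmod cmod_cinner_le order_trans by blast
        also have "\<dots> \<le> norm \<xi> * (norm s * norm \<xi>)"
          by (intro mult_left_mono norm_blinfun) auto
        finally show ?thesis by (simp add: power2_eq_square mult_ac)
      qed
      have "cmod (cinner \<xi> (x \<eta>)) \<le> norm s * norm \<xi> * norm \<eta>" if x: "x \<in> D" for x
      proof (rule power2_le_imp_le)
        have "(cmod (cinner \<xi> (x \<eta>)))\<^sup>2 \<le> g \<xi> x * g \<eta> x"
          unfolding g_def by (rule op_pos_Cauchy_Schwarz[OF Dpos[OF x]])
        also have "\<dots> \<le> (norm s * (norm \<xi>)\<^sup>2) * (norm s * (norm \<eta>)\<^sup>2)"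
          using order_trans[OF gs[OF x] gn] op_pos_Re_nonneg[OF Dpos[OF x]]
          by (intro mult_mono) (auto simp: g_def)
        finally show "(cmod (cinner \<xi> (x \<eta>)))\<^sup>2 \<le> (norm s * norm \<xi> * norm \<eta>)\<^sup>2"
          by (simp add: power2_eq_square mult_ac)
      qed auto
      then show "\<forall>\<^sub>F x in F. cmod (cinner \<xi> (blinfun_apply x \<eta>)) \<le> norm s * norm \<xi> * norm \<eta>"
        using evD by (auto elim: eventually_mono)
    qed
  qed
  then obtain u where u: "u \<in> BH" "\<And>\<xi> \<eta>. cinner \<xi> (u \<eta>) = B \<xi> \<eta>" by blast
  have uL: "cinner \<xi> (u \<xi>) = of_real (L \<xi>)" for \<xi>
    unfolding u by (rule limB_eqI[OF HOL.refl limc])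
  have L0: "0 \<le> L \<xi>" for \<xi>
    using ne gL[of _ \<xi>] op_pos_Re_nonneg[OF Dpos] unfolding g_def by (metis all_not_in_conv order_trans)
  have "op_le s u"
  proof (rule least)
    show "u \<in> pos_part BH"
      using u(1) L0 by (simp add: pos_part_def op_pos_iff uL)
    fix x assume x: "x \<in> D"
    show "op_le x u"
      unfolding op_le_def op_pos_iff
      using u(1) Dpos[OF x] gL[OF x]
      by (auto simp: op_pos_iff blinfun.diff_left cinner_diff_right uL g_def)
  qed
  then have "g \<xi> s \<le> L \<xi>" for \<xi>
    using op_le_form[of s u \<xi>] by (simp add: g_def uL)
  then have "L \<xi> = g \<xi> s" for \<xi>
    using Ls by (simp add: antisym)
  then show ?thesis
    using that[OF F evD] lim unfolding g_def by simp
qed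

lemma comp_id [simp]: "id_blinfun o\<^sub>L T = T" "T o\<^sub>L id_blinfun = T"
  by (rule blinfun_eqI, simp)+

section \<open>Extended sums of nonnegative reals\<close>

lemma ennreal_infsum:
  fixes f :: "'a \<Rightarrow> real"
  assumes "f summable_on UNIV" "\<And>i. 0 \<le> f i"
  shows "(\<Sum>\<^sub>\<infinity>i. ennreal (f i)) = ennreal (\<Sum>\<^sub>\<infinity>i. f i)"
  using assms
  by (subst infsum_nonneg_is_SUPREMUM_ennreal) (simp_all add: nonneg_infsum_complete sum_ennreal)

lemma summable_of_ennreal_infsum:
  fixes f :: "'a \<Rightarrow> real"
  assumes fin: "(\<Sum>\<^sub>\<infinity>i. ennreal (f i)) < \<infinity>" and pos: "\<And>i. 0 \<le> f i"
  shows "f summable_on UNIV"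
proof (rule nonneg_bdd_above_summable_on)
  show "bdd_above (sum f ` {F. F \<subseteq> UNIV \<and> finite F})"
  proof (rule bdd_aboveI2)
    fix F :: "'a set" assume F: "F \<in> {F. F \<subseteq> UNIV \<and> finite F}"
    have "ennreal (sum f F) = (\<Sum>i\<in>F. ennreal (f i))"
      using pos by simp
    also have "\<dots> \<le> (\<Sum>\<^sub>\<infinity>i. ennreal (f i))"
      unfolding nonneg_infsum_complete[OF zero_le] using F by (intro SUP_upper) auto
    finally show "sum f F \<le> enn2real (\<Sum>\<^sub>\<infinity>i. ennreal (f i))"
      using fin by (metis enn2real_ennreal enn2real_mono infinity_ennreal_def pos sum_nonneg)
  qed
qed (use pos in simp)

lemma infsum_ennreal_mult_left:
  "(\<Sum>\<^sub>\<infinity>i\<in>A. c * f i) = c * (\<Sum>\<^sub>\<infinity>i\<in>A. f i :: ennreal)"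
  unfolding nonneg_infsum_complete[OF zero_le]
  by (simp add: SUP_mult_left_ennreal sum_distrib_left)

section \<open>Diagonal weights\<close>

definition diag_weight :: "('i \<Rightarrow> real) \<Rightarrow> 'i op \<Rightarrow> ennreal" where
  "diag_weight lam T = (\<Sum>\<^sub>\<infinity>i. ennreal (lam i * Re (entry T i i)))"

text \<open>The left ideal of all \<open>X\<close> for which \<open>op_adj X o\<^sub>L X\<close> has
  finite weight. Column norms appear because their squares are the diagonal entries of that
  product.\<close>

definition square_summable_ideal :: "('i \<Rightarrow> real) \<Rightarrow> 'i op set" where
  "square_summable_ideal lam = {X\<in>BH. (\<lambda>i. lam i * (norm (X (ket i)))\<^sup>2) summable_on UNIV}"

text \<open>Strict positivity serves faithfulness and the logarithms in the modular group.\<close>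

locale diagonal_weight =
  fixes lam :: "'i \<Rightarrow> real"
  assumes lam_pos: "0 < lam i"
begin

abbreviation \<Phi> where "\<Phi> \<equiv> diag_weight lam"
abbreviation \<LL> where "\<LL> \<equiv> square_summable_ideal lam"

lemma lam_nonneg [simp]: "0 \<le> lam i"
  using lam_pos by (rule less_imp_le)

lemma pos_part_BH: "x \<in> pos_part BH \<longleftrightarrow> op_pos x"
  by (auto simp: pos_part_def op_pos_BH)

lemma weight_term_nonneg: "op_pos x \<Longrightarrow> 0 \<le> lam i * Re (entry x i i)"
  by (simp add: op_pos_entry_nonneg)

lemma diag_weight_add:
  assumes "op_pos x" "op_pos y"
  shows "\<Phi> (x + y) = \<Phi> x + \<Phi> y"
  unfolding diag_weight_def
  by (subst infsum_add[symmetric])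
     (auto intro!: infsum_cong nonneg_summable_on_complete simp: distrib_left ennreal_plus weight_term_nonneg[OF assms(1)]
       weight_term_nonneg[OF assms(2)])

lemma diag_weight_scaleR: "0 \<le> r \<Longrightarrow> op_pos x \<Longrightarrow> \<Phi> (r *\<^sub>R x) = ennreal r * \<Phi> x"
  unfolding diag_weight_def infsum_ennreal_mult_left[symmetric]
  by (intro infsum_cong) (simp add: ennreal_mult[symmetric] op_pos_entry_nonneg mult.left_commute)

lemma weight_diag: "weight BH \<Phi>"
  by (simp add: weight_def pos_part_BH diag_weight_add diag_weight_scaleR)

lemma diag_weight_ge:
  assumes "finite F"
  shows "(\<Sum>i\<in>F. ennreal (lam i * Re (entry x i i))) \<le> \<Phi> x"
  unfolding diag_weight_def nonneg_infsum_complete[OF zero_le]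
  using assms by (intro SUP_upper) auto

text \<open>All summands are nonnegative and \<open>0 < lam i\<close>, so the diagonal vanishes, and
  a positive operator with zero diagonal is zero.\<close>

lemma faithful_diag: "faithful_weight BH \<Phi>"
  unfolding faithful_weight_def pos_part_BH
proof (intro allI ballI impI)
  fix x assume x: "x \<in> pos_part BH" and 0: "\<Phi> x = 0"
  then have xp: "op_pos x" by (simp add: pos_part_BH)
  show "x = 0"
  proof (rule op_pos_zeroI[OF xp])
    fix i
    have "ennreal (lam i * Re (entry x i i)) \<le> 0"
      using diag_weight_ge[of "{i}" x] 0 by simp
    then have "Re (entry x i i) = 0"
      using weight_term_nonneg[OF xp, of i] lam_pos[of i] by (simp add: ennreal_eq_0_iff mult_le_0_iff op_pos_entry_nonneg[OF xp] antisym)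
    then show "entry x i i = 0"
      using op_pos_form_real[OF xp, of "ket i"] by (simp add: entry_eq_cinner)
  qed
qed

lemma diag_weight_mono:
  assumes "op_le x y"
  shows "\<Phi> x \<le> \<Phi> y"
  unfolding diag_weight_def
  using op_le_form[OF assms]
  by (intro infsum_mono nonneg_summable_on_complete ennreal_leI mult_left_mono) (auto simp: entry_eq_cinner)

text \<open>Lower semicontinuity: a finite partial sum of the weight of \<open>s\<close> is the
  limit of the same partial sums over elements of \<open>D\<close>, each at most the weight of that
  element. The other inequality is monotonicity.\<close>

lemma normal_diag: "normal_weight BH \<Phi>"
  unfolding normal_weight_def
proof (intro allI impI, elim conjE)
  fix D and s :: "'i op"
  assume D: "D \<noteq> {}" "D \<subseteq> pos_part BH" "\<forall>x\<in>D. \<forall>y\<in>D. \<exists>z\<in>D. op_le x z \<and> op_le y z"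
    "s \<in> pos_part BH" "\<forall>x\<in>D. op_le x s" "\<forall>u\<in>pos_part BH. (\<forall>x\<in>D. op_le x u) \<longrightarrow> op_le s u"
  obtain F where F: "F \<noteq> bot" "\<forall>\<^sub>F x in F. x \<in> D"
      "\<And>\<xi>. ((\<lambda>x. Re (cinner \<xi> (blinfun_apply x \<xi>))) \<longlongrightarrow> Re (cinner \<xi> (s \<xi>))) F"
    by (rule directed_sup_form[of D s]) (use D in auto)
  show "\<Phi> s = (SUP x\<in>D. \<Phi> x)"
  proof (rule antisym)
    show "(SUP x\<in>D. \<Phi> x) \<le> \<Phi> s"
      using D by (intro SUP_least diag_weight_mono) auto
    show "\<Phi> s \<le> (SUP x\<in>D. \<Phi> x)"
      unfolding diag_weight_def[of _ s] nonneg_infsum_complete[OF zero_le]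
    proof (rule SUP_least)
      fix A :: "'i set" assume "A \<in> {F. finite F \<and> F \<subseteq> UNIV}"
      then have A: "finite A" by simp
      show "(\<Sum>i\<in>A. ennreal (lam i * Re (entry s i i))) \<le> (SUP x\<in>D. \<Phi> x)"
      proof (rule tendsto_upperbound[OF _ _ F(1)])
        show "((\<lambda>x. \<Sum>i\<in>A. ennreal (lam i * Re (entry x i i))) \<longlongrightarrow>
            (\<Sum>i\<in>A. ennreal (lam i * Re (entry s i i)))) F"
          unfolding entry_eq_cinner by (intro tendsto_sum tendsto_ennrealI tendsto_mult tendsto_const F(3))
        show "\<forall>\<^sub>F x in F. (\<Sum>i\<in>A. ennreal (lam i * Re (entry x i i))) \<le> (SUP x\<in>D. \<Phi> x)"
          using F(2) by eventually_elim (rule order_trans[OF diag_weight_ge[OF A]], rule SUP_upper)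
      qed
    qed
  qed
qed

section \<open>The left ideal and products of its elements\<close>

lemma ideal_BH: "X \<in> \<LL> \<Longrightarrow> X \<in> BH"
  by (simp add: square_summable_ideal_def)

lemma entry_adj_comp_self: "X \<in> BH \<Longrightarrow> entry (op_adj X o\<^sub>L X) i i = of_real ((norm (X (ket i)))\<^sup>2)"
  by (simp only: entry_eq_cinner blinfun_apply_blinfun_compose cinner_adj_right cinner_self_norm)

lemma ideal_iff: "X \<in> BH \<Longrightarrow> X \<in> \<LL> \<longleftrightarrow> \<Phi> (op_adj X o\<^sub>L X) < \<infinity>"
proof
  assume X: "X \<in> BH" and "X \<in> \<LL>"
  then have "(\<lambda>i. lam i * (norm (X (ket i)))\<^sup>2) summable_on UNIV"
    by (simp add: square_summable_ideal_def)
  then show "\<Phi> (op_adj X o\<^sub>L X) < \<infinity>"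
    using X by (simp add: diag_weight_def entry_adj_comp_self ennreal_infsum del: of_real_power)
next
  assume X: "X \<in> BH" and fin: "\<Phi> (op_adj X o\<^sub>L X) < \<infinity>"
  then have "(\<lambda>i. lam i * (norm (X (ket i)))\<^sup>2) summable_on UNIV"
    by (intro summable_of_ennreal_infsum)
       (simp_all add: diag_weight_def entry_adj_comp_self del: of_real_power)
  with X show "X \<in> \<LL>"
    by (simp add: square_summable_ideal_def)
qed

lemma ideal_add:
  assumes X: "X \<in> \<LL>" and Y: "Y \<in> \<LL>"
  shows "X + Y \<in> \<LL>"
proof -
  have "(norm (X (ket i) + Y (ket i)))\<^sup>2 \<le> 2 * (norm (X (ket i)))\<^sup>2 + 2 * (norm (Y (ket i)))\<^sup>2" for i
  proof -
    have "(norm (X (ket i) + Y (ket i)))\<^sup>2 \<le> (norm (X (ket i)) + norm (Y (ket i)))\<^sup>2"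
      by (intro power_mono norm_triangle_ineq) auto
    also have "\<dots> \<le> 2 * (norm (X (ket i)))\<^sup>2 + 2 * (norm (Y (ket i)))\<^sup>2"
      using sum_squares_bound[of "norm (X (ket i))" "norm (Y (ket i))"] by (simp add: power2_sum)
    finally show ?thesis .
  qed
  then have le: "lam i * (norm (X (ket i) + Y (ket i)))\<^sup>2
      \<le> 2 * (lam i * (norm (X (ket i)))\<^sup>2) + 2 * (lam i * (norm (Y (ket i)))\<^sup>2)" for i
    using mult_left_mono[OF _ lam_nonneg] by (fastforce simp: algebra_simps)
  have "(\<lambda>i. lam i * (norm (X (ket i) + Y (ket i)))\<^sup>2) summable_on UNIV"
    by (rule summable_on_comparison_test[where
          f = "\<lambda>i. 2 * (lam i * (norm (X (ket i)))\<^sup>2) + 2 * (lam i * (norm (Y (ket i)))\<^sup>2)"])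
       (use X Y le in \<open>auto intro!: summable_on_add summable_on_cmult_right simp: square_summable_ideal_def\<close>)
  then show ?thesis
    using X Y by (simp add: square_summable_ideal_def blinfun.add_left)
qed

lemma ideal_scale:
  assumes X: "X \<in> \<LL>"
  shows "op_scale c X \<in> \<LL>"
proof -
  have "(\<lambda>i. (cmod c)\<^sup>2 * (lam i * (norm (X (ket i)))\<^sup>2)) summable_on UNIV"
    using X by (intro summable_on_cmult_right) (simp add: square_summable_ideal_def)
  then show ?thesis
    using X by (simp add: square_summable_ideal_def op_scale_apply norm_scaleC_ell2 power_mult_distrib mult_ac)
qed

lemma ideal_square_finite_pos: "X \<in> \<LL> \<Longrightarrow> op_adj X o\<^sub>L X \<in> finite_pos BH \<Phi>"
  using ideal_iff[of X] by (simp add: finite_pos_def pos_part_BH op_pos_adj_comp ideal_BH)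

lemma finite_pos_scaleR: "x \<in> finite_pos BH \<Phi> \<Longrightarrow> 0 \<le> r \<Longrightarrow> r *\<^sub>R x \<in> finite_pos BH \<Phi>"
  by (auto simp: finite_pos_def pos_part_BH op_pos_scaleR diag_weight_scaleR ennreal_mult_less_top)

lemma ideal_product_decomposition:
  assumes X: "X \<in> \<LL>" and Y: "Y \<in> \<LL>"
  obtains x1 x2 x3 x4 where "x1 \<in> finite_pos BH \<Phi>" "x2 \<in> finite_pos BH \<Phi>"
    "x3 \<in> finite_pos BH \<Phi>" "x4 \<in> finite_pos BH \<Phi>"
    "op_adj X o\<^sub>L Y = (x1 - x2) + op_scale \<i> (x3 - x4)"
proof -
  define P where "P = (\<lambda>c. (1 / 4) *\<^sub>R (op_adj (X + op_scale c Y) o\<^sub>L (X + op_scale c Y)))"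
  have P: "P c \<in> finite_pos BH \<Phi>" for c
    unfolding P_def using X Y by (intro finite_pos_scaleR ideal_square_finite_pos ideal_add ideal_scale) auto
  have B [simp]: "X \<in> BH" "Y \<in> BH" using X Y by (auto intro: ideal_BH)
  \<comment> \<open>In \<open>P c\<close> the product of \<open>op_adj X\<close> with
    \<open>Y\<close> has coefficient \<open>c / 4\<close>, that of \<open>op_adj Y\<close> with
    \<open>X\<close> has \<open>cnj c / 4\<close>. The first difference is thus half the sum of the
    two, and \<i> times the second, taken in this order, half their difference.\<close>
  have "op_adj X o\<^sub>L Y = (P 1 - P (- 1)) + op_scale \<i> (P (- \<i>) - P \<i>)"
  proof (rule op_eqI)
    fix i j
    have eq: "entry (P c) i j = (entry (op_adj X o\<^sub>L X) i j + c * entry (op_adj X o\<^sub>L Y) i j +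
        cnj c * entry (op_adj Y o\<^sub>L X) i j + cnj c * c * entry (op_adj Y o\<^sub>L Y) i j) / 4" for c
      by (simp add: P_def op_adj_simps comp_add op_scale_comp algebra_simps)
    show "entry (op_adj X o\<^sub>L Y) i j = entry ((P 1 - P (- 1)) + op_scale \<i> (P (- \<i>) - P \<i>)) i j"
      by (simp only: entry_simps eq) (simp add: field_simps)
  qed (auto simp: P_def)
  then show ?thesis using that P by blast
qed

lemma ideal_product_weight_dom:
  assumes "X \<in> \<LL>" "Y \<in> \<LL>"
  shows "op_adj X o\<^sub>L Y \<in> weight_dom BH \<Phi>"
proof -
  obtain x1 x2 x3 x4 where x: "x1 \<in> finite_pos BH \<Phi>" "x2 \<in> finite_pos BH \<Phi>"
    "x3 \<in> finite_pos BH \<Phi>" "x4 \<in> finite_pos BH \<Phi>"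
    "op_adj X o\<^sub>L Y = (x1 - x2) + op_scale \<i> (x3 - x4)"
    using ideal_product_decomposition[OF assms] .
  show ?thesis
    unfolding weight_dom_def x(5)
    using x(1-4) by (intro op_module.span_add op_module.span_diff op_module.span_scale op_module.span_base)
qed

lemma finite_pos_has_sum:
  assumes "x \<in> finite_pos BH \<Phi>"
  shows "((\<lambda>i. of_real (lam i) * entry x i i) has_sum of_real (enn2real (\<Phi> x))) UNIV"
proof -
  have x: "op_pos x" "\<Phi> x < \<infinity>" using assms by (auto simp: finite_pos_def pos_part_BH)
  have s: "(\<lambda>i. lam i * Re (entry x i i)) summable_on UNIV"
    using x unfolding diag_weight_def by (intro summable_of_ennreal_infsum weight_term_nonneg) auto
  have "\<Phi> x = ennreal (\<Sum>\<^sub>\<infinity>i. lam i * Re (entry x i i))"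
    unfolding diag_weight_def by (rule ennreal_infsum[OF s weight_term_nonneg[OF x(1)]])
  then have "((\<lambda>i. lam i * Re (entry x i i)) has_sum enn2real (\<Phi> x)) UNIV"
    using s weight_term_nonneg[OF x(1)] by (simp add: infsum_nonneg)
  then have "((\<lambda>i. complex_of_real (lam i * Re (entry x i i))) has_sum of_real (enn2real (\<Phi> x))) UNIV"
    by (rule has_sum_of_real)
  moreover have "complex_of_real (lam i * Re (entry x i i)) = of_real (lam i) * entry x i i" for i
    using op_pos_form_real[OF x(1), of "ket i"] by (simp add: entry_eq_cinner[symmetric])
  ultimately show ?thesis by (simp only:)
qed

text \<open>Polarization supplies one decomposition; adding up diagonal entries shows that every
  decomposition gives the same value, the trace series, so the definite description denotes
  it.\<close>

lemma weight_ext_ideal_product: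
  assumes X: "X \<in> \<LL>" and Y: "Y \<in> \<LL>"
  shows "weight_ext BH \<Phi> (op_adj X o\<^sub>L Y) = (\<Sum>\<^sub>\<infinity>i. of_real (lam i) * entry (op_adj X o\<^sub>L Y) i i)"
proof -
  let ?z = "op_adj X o\<^sub>L Y"
  have tr: "c = (\<Sum>\<^sub>\<infinity>i. of_real (lam i) * entry ?z i i)"
    if x: "x1 \<in> finite_pos BH \<Phi>" "x2 \<in> finite_pos BH \<Phi>" "x3 \<in> finite_pos BH \<Phi>" "x4 \<in> finite_pos BH \<Phi>"
      and z: "?z = (x1 - x2) + op_scale \<i> (x3 - x4)"
      and c: "c = Complex (enn2real (\<Phi> x1) - enn2real (\<Phi> x2)) (enn2real (\<Phi> x3) - enn2real (\<Phi> x4))"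
    for c x1 x2 x3 x4
  proof -
    have "((\<lambda>i. (of_real (lam i) * entry x1 i i + - (of_real (lam i) * entry x2 i i)) +
        \<i> * (of_real (lam i) * entry x3 i i + - (of_real (lam i) * entry x4 i i))) has_sum
      ((of_real (enn2real (\<Phi> x1)) + - of_real (enn2real (\<Phi> x2))) +
        \<i> * (of_real (enn2real (\<Phi> x3)) + - of_real (enn2real (\<Phi> x4))))) UNIV"
      by (intro has_sum_add has_sum_uminusI has_sum_cmult_right finite_pos_has_sum x)
    then have "((\<lambda>i. of_real (lam i) * entry ?z i i) has_sum c) UNIV"
      unfolding z c complex_eq_cancel_iff2 by (simp add: Complex_eq algebra_simps)
    then show ?thesis by (simp add: infsumI)
  qed
  obtain x1 x2 x3 x4 where x: "x1 \<in> finite_pos BH \<Phi>" "x2 \<in> finite_pos BH \<Phi>"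
    "x3 \<in> finite_pos BH \<Phi>" "x4 \<in> finite_pos BH \<Phi>"
    "?z = (x1 - x2) + op_scale \<i> (x3 - x4)"
    using ideal_product_decomposition[OF assms] .
  show ?thesis
    unfolding weight_ext_def
  proof (rule the_equality)
    show "\<exists>x1\<in>finite_pos BH \<Phi>. \<exists>x2\<in>finite_pos BH \<Phi>. \<exists>x3\<in>finite_pos BH \<Phi>. \<exists>x4\<in>finite_pos BH \<Phi>.
        ?z = (x1 - x2) + op_scale \<i> (x3 - x4) \<and> (\<Sum>\<^sub>\<infinity>i. of_real (lam i) * entry ?z i i) =
        Complex (enn2real (\<Phi> x1) - enn2real (\<Phi> x2)) (enn2real (\<Phi> x3) - enn2real (\<Phi> x4))"
      by (rule bexI[OF _ x(1)], rule bexI[OF _ x(2)], rule bexI[OF _ x(3)], rule bexI[OF _ x(4)])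
         (use x(5) tr[OF x HOL.refl] in simp)
  qed (use tr in blast)
qed

text \<open>Compressions to finitely many basis vectors have finite weight and converge weakly.\<close>

lemma semifinite_diag: "semifinite_weight BH \<Phi>"
  unfolding semifinite_weight_def
proof (intro ballI allI impI)
  fix x :: "'i op" and V :: "('i ell2 \<times> 'i ell2) set" and e :: real
  assume x: "x \<in> BH" and V: "finite V" and e: "0 < e"
  \<comment> \<open>Coordinate projections. The compression of \<open>x\<close> is the product of
    \<open>P A\<close> with \<open>x o\<^sub>L P A\<close>; both lie in the ideal because only
    finitely many of their columns are nonzero.\<close>
  define P where "P = (\<lambda>A::'i set. mult_op (\<lambda>i. if i \<in> A then 1 else 0))"
  have le: "cmod (if i \<in> A then 1 else 0) \<le> 1" for i :: 'i and A by simp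
  have PB: "P A \<in> BH" for A
    unfolding P_def by (rule mult_op_BH[OF le])
  have Ptr: "P A \<xi> = trunc A \<xi>" if "finite A" for A \<xi>
    unfolding P_def using that by (intro ell2_eqI) (simp add: coord_mult_op[OF le] coord_trunc)
  have adj: "op_adj (P A) = P A" for A
    by (rule op_adj_eq_entryI) (use PB in \<open>auto simp: P_def entry_mult_op[OF le]\<close>)
  have ideal: "Z o\<^sub>L P A \<in> \<LL>" if "finite A" "Z \<in> BH" for A Z
  proof -
    have "lam i * (norm (Z (P A (ket i))))\<^sup>2 = 0" if "i \<notin> A" for i
    proof -
      have "P A (ket i) = 0"
        by (rule ell2_eqI) (use that in \<open>simp add: P_def coord_mult_op[OF le]\<close>)
      then show ?thesis by simp
    qed
    then have "{i. lam i * (norm (Z (P A (ket i))))\<^sup>2 \<noteq> 0} \<subseteq> A"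
      by blast
    then have "(\<lambda>i. lam i * (norm (Z (P A (ket i))))\<^sup>2) summable_on UNIV"
      using \<open>finite A\<close> finite_subset by (intro finite_nonzero_values_imp_summable_on) auto
    then show ?thesis
      using that PB by (simp add: square_summable_ideal_def)
  qed
  have "((\<lambda>A. cinner \<xi> (x \<eta>) - cinner (trunc A \<xi>) (x (trunc A \<eta>))) \<longlongrightarrow> cinner \<xi> (x \<eta>) - cinner \<xi> (x \<eta>))
      (finite_subsets_at_top UNIV)" for \<xi> \<eta>
    by (intro tendsto_intros tendsto_cinner trunc_tendsto blinfun.tendsto)
  then have "\<forall>\<^sub>F A in finite_subsets_at_top UNIV. 
      cmod (cinner \<xi> (x \<eta>) - cinner (trunc A \<xi>) (x (trunc A \<eta>))) < e" for \<xi> \<eta>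
    using e by (simp add: tendsto_iff dist_norm)
  then have "\<forall>\<^sub>F A in finite_subsets_at_top UNIV. \<forall>(\<xi>, \<eta>)\<in>V.
      cmod (cinner \<xi> (x \<eta>) - cinner (trunc A \<xi>) (x (trunc A \<eta>))) < e"
    using V by (simp add: eventually_ball_finite split_beta)
  then have "\<forall>\<^sub>F A in finite_subsets_at_top UNIV. finite A \<and> (\<forall>(\<xi>, \<eta>)\<in>V.
      cmod (cinner \<xi> (x \<eta>) - cinner (trunc A \<xi>) (x (trunc A \<eta>))) < e)"
    by (intro eventually_conj) (simp_all add: eventually_finite_subsets_at_top_weakI)
  then obtain A where "finite A \<and> (\<forall>(\<xi>, \<eta>)\<in>V. cmod (cinner \<xi> (x \<eta>) - cinner (trunc A \<xi>) (x (trunc A \<eta>))) < e)"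
    by (rule eventually_happens'[OF finite_subsets_at_top_neq_bot, THEN exE])
  then have A: "finite A" and *: "\<forall>(\<xi>, \<eta>)\<in>V. cmod (cinner \<xi> (x \<eta>) - cinner (trunc A \<xi>) (x (trunc A \<eta>))) < e"
    by auto
  have "cinner \<xi> ((blinfun_apply x - blinfun_apply (op_adj (P A) o\<^sub>L (x o\<^sub>L P A))) \<eta>) = cinner \<xi> (x \<eta>) - cinner (trunc A \<xi>) (x (trunc A \<eta>))" for \<xi> \<eta>
    by (simp add: cinner_diff_right cinner_adj_right[OF PB] Ptr[OF A])
  moreover have "op_adj (P A) o\<^sub>L (x o\<^sub>L P A) \<in> weight_dom BH \<Phi>"
    using ideal[OF A, of id_blinfun] ideal[OF A x] by (intro ideal_product_weight_dom) simp_all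
  ultimately show "\<exists>y\<in>weight_dom BH \<Phi>. \<forall>(\<xi>, \<eta>)\<in>V. cmod (cinner \<xi> ((blinfun_apply x - blinfun_apply y) \<eta>)) < e"
    using * by (intro bexI[of _ "op_adj (P A) o\<^sub>L (x o\<^sub>L P A)"]) auto
qed

lemma fns_weight_diag: "fns_weight BH \<Phi>"
  by (simp add: fns_weight_def weight_diag faithful_diag normal_diag semifinite_diag)

end

section \<open>The modular group of a diagonal weight\<close>

lemma bounded_linear_scaleC_left: "bounded_linear (\<lambda>c. c *\<^sub>C \<xi>)"
  by (rule bounded_linear_intro[where K = "norm \<xi>"])
     (auto intro!: ell2_eqI simp: algebra_simps norm_scaleC_ell2 scaleR_conv_of_real)

context diagonal_weight
begin

text \<open>The unitary \<open>K^(i t)\<close> of the diagonal operator with eigenvalues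
  \<open>lam\<close>; it is bounded whether or not these are.\<close>

definition U :: "real \<Rightarrow> 'i op" where
  "U t = mult_op (\<lambda>i. cis (t * ln (lam i)))"

definition \<sigma> :: "real \<Rightarrow> 'i op \<Rightarrow> 'i op" where
  "\<sigma> t x = U t o\<^sub>L x o\<^sub>L U (- t)"

lemma U_BH [simp]: "U t \<in> BH" and coord_U: "coord (U t \<xi>) i = cis (t * ln (lam i)) * coord \<xi> i"
  and entry_U: "entry (U t) i j = (if i = j then cis (t * ln (lam i)) else 0)"
  unfolding U_def by (rule mult_op[where C = 1]; simp)+

lemma U_ket: "U t (ket j) = cis (t * ln (lam j)) *\<^sub>C ket j"
  by (rule ell2_eqI) (simp add: coord_U)

lemma U_apply_apply: "U s (U t \<xi>) = U (s + t) \<xi>"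
  by (rule ell2_eqI) (simp add: coord_U mult.assoc[symmetric] cis_mult distrib_right)

lemma U_zero: "U 0 \<xi> = \<xi>"
  by (rule ell2_eqI) (simp add: coord_U)

lemma op_adj_U: "op_adj (U t) = U (- t)"
  by (rule op_adj_eq_entryI) (auto simp: entry_U cis_cnj)

lemma norm_U: "norm (U t \<xi>) = norm \<xi>"
proof -
  have "(norm (U t \<xi>))\<^sup>2 = (norm \<xi>)\<^sup>2"
    by (simp add: norm_ell2_sq coord_U norm_mult)
  then show ?thesis by simp
qed

text \<open>On a truncation the orbit is a finite sum of characters times basis vectors; the
  approximation is uniform in \<open>t\<close> because every \<open>U t\<close> is
  isometric.\<close>

lemma U_continuous: "continuous_on UNIV (\<lambda>t. U t \<xi>)"
proof (rule uniform_limit_theorem[OF _ _ finite_subsets_at_top_neq_bot])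
  have "continuous_on UNIV (\<lambda>t. U t (trunc A \<xi>))" for A
    unfolding trunc_def blinfun.sum_right BH_scaleC[OF U_BH] U_ket
    by (intro continuous_intros bounded_linear.continuous_on[OF bounded_linear_scaleC_ell2]
        bounded_linear.continuous_on[OF bounded_linear_scaleC_left])
  then show "\<forall>\<^sub>F A in finite_subsets_at_top UNIV. continuous_on UNIV (\<lambda>t. U t (trunc A \<xi>))"
    by simp
  show "uniform_limit UNIV (\<lambda>A t. U t (trunc A \<xi>)) (\<lambda>t. U t \<xi>) (finite_subsets_at_top UNIV)"
  proof (rule uniform_limitI)
    fix e :: real assume "0 < e"
    then have "\<forall>\<^sub>F A in finite_subsets_at_top UNIV. dist (trunc A \<xi>) \<xi> < e"
      using trunc_tendsto by (rule tendstoD[rotated])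
    then show "\<forall>\<^sub>F A in finite_subsets_at_top UNIV. \<forall>t\<in>UNIV. dist (U t (trunc A \<xi>)) (U t \<xi>) < e"
      by (simp add: dist_norm blinfun.diff_right[symmetric] norm_U)
  qed
qed

section \<open>The one-parameter automorphism group\<close>

lemma \<sigma>_BH [simp, intro]: "x \<in> BH \<Longrightarrow> \<sigma> t x \<in> BH"
  by (simp add: \<sigma>_def)

lemma \<sigma>_apply: "\<sigma> t x \<xi> = U t (x (U (- t) \<xi>))"
  by (simp add: \<sigma>_def)

text \<open>Diagonal entries are untouched, which is the invariance of the weight; the factor
  \<open>(lam i / lam j)^(i t)\<close> off the diagonal is what the KMS function continues
  analytically.\<close>

lemma entry_\<sigma>: "x \<in> BH \<Longrightarrow> entry (\<sigma> t x) i j = cis (t * (ln (lam i) - ln (lam j))) * entry x i j"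
  by (simp add: entry_def \<sigma>_apply U_ket BH_scaleC coord_U mult.assoc[symmetric] cis_mult algebra_simps)

lemma star_automorphism_\<sigma>: "star_automorphism BH (\<sigma> t)"
  unfolding star_automorphism_def
proof (intro conjI ballI allI)
  show "bij_betw (\<sigma> t) BH BH"
    by (rule bij_betw_byWitness[where f' = "\<sigma> (- t)"])
       (auto intro!: blinfun_eqI simp: \<sigma>_apply U_apply_apply U_zero)
next
  fix c and x y :: "'i op" assume x: "x \<in> BH"
  show "\<sigma> t (x + y) = \<sigma> t x + \<sigma> t y"
    by (rule blinfun_eqI) (simp add: \<sigma>_apply blinfun.bilinear_simps)
  show "\<sigma> t (x o\<^sub>L y) = \<sigma> t x o\<^sub>L \<sigma> t y"
    by (rule blinfun_eqI) (simp add: \<sigma>_apply U_apply_apply U_zero)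
  show "\<sigma> t (op_scale c x) = op_scale c (\<sigma> t x)"
    by (rule blinfun_eqI) (simp add: \<sigma>_apply op_scale_apply BH_scaleC)
  show "\<sigma> t (op_adj x) = op_adj (\<sigma> t x)"
    using x by (simp add: \<sigma>_def op_adj_comp op_adj_U comp_assoc)
qed

lemma \<sigma>_adj: "x \<in> BH \<Longrightarrow> \<sigma> t (op_adj x) = op_adj (\<sigma> t x)"
  using star_automorphism_\<sigma>[of t] by (simp add: star_automorphism_def)

lemma one_parameter_\<sigma>: "one_parameter_automorphism_group BH \<sigma>"
  unfolding one_parameter_automorphism_group_def
proof (intro conjI ballI allI)
  fix s t and x :: "'i op" and \<xi> \<eta> :: "'i ell2" assume x: "x \<in> BH"
  show "\<sigma> 0 x = x"
    by (rule blinfun_eqI) (simp add: \<sigma>_apply U_zero)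
  show "\<sigma> (s + t) x = \<sigma> s (\<sigma> t x)"
    by (rule blinfun_eqI) (simp add: \<sigma>_apply U_apply_apply algebra_simps)
  have c: "continuous_on UNIV (\<lambda>t. U (- t) \<zeta>)" for \<zeta>
    by (rule continuous_on_compose2[OF U_continuous]) (auto intro: continuous_intros)
  \<comment> \<open>With \<open>U t\<close> moved across the inner product, strong continuity of
    \<open>U\<close> is enough.\<close>
  have "cinner \<xi> (\<sigma> t x \<eta>) = cinner (U (- t) \<xi>) (x (U (- t) \<eta>))" for t
    by (simp add: \<sigma>_apply cinner_adj_left[OF U_BH, symmetric] op_adj_U)
  moreover have "continuous_on UNIV (\<lambda>t. cinner (U (- t) \<xi>) (x (U (- t) \<eta>)))"
    using c unfolding continuous_on_def
    by (intro ballI tendsto_cinner blinfun.tendsto[OF tendsto_const, of _ _ _ x]) auto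
  ultimately show "continuous_on UNIV (\<lambda>t. cinner \<xi> (\<sigma> t x \<eta>))"
    by simp
qed (rule star_automorphism_\<sigma>)

lemma diag_weight_\<sigma>: "x \<in> BH \<Longrightarrow> \<Phi> (\<sigma> t x) = \<Phi> x"
  by (simp add: diag_weight_def entry_\<sigma>)

section \<open>The modular condition\<close>

lemma square_int_iff: "x \<in> square_int BH \<Phi> \<longleftrightarrow> x \<in> BH \<and> x \<in> \<LL> \<and> op_adj x \<in> \<LL>"
  using ideal_iff[of x] ideal_iff[of "op_adj x"] by (auto simp: square_int_def op_adj_adj)

lemma \<sigma>_ideal: "x \<in> \<LL> \<Longrightarrow> \<sigma> t x \<in> \<LL>"
  by (simp add: square_summable_ideal_def \<sigma>_apply U_ket norm_U BH_scaleC norm_scaleC_ell2)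

lemma \<sigma>_square_int: "x \<in> square_int BH \<Phi> \<Longrightarrow> \<sigma> t x \<in> square_int BH \<Phi>"
  by (auto simp: square_int_iff \<sigma>_adj[symmetric] \<sigma>_ideal)

text \<open>A weighted Hilbert-Schmidt series: each squared column norm is a sum over rows. The
  weight sits at the column index; passing to the adjoint moves it to the row index.\<close>

lemma ideal_entries_summable:
  assumes X: "X \<in> \<LL>"
  shows "(\<lambda>(j, i). lam j * (cmod (entry X i j))\<^sup>2) summable_on UNIV \<times> UNIV"
proof (rule summable_on_SigmaI)
  show "(\<lambda>j. lam j * (norm (X (ket j)))\<^sup>2) summable_on UNIV"
    using X by (simp add: square_summable_ideal_def)
  show "((\<lambda>i. case (j, i) of (j, i) \<Rightarrow> lam j * (cmod (entry X i j))\<^sup>2) has_sum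
      lam j * (norm (X (ket j)))\<^sup>2) UNIV" for j
    unfolding norm_ell2_sq prod.case entry_def
    by (intro has_sum_cmult_right has_sum_infsum coord_summable)
qed auto

text \<open>On the strip \<open>0 \<le> Im z \<le> 1\<close> the bound comes from
  \<open>\<lambda>\<^sub>i\<^bsup>1-s\<^esup> \<lambda>\<^sub>j\<^sup>s \<le> \<lambda>\<^sub>i + \<lambda>\<^sub>j\<close> for \<open>s = Im z\<close>.\<close>

definition kms_bound :: "'i op \<Rightarrow> 'i op \<Rightarrow> 'i \<times> 'i \<Rightarrow> real" where
  "kms_bound x y = (\<lambda>(i, j). (lam i + lam j) * (cmod (entry x i j) * cmod (entry y j i)))"

text \<open>After the product of two entries is bounded by the sum of their squares, four series
  remain. They come from \<open>x\<close>, \<open>y\<close>, \<open>op_adj x\<close> and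
  \<open>op_adj y\<close>, each in the ideal.\<close>

lemma kms_bound_summable:
  assumes x: "x \<in> square_int BH \<Phi>" and y: "y \<in> square_int BH \<Phi>"
  shows "kms_bound x y summable_on UNIV"
proof (rule summable_on_comparison_test)
  have B: "x \<in> BH" "y \<in> BH" using x y by (auto simp: square_int_iff)
  have 1: "(\<lambda>(i, j). lam i * (cmod (entry x i j))\<^sup>2) summable_on UNIV \<times> UNIV"
    using ideal_entries_summable[of "op_adj x"] x by (simp add: square_int_iff entry_adj)
  have 2: "(\<lambda>(i, j). lam i * (cmod (entry y j i))\<^sup>2) summable_on UNIV \<times> UNIV"
    using ideal_entries_summable[of y] y by (simp add: square_int_iff)
  have 3: "(\<lambda>(i, j). lam j * (cmod (entry x i j))\<^sup>2) summable_on UNIV \<times> UNIV"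
    using ideal_entries_summable[of x] x by (subst summable_on_swap) (simp add: square_int_iff)
  have 4: "(\<lambda>(i, j). lam j * (cmod (entry y j i))\<^sup>2) summable_on UNIV \<times> UNIV"
    using ideal_entries_summable[of "op_adj y"] y
    by (subst summable_on_swap) (simp add: square_int_iff entry_adj)
  show "(\<lambda>p. ((case p of (i, j) \<Rightarrow> lam i * (cmod (entry x i j))\<^sup>2) +
      (case p of (i, j) \<Rightarrow> lam i * (cmod (entry y j i))\<^sup>2)) +
      ((case p of (i, j) \<Rightarrow> lam j * (cmod (entry x i j))\<^sup>2) +
      (case p of (i, j) \<Rightarrow> lam j * (cmod (entry y j i))\<^sup>2))) summable_on UNIV"
    using 1 2 3 4 by (intro summable_on_add) simp_all
  fix p :: "'i \<times> 'i"
  obtain i j where p: "p = (i, j)" by (cases p)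
  have "cmod (entry x i j) * cmod (entry y j i) \<le> (cmod (entry x i j))\<^sup>2 + (cmod (entry y j i))\<^sup>2"
    using sum_squares_bound[of "cmod (entry x i j)" "cmod (entry y j i)"]
      mult_nonneg_nonneg[of "cmod (entry x i j)" "cmod (entry y j i)"] by (simp del: mult_nonneg_nonneg)
  then have "(lam i + lam j) * (cmod (entry x i j) * cmod (entry y j i))
      \<le> (lam i + lam j) * ((cmod (entry x i j))\<^sup>2 + (cmod (entry y j i))\<^sup>2)"
    by (intro mult_left_mono) auto
  then show "kms_bound x y p \<le> ((case p of (i, j) \<Rightarrow> lam i * (cmod (entry x i j))\<^sup>2) +
      (case p of (i, j) \<Rightarrow> lam i * (cmod (entry y j i))\<^sup>2)) +
      ((case p of (i, j) \<Rightarrow> lam j * (cmod (entry x i j))\<^sup>2) +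
      (case p of (i, j) \<Rightarrow> lam j * (cmod (entry y j i))\<^sup>2))"
    by (simp add: kms_bound_def p algebra_simps)
qed (auto simp: kms_bound_def)

definition kms_term :: "'i op \<Rightarrow> 'i op \<Rightarrow> 'i \<times> 'i \<Rightarrow> complex \<Rightarrow> complex" where
  "kms_term x y = (\<lambda>(i, j) z. of_real (lam i) * exp (\<i> * z * of_real (ln (lam i) - ln (lam j))) *
     (entry x i j * entry y j i))"

lemma kms_term_bound:
  assumes "0 \<le> Im z" "Im z \<le> 1"
  shows "cmod (kms_term x y p z) \<le> kms_bound x y p"
proof -
  obtain i j where p: "p = (i, j)" by (cases p)
  define d where "d = ln (lam i) - ln (lam j)"
  have e: "exp (- d) = lam j / lam i"
    using lam_pos[of i] lam_pos[of j] by (simp add: d_def exp_diff)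
  \<comment> \<open>The left side is monotone in \<open>Im z\<close>, with value
    \<open>lam i\<close> at 0 and \<open>lam j\<close> at 1.\<close>
  have "lam i * exp (- (Im z * d)) \<le> lam i + lam j"
  proof (cases "0 \<le> d")
    case True
    then have "lam i * exp (- (Im z * d)) \<le> lam i * 1"
      using assms by (intro mult_left_mono) auto
    then show ?thesis using lam_pos[of j] by simp
  next
    case False
    then have "lam i * exp (- (Im z * d)) \<le> lam i * exp (- d)"
      using assms mult_right_mono_neg[of "Im z" 1 d] by (intro mult_left_mono) auto
    also have "\<dots> = lam j"
      using lam_pos[of i] by (simp add: e)
    finally show ?thesis using lam_pos[of i] by simp
  qed
  then have "(lam i * exp (- (Im z * d))) * (cmod (entry x i j) * cmod (entry y j i))
      \<le> (lam i + lam j) * (cmod (entry x i j) * cmod (entry y j i))"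
    by (intro mult_right_mono) auto
  then show ?thesis
    by (simp add: kms_term_def kms_bound_def p norm_mult d_def)
qed

text \<open>Continuity, boundedness and holomorphy all come from one domination on the closed strip,
  the finite partial sums being entire. On the two boundary lines the terms are those of matrix
  products.\<close>

lemma kms_condition:
  assumes x: "x \<in> square_int BH \<Phi>" and y: "y \<in> square_int BH \<Phi>"
  shows "\<exists>G :: complex \<Rightarrow> complex.
        continuous_on {z. 0 \<le> Im z \<and> Im z \<le> 1} G \<and>
        bounded (G ` {z. 0 \<le> Im z \<and> Im z \<le> 1}) \<and>
        G holomorphic_on {z. 0 < Im z \<and> Im z < 1} \<and>
        (\<forall>t::real. G (of_real t) = weight_ext BH \<Phi> (\<sigma> t x o\<^sub>L y) \<and>
                   G (of_real t + \<i>) = weight_ext BH \<Phi> (y o\<^sub>L \<sigma> t x))"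
proof -
  let ?S = "{z. 0 \<le> Im z \<and> Im z \<le> 1}" and ?T = "{z. 0 < Im z \<and> Im z < 1}"
  define g where "g = kms_term x y"
  define G where "G = (\<lambda>z. \<Sum>\<^sub>\<infinity>p. g p z)"
  have B: "x \<in> BH" "y \<in> BH" using x y by (auto simp: square_int_iff)
  have bound: "cmod (g p z) \<le> kms_bound x y p" if "z \<in> ?S" for p z
    using that by (auto simp: g_def kms_term_bound)
  have gsum: "(\<lambda>p. g p z) summable_on UNIV" if "z \<in> ?S" for z
    by (rule abs_summable_summable, rule Infinite_Sum.abs_summable_on_comparison_test'[OF kms_bound_summable[OF x y]])
       (rule bound[OF that])
  have ul: "uniform_limit ?S (\<lambda>A z. \<Sum>p\<in>A. g p z) G (finite_subsets_at_top UNIV)"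
    unfolding G_def by (rule Weierstrass_m_test_general[OF bound kms_bound_summable[OF x y]])
  have hol: "(\<lambda>z. \<Sum>p\<in>A. g p z) holomorphic_on V" for A V
    unfolding g_def kms_term_def by (intro holomorphic_intros) (auto simp: split_beta intro!: holomorphic_intros)
  have "continuous_on ?S G"
    by (rule uniform_limit_theorem[OF _ ul finite_subsets_at_top_neq_bot])
       (simp add: hol holomorphic_on_imp_continuous_on)
  moreover have "bounded (G ` ?S)"
    unfolding bounded_iff
  proof (intro exI ballI)
    fix w assume "w \<in> G ` ?S"
    then obtain z where z: "z \<in> ?S" "w = G z" by blast
    show "norm w \<le> (\<Sum>\<^sub>\<infinity>p. kms_bound x y p)"
      unfolding z(2) G_def
      by (rule norm_infsum_le[OF has_sum_infsum[OF gsum[OF z(1)]] has_sum_infsum[OF kms_bound_summable[OF x y]]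
          bound[OF z(1)]])
  qed
  moreover have "G holomorphic_on ?T"
  proof (rule analytic_imp_holomorphic, unfold analytic_on_def, intro ballI)
    fix z assume z: "z \<in> ?T"
    have "open ?T"
      by (intro open_Collect_conj open_Collect_less continuous_intros)
    then have "\<exists>r>0. cball z r \<subseteq> ?T"
      using z unfolding open_contains_cball by (rule bspec)
    then obtain r where r: "0 < r" "cball z r \<subseteq> ?T"
      by (elim exE conjE)
    have "G holomorphic_on ball z r"
    proof (rule holomorphic_uniform_limit[where f = "\<lambda>A z. \<Sum>p\<in>A. g p z" and F = "finite_subsets_at_top UNIV" and z = z and r = r])
      show "uniform_limit (cball z r) (\<lambda>A z. \<Sum>p\<in>A. g p z) G (finite_subsets_at_top UNIV)"
        by (rule uniform_limit_on_subset[OF ul]) (use r in auto)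
    qed (auto simp: hol holomorphic_on_imp_continuous_on)
    then show "\<exists>e>0. G holomorphic_on ball z e"
      using r by blast
  qed
  moreover have "G (of_real t) = weight_ext BH \<Phi> (\<sigma> t x o\<^sub>L y)" for t
  proof -
    have s: "\<sigma> t x \<in> square_int BH \<Phi>" by (rule \<sigma>_square_int[OF x])
    have eq: "g (i, j) (of_real t) = of_real (lam i) * (entry (\<sigma> t x) i j * entry y j i)" for i j
      by (simp add: g_def kms_term_def entry_\<sigma>[OF B(1)] cis_conv_exp mult_ac)
    have "G (of_real t) = (\<Sum>\<^sub>\<infinity>i. \<Sum>\<^sub>\<infinity>j. g (i, j) (of_real t))"
      unfolding G_def using infsum_Sigma_banach[of "\<lambda>p. g p (of_real t)" UNIV "\<lambda>_. UNIV"] gsum[of "of_real t"] by simp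
    also have "\<dots> = (\<Sum>\<^sub>\<infinity>i. of_real (lam i) * entry (\<sigma> t x o\<^sub>L y) i i)"
      unfolding eq by (intro infsum_cong infsumI has_sum_cmult_right entry_comp_has_sum) (use B in auto)
    also have "\<dots> = weight_ext BH \<Phi> (\<sigma> t x o\<^sub>L y)"
      using weight_ext_ideal_product[of "op_adj (\<sigma> t x)" y] s y by (simp add: square_int_iff op_adj_adj)
    finally show ?thesis .
  qed
  moreover have "G (of_real t + \<i>) = weight_ext BH \<Phi> (y o\<^sub>L \<sigma> t x)" for t
  proof -
    have s: "\<sigma> t x \<in> square_int BH \<Phi>" by (rule \<sigma>_square_int[OF x])
    \<comment> \<open>On the upper boundary the extra factor
      \<open>exp (- d) = lam j / lam i\<close> trades the weight \<open>lam i\<close> for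
      \<open>lam j\<close>; summing over \<open>i\<close> first then gives the product in the
      opposite order.\<close>
    have eq: "g (i, j) (of_real t + \<i>) = of_real (lam j) * (entry y j i * entry (\<sigma> t x) i j)" for i j
    proof -
      define d where "d = ln (lam i) - ln (lam j)"
      have exponent: "\<i> * (of_real t + \<i>) * of_real d = \<i> * of_real (t * d) + of_real (- d)"
        by (simp add: algebra_simps)
      have "exp (\<i> * (of_real t + \<i>) * of_real d) = cis (t * d) * of_real (exp (- d))"
        by (simp only: exponent cis_conv_exp exp_add exp_of_real)
      also have "exp (- d) = lam j / lam i"
        using lam_pos[of i] lam_pos[of j] by (simp add: d_def exp_diff)
      finally have "of_real (lam i) * exp (\<i> * (of_real t + \<i>) * of_real d) = cis (t * d) * of_real (lam j)"
        using lam_pos[of i] by simp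
      then show ?thesis
        by (simp add: g_def kms_term_def entry_\<sigma>[OF B(1)] d_def mult_ac)
    qed
    have "G (of_real t + \<i>) = (\<Sum>\<^sub>\<infinity>i. \<Sum>\<^sub>\<infinity>j. g (i, j) (of_real t + \<i>))"
      unfolding G_def using infsum_Sigma_banach[of "\<lambda>p. g p (of_real t + \<i>)" UNIV "\<lambda>_. UNIV"] gsum[of "of_real t + \<i>"] by simp
    also have "\<dots> = (\<Sum>\<^sub>\<infinity>j. \<Sum>\<^sub>\<infinity>i. g (i, j) (of_real t + \<i>))"
      by (rule infsum_swap_banach) (use gsum[of "of_real t + \<i>"] in \<open>simp add: case_prod_unfold\<close>)
    also have "\<dots> = (\<Sum>\<^sub>\<infinity>j. of_real (lam j) * entry (y o\<^sub>L \<sigma> t x) j j)"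
      unfolding eq by (intro infsum_cong infsumI has_sum_cmult_right entry_comp_has_sum) (use B in auto)
    also have "\<dots> = weight_ext BH \<Phi> (y o\<^sub>L \<sigma> t x)"
      using weight_ext_ideal_product[of "op_adj y" "\<sigma> t x"] s y by (simp add: square_int_iff op_adj_adj)
    finally show ?thesis .
  qed
  ultimately show ?thesis by blast
qed

lemma modular_group_diag: "modular_group BH \<Phi> \<sigma>"
  unfolding modular_group_def
  using one_parameter_\<sigma> diag_weight_\<sigma> kms_condition by (auto simp: pos_part_BH op_pos_BH)

end

section \<open>The representation of the quantum group\<close>

locale suq2_representation =
  fixes q :: real
  assumes q_pos: "0 < q" and q_less_1: "q < 1"
begin

section \<open>The generators and their relations\<close>

lemma entry_op_a: "entry (op_a q) (k', l') (k, l) =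
    (if k' = k + 1 \<and> l' = l then of_real (sqrt (1 - q ^ (2 * k + 2))) else 0)"
  using op_a(2)[OF q_pos q_less_1, of k l] by (simp add: entry_def)

lemma entry_op_b: "entry (op_b q) (k', l') (k, l) = (if k' = k \<and> l' = l + 1 then of_real (q ^ k) else 0)"
  using op_b(2)[OF q_pos q_less_1, of k l] by (simp add: entry_def)

lemma op_ab_BH [simp]: "op_a q \<in> BH" "op_b q \<in> BH"
  using op_a op_b q_pos q_less_1 by auto

lemma op_adj_a_ket: "op_adj (op_a q) (ket (k, l)) =
    (if k = 0 then 0 else of_real (sqrt (1 - q ^ (2 * k))) *\<^sub>C ket (k - 1, l))"
proof (rule ell2_eqI)
  fix i :: "nat \<times> int"
  obtain k' l' where i: "i = (k', l')" by (cases i)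
  have "coord (op_adj (op_a q) (ket (k, l))) i = cnj (entry (op_a q) (k, l) (k', l'))"
    using entry_adj[of "op_a q" i "(k, l)"] by (simp add: i entry_def)
  also have "\<dots> = coord (if k = 0 then 0 else of_real (sqrt (1 - q ^ (2 * k))) *\<^sub>C ket (k - 1, l)) i"
    unfolding entry_op_a i by (cases k) auto
  finally show "coord (op_adj (op_a q) (ket (k, l))) i =
      coord (if k = 0 then 0 else of_real (sqrt (1 - q ^ (2 * k))) *\<^sub>C ket (k - 1, l)) i" .
qed

lemma op_adj_b_ket: "op_adj (op_b q) (ket (k, l)) = of_real (q ^ k) *\<^sub>C ket (k, l - 1)"
proof (rule ell2_eqI)
  fix i :: "nat \<times> int"
  obtain k' l' where i: "i = (k', l')" by (cases i)
  have "coord (op_adj (op_b q) (ket (k, l))) i = cnj (entry (op_b q) (k, l) (k', l'))"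
    using entry_adj[of "op_b q" i "(k, l)"] by (simp add: i entry_def)
  also have "\<dots> = coord (of_real (q ^ k) *\<^sub>C ket (k, l - 1)) i"
    unfolding entry_op_b i by auto
  finally show "coord (op_adj (op_b q) (ket (k, l))) i = coord (of_real (q ^ k) *\<^sub>C ket (k, l - 1)) i" .
qed

lemma sqrt_sq_eigenvalue:
  "complex_of_real (sqrt (1 - q ^ n)) * complex_of_real (sqrt (1 - q ^ n)) = 1 - complex_of_real (q ^ n)"
proof -
  have "q ^ n \<le> 1" using q_pos q_less_1 by (intro power_le_one) auto
  then have "sqrt (1 - q ^ n) * sqrt (1 - q ^ n) = 1 - q ^ n" by simp
  then show ?thesis
    by (metis of_real_1 of_real_diff of_real_mult)
qed

lemmas generator_kets = op_a(2)[OF q_pos q_less_1] op_b(2)[OF q_pos q_less_1] op_adj_a_ket op_adj_b_ket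
  BH_scaleC[OF op_ab_BH(1)] BH_scaleC[OF op_ab_BH(2)]
  BH_scaleC[OF op_adj_BH[OF op_ab_BH(1)]] BH_scaleC[OF op_adj_BH[OF op_ab_BH(2)]]

lemma rep_ba: "op_b q o\<^sub>L op_a q = op_scale (of_real q) (op_a q o\<^sub>L op_b q)"
  by (rule BH_eqI) (auto simp: generator_kets op_scale_apply scaleC_simps mult_ac)

lemma rep_b_normal: "op_b q o\<^sub>L op_adj (op_b q) = op_adj (op_b q) o\<^sub>L op_b q"
  by (rule BH_eqI) (auto simp: generator_kets scaleC_simps)

lemma rep_bstar_a: "op_adj (op_b q) o\<^sub>L op_a q = op_scale (of_real q) (op_a q o\<^sub>L op_adj (op_b q))"
  by (rule BH_eqI) (auto simp: generator_kets op_scale_apply scaleC_simps mult_ac)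

text \<open>On \<open>ket (k, l)\<close> the two summands contribute \<open>1 - q^(2 k)\<close> and
  \<open>q^(2 k)\<close>. For \<open>k = 0\<close> the adjoint of \<open>op_a q\<close> annihilates
  the vector and the second contribution is 1.\<close>

lemma rep_sphere: "(op_a q o\<^sub>L op_adj (op_a q)) + (op_b q o\<^sub>L op_adj (op_b q)) = id_blinfun"
proof (rule BH_eqI)
  fix i :: "nat \<times> int"
  obtain k l where i: "i = (k, l)" by (cases i)
  have p: "complex_of_real (q ^ k) * complex_of_real (q ^ k) = of_real (q ^ (2 * k))"
    by (simp add: power_add mult_2)
  show "((op_a q o\<^sub>L op_adj (op_a q)) + (op_b q o\<^sub>L op_adj (op_b q))) (ket i) = id_blinfun (ket i)"
  proof (cases k)
    case 0
    then show ?thesis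
      by (simp add: i blinfun.add_left generator_kets scaleC_simps)
  next
    case (Suc n)
    have "((op_a q o\<^sub>L op_adj (op_a q)) + (op_b q o\<^sub>L op_adj (op_b q))) (ket i) =
        (of_real (sqrt (1 - q ^ (2 * k))) * of_real (sqrt (1 - q ^ (2 * k))) + of_real (q ^ (2 * k))) *\<^sub>C ket i"
      unfolding scaleC_simps(2) p[symmetric]
      using Suc by (simp add: i blinfun.add_left generator_kets scaleC_simps mult_ac)
    then show ?thesis
      by (simp add: sqrt_sq_eigenvalue scaleC_simps)
  qed
qed auto

text \<open>Here \<open>op_a q\<close> acts first and its weight gives
  \<open>1 - q^(2 k + 2)\<close>; the factor \<open>q^2\<close> lifts the other summand to the
  matching power.\<close>

lemma rep_sphere': "(op_adj (op_a q) o\<^sub>L op_a q) + op_scale (of_real (q\<^sup>2)) (op_b q o\<^sub>L op_adj (op_b q)) = id_blinfun"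
proof (rule BH_eqI)
  fix i :: "nat \<times> int"
  obtain k l where i: "i = (k, l)" by (cases i)
  have p: "complex_of_real (q\<^sup>2) * (complex_of_real (q ^ k) * complex_of_real (q ^ k)) = of_real (q ^ (2 * k + 2))"
    by (simp add: power_add mult_2 power2_eq_square)
  have "((op_adj (op_a q) o\<^sub>L op_a q) + op_scale (of_real (q\<^sup>2)) (op_b q o\<^sub>L op_adj (op_b q))) (ket i) =
      (of_real (sqrt (1 - q ^ (2 * k + 2))) * of_real (sqrt (1 - q ^ (2 * k + 2))) + of_real (q ^ (2 * k + 2))) *\<^sub>C ket i"
    unfolding scaleC_simps(2) p[symmetric]
    by (simp add: i blinfun.add_left generator_kets op_scale_apply scaleC_simps mult_ac)
  then show "((op_adj (op_a q) o\<^sub>L op_a q) + op_scale (of_real (q\<^sup>2)) (op_b q o\<^sub>L op_adj (op_b q))) (ket i) =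
      id_blinfun (ket i)"
    unfolding sqrt_sq_eigenvalue by (simp add: scaleC_simps)
qed auto

lemma pi0_term_BH [simp]: "pi0_term q x \<in> BH"
  by (induction x) auto

text \<open>This makes \<open>pi0\<close> well defined: the terms of one class share one operator,
  so the image in its definition is a singleton.\<close>

lemma pi0_term_sound: "suq2_eq q x y \<Longrightarrow> pi0_term q x = pi0_term q y"
proof (induction rule: suq2_eq.induct)
  case (scale_plus_right c x y) then show ?case by (simp add: op_module.scale_right_distrib)
next
  case (scale_plus_left c d x) then show ?case by (simp add: op_module.scale_left_distrib)
next
  case rel_b_normal then show ?case by (simp add: rep_b_normal)
qed (simp_all add: comp_add comp_assoc op_scale_comp op_adj_simps rep_ba rep_bstar_a
    rep_sphere rep_sphere'[simplified] add_ac)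

lemma suq2_class_eqI: "suq2_eq q x y \<Longrightarrow> suq2_class q x = suq2_class q y"
  unfolding suq2_class_def by (blast intro: suq2_eq.sym suq2_eq.trans)

lemma self_in_suq2_class: "x \<in> suq2_class q x"
  by (simp add: suq2_class_def suq2_eq.refl)

text \<open>The operations of \<open>suq2\<close> are unions over representatives; for a congruent
  operation all the united classes coincide.\<close>

lemma suq2_class_UN:
  assumes "\<And>y. suq2_eq q x y \<Longrightarrow> suq2_eq q (f x) (f y)"
  shows "(\<Union>y\<in>suq2_class q x. suq2_class q (f y)) = suq2_class q (f x)"
proof -
  have "suq2_class q (f y) = suq2_class q (f x)" if "y \<in> suq2_class q x" for y
    by (rule suq2_class_eqI[OF suq2_eq.sym[OF assms]]) (use that in \<open>simp add: suq2_class_def\<close>)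
  then show ?thesis
    using self_in_suq2_class by blast
qed

lemma suq2_simps:
  "suq2_class q x \<oplus>\<^bsub>suq2 q\<^esub> suq2_class q y = suq2_class q (Tm_plus x y)"
  "suq2_class q x \<otimes>\<^bsub>suq2 q\<^esub> suq2_class q y = suq2_class q (Tm_times x y)"
  "\<one>\<^bsub>suq2 q\<^esub> = suq2_class q Tm_one"
  "c \<odot>\<^bsub>suq2 q\<^esub> suq2_class q x = suq2_class q (Tm_scale c x)"
  "star (suq2 q) (suq2_class q x) = suq2_class q (Tm_star x)"
  "carrier (suq2 q) = range (suq2_class q)"
  by (simp_all add: suq2_def suq2_class_UN suq2_eq.intros(1,4-7))

lemma pi0_class: "pi0 q (suq2_class q x) = pi0_term q x"
proof -
  have "pi0_term q y = pi0_term q x" if "y \<in> suq2_class q x" for y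
    using that pi0_term_sound[of x y] by (simp add: suq2_class_def)
  then have "pi0_term q ` suq2_class q x = (\<lambda>_. pi0_term q x) ` suq2_class q x"
    by (rule image_cong[OF HOL.refl])
  also have "\<dots> = {pi0_term q x}"
    by (rule image_constant[OF self_in_suq2_class])
  finally have "pi0_term q ` suq2_class q x = {pi0_term q x}" .
  then show ?thesis by (simp add: pi0_def)
qed

lemma pi0_image: "pi0 q ` carrier (suq2 q) = range (pi0_term q)"
  by (simp add: suq2_simps image_image pi0_class)

lemma star_representation_pi0: "star_representation (suq2 q) (pi0 q)"
  unfolding star_representation_def pi0_image suq2_simps(3,6)
  by (auto simp: pi0_class suq2_simps(1-5))

lemma unital_star_subalgebra_pi0: "unital_star_subalgebra (range (pi0_term q))"
proof -
  have "id_blinfun = pi0_term q Tm_one" "pi0_term q x + pi0_term q y = pi0_term q (Tm_plus x y)"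
    "pi0_term q x o\<^sub>L pi0_term q y = pi0_term q (Tm_times x y)" 
    "op_scale c (pi0_term q x) = pi0_term q (Tm_scale c x)" "op_adj (pi0_term q x) = pi0_term q (Tm_star x)" for x y c
    by simp_all
  then show ?thesis
    unfolding unital_star_subalgebra_def by (auto simp del: pi0_term.simps)
qed

end

section \<open>Separability\<close>

lemma norm_op_scale_le: "norm (op_scale c T) \<le> cmod c * norm T"
proof (rule norm_blinfun_bound)
  fix \<xi>
  show "norm (op_scale c T \<xi>) \<le> cmod c * norm T * norm \<xi>"
    using mult_left_mono[OF norm_blinfun[of T \<xi>], of "cmod c"] by (simp add: op_scale_apply norm_scaleC_ell2 mult.assoc)
qed simp

lemma bounded_bilinear_op_scale: "bounded_bilinear op_scale"
proof
  show "\<exists>K. \<forall>c T. norm (op_scale c T) \<le> norm c * norm T * K"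
    by (intro exI[of _ 1] allI) (simp add: norm_op_scale_le)
qed (auto intro!: blinfun_eqI ell2_eqI simp: op_scale_apply blinfun.bilinear_simps algebra_simps scaleR_conv_of_real)

text \<open>The stage bounds the nesting depth, so countability is an induction; the union of all
  stages consists of the terms with scalars in \<open>Q\<close>.\<close>

primrec terms_over :: "complex set \<Rightarrow> nat \<Rightarrow> suq2_term set" where
  "terms_over Q 0 = {Gen_a, Gen_b, Tm_zero, Tm_one}"
| "terms_over Q (Suc n) = terms_over Q n \<union> Tm_star ` terms_over Q n \<union>
     (\<lambda>(x, y). Tm_plus x y) ` (terms_over Q n \<times> terms_over Q n) \<union>
     (\<lambda>(x, y). Tm_times x y) ` (terms_over Q n \<times> terms_over Q n) \<union>
     (\<lambda>(c, x). Tm_scale c x) ` (Q \<times> terms_over Q n)"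

lemma countable_terms_over: "countable Q \<Longrightarrow> countable (terms_over Q n)"
  by (induction n) auto

lemma terms_over_mono: "m \<le> n \<Longrightarrow> terms_over Q m \<subseteq> terms_over Q n"
  by (induction n rule: dec_induct) auto

lemma terms_over_closed:
  "Tm_star x \<in> (\<Union>n. terms_over Q n)" "c \<in> Q \<Longrightarrow> Tm_scale c x \<in> (\<Union>n. terms_over Q n)"
  "y \<in> (\<Union>n. terms_over Q n) \<Longrightarrow> Tm_plus x y \<in> (\<Union>n. terms_over Q n)"
  "y \<in> (\<Union>n. terms_over Q n) \<Longrightarrow> Tm_times x y \<in> (\<Union>n. terms_over Q n)"
  if x: "x \<in> (\<Union>n. terms_over Q n)"
proof -
  obtain m where m: "x \<in> terms_over Q m" using x by blast
  then have "Tm_star x \<in> terms_over Q (Suc m)" "c \<in> Q \<Longrightarrow> Tm_scale c x \<in> terms_over Q (Suc m)"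
    by auto
  then show "Tm_star x \<in> (\<Union>n. terms_over Q n)" "c \<in> Q \<Longrightarrow> Tm_scale c x \<in> (\<Union>n. terms_over Q n)"
    by blast+
  assume "y \<in> (\<Union>n. terms_over Q n)"
  then obtain n where n: "y \<in> terms_over Q n" by blast
  have "x \<in> terms_over Q (max m n)" "y \<in> terms_over Q (max m n)"
    using m n terms_over_mono[of m "max m n" Q] terms_over_mono[of n "max m n" Q] by auto
  then have "Tm_plus x y \<in> terms_over Q (Suc (max m n))" "Tm_times x y \<in> terms_over Q (Suc (max m n))"
    by auto
  then show "Tm_plus x y \<in> (\<Union>n. terms_over Q n)" "Tm_times x y \<in> (\<Union>n. terms_over Q n)"
    by blast+
qed

context suq2_representation
begin

text \<open>Terms with scalars from a countable dense set suffice: all operations are norm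
  continuous, so sequences approximating the subterms combine into one for the term.\<close>

lemma separable_pi0: "separable_space (top_of_set (range (pi0_term q)))"
proof -
  obtain Q :: "complex set" where Q: "countable Q" "\<And>X. open X \<Longrightarrow> X \<noteq> {} \<Longrightarrow> \<exists>d\<in>Q. d \<in> X"
    by (rule countable_dense_setE) blast
  have dense: "c \<in> closure Q" for c
    unfolding closure_approachable using Q(2)[of "ball c _"] by (auto simp: dist_commute)
  define D where "D = (\<Union>n. terms_over Q n)"
  note D_closed = terms_over_closed[where Q = Q, folded D_def]
  have "countable D"
    unfolding D_def using Q(1) by (auto intro: countable_terms_over)
  have seq: "\<exists>s. (\<forall>n. s n \<in> D) \<and> (\<lambda>n. pi0_term q (s n)) \<longlonglongrightarrow> pi0_term q x" for x
  proof (induction x)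
    case Gen_a
    show ?case by (intro exI[of _ "\<lambda>_. Gen_a"]) (auto simp: D_def intro: exI[of _ 0])
  next
    case Gen_b
    show ?case by (intro exI[of _ "\<lambda>_. Gen_b"]) (auto simp: D_def intro: exI[of _ 0])
  next
    case Tm_zero
    show ?case by (intro exI[of _ "\<lambda>_. Tm_zero"]) (auto simp: D_def intro: exI[of _ 0])
  next
    case Tm_one
    show ?case by (intro exI[of _ "\<lambda>_. Tm_one"]) (auto simp: D_def intro: exI[of _ 0])
  next
    case (Tm_plus x y)
    then obtain s s' where "\<forall>n. s n \<in> D" "\<forall>n. s' n \<in> D" "(\<lambda>n. pi0_term q (s n)) \<longlonglongrightarrow> pi0_term q x"
      "(\<lambda>n. pi0_term q (s' n)) \<longlonglongrightarrow> pi0_term q y" by auto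
    then show ?case
      by (intro exI[of _ "\<lambda>n. Tm_plus (s n) (s' n)"]) (auto intro!: D_closed tendsto_add)
  next
    case (Tm_times x y)
    then obtain s s' where "\<forall>n. s n \<in> D" "\<forall>n. s' n \<in> D" "(\<lambda>n. pi0_term q (s n)) \<longlonglongrightarrow> pi0_term q x"
      "(\<lambda>n. pi0_term q (s' n)) \<longlonglongrightarrow> pi0_term q y" by auto
    then show ?case
      by (intro exI[of _ "\<lambda>n. Tm_times (s n) (s' n)"])
         (auto intro!: D_closed bounded_bilinear.tendsto[OF bounded_bilinear_blinfun_compose])
  next
    case (Tm_scale c x)
    then obtain s where s: "\<forall>n. s n \<in> D" "(\<lambda>n. pi0_term q (s n)) \<longlonglongrightarrow> pi0_term q x" by auto
    obtain u where u: "\<forall>n. u n \<in> Q" "u \<longlonglongrightarrow> c"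
      using dense[of c] unfolding closure_sequential by blast
    show ?case
      using s u by (intro exI[of _ "\<lambda>n. Tm_scale (u n) (s n)"])
         (auto intro!: D_closed bounded_bilinear.tendsto[OF bounded_bilinear_op_scale])
  next
    case (Tm_star x)
    then obtain s where s: "\<forall>n. s n \<in> D" "(\<lambda>n. pi0_term q (s n)) \<longlonglongrightarrow> pi0_term q x" by auto
    have "(\<lambda>n. op_adj (pi0_term q (s n))) \<longlonglongrightarrow> op_adj (pi0_term q x)"
    proof (rule Lim_null[THEN iffD2], rule Lim_null_comparison)
      show "(\<lambda>n. norm (pi0_term q (s n) - pi0_term q x)) \<longlonglongrightarrow> 0"
        using s(2) by (simp add: tendsto_norm_zero_iff LIM_zero_iff)
      show "\<forall>\<^sub>F n in sequentially. norm (op_adj (pi0_term q (s n)) - op_adj (pi0_term q x))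
          \<le> norm (pi0_term q (s n) - pi0_term q x)"
        by (simp add: op_adj_diff[symmetric] norm_op_adj_le)
    qed
    then show ?case
      using s by (intro exI[of _ "\<lambda>n. Tm_star (s n)"]) (auto intro!: D_closed)
  qed
  have "range (pi0_term q) \<subseteq> closure (pi0_term q ` D)"
  proof
    fix y assume "y \<in> range (pi0_term q)"
    then obtain x where x: "y = pi0_term q x" by blast
    obtain s where "\<forall>n. s n \<in> D" "(\<lambda>n. pi0_term q (s n)) \<longlonglongrightarrow> pi0_term q x"
      using seq by blast
    then show "y \<in> closure (pi0_term q ` D)"
      unfolding x closure_sequential by (intro exI[of _ "\<lambda>n. pi0_term q (s n)"]) auto
  qed
  then have "top_of_set (range (pi0_term q)) closure_of (pi0_term q ` D) = range (pi0_term q)"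
    by (auto simp: closure_of_subtopology Int_absorb1 image_mono)
  then show ?thesis
    unfolding separable_space_def using \<open>countable D\<close>
    by (intro exI[of _ "pi0_term q ` D"]) auto
qed

end

section \<open>Homogeneous operators\<close>

text \<open>Complex-linearity of \<open>A\<close> is what lets the scalars of the right factor pass
  the left one.\<close>

lemma span_comp:
  assumes x: "x \<in> op_module.span A" and y: "y \<in> op_module.span B" and A: "A \<subseteq> BH"
    and AB: "\<And>a b. a \<in> A \<Longrightarrow> b \<in> B \<Longrightarrow> a o\<^sub>L b \<in> op_module.span D"
  shows "x o\<^sub>L y \<in> op_module.span D"
  using x
proof (induction rule: op_module.span_induct_alt)
  case base
  show ?case by (metis blinfun_compose_zero(1) op_module.span_zero)
next
  case (step c a x)
  have "a o\<^sub>L y \<in> op_module.span D"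
    using y
  proof (induction rule: op_module.span_induct_alt)
    case base
    show ?case by (metis blinfun_compose_zero(2) op_module.span_zero)
  next
    case (step d b y)
    moreover have "a \<in> BH" using A \<open>a \<in> A\<close> by blast
    ultimately show ?case
      using AB \<open>a \<in> A\<close> by (auto simp: comp_add op_scale_comp intro!: op_module.span_add op_module.span_scale)
  qed
  then show ?case
    using step by (auto simp: comp_add op_scale_comp intro!: op_module.span_add op_module.span_scale)
qed

lemma span_adj:
  assumes x: "x \<in> op_module.span A" and A: "A \<subseteq> BH" and adj: "\<And>a. a \<in> A \<Longrightarrow> op_adj a \<in> op_module.span D"
  shows "op_adj x \<in> op_module.span D"
proof -
  have "x \<in> BH \<and> op_adj x \<in> op_module.span D"
    using x
  proof (induction rule: op_module.span_induct_alt)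
    case base
    show ?case by (simp add: op_adj_zero op_module.span_zero)
  next
    case (step c a x)
    then have "a \<in> BH" using A by blast
    then show ?case
      using step adj by (auto simp: op_adj_simps intro!: op_module.span_add op_module.span_scale)
  qed
  then show ?thesis ..
qed

text \<open>The spanning elements are positive, hence self-adjoint. This reduces shifts that lower
  \<open>k\<close> to shifts that raise it.\<close>

lemma weight_dom_adj:
  assumes "x \<in> weight_dom BH \<Phi>"
  shows "op_adj x \<in> weight_dom BH \<Phi>"
  unfolding weight_dom_def
  by (rule span_adj[OF assms[unfolded weight_dom_def]])
     (auto simp: finite_pos_def pos_part_def op_adj_pos intro!: op_module.span_base)

text \<open>Weighted shifts by \<open>(m, n)\<close>, negative degrees included. The condition is
  stated in integers, so a column that would be moved below \<open>k = 0\<close> is zero.\<close>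

definition homogeneous :: "int \<Rightarrow> int \<Rightarrow> (nat \<times> int) op \<Rightarrow> bool" where
  "homogeneous m n T \<longleftrightarrow> T \<in> BH \<and>
     (\<forall>k l k' l'. entry T (k', l') (k, l) \<noteq> 0 \<longrightarrow> int k' = int k + m \<and> l' = l + n)"

lemma homogeneous_BH: "homogeneous m n T \<Longrightarrow> T \<in> BH"
  by (simp add: homogeneous_def)

text \<open>A column of \<open>T\<close> has at most one nonzero entry. For \<open>k + m < 0\<close>
  the function \<open>nat\<close> returns 0, but homogeneity makes that entry of \<open>T\<close>
  vanish, so the formula survives.\<close>

lemma homogeneous_entry_comp:
  assumes S: "S \<in> BH" and T: "homogeneous m n T"
  shows "entry (S o\<^sub>L T) i (k, l) =
    entry S i (nat (int k + m), l + n) * entry T (nat (int k + m), l + n) (k, l)"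
proof (rule has_sum_single[OF entry_comp_has_sum[OF S]])
  fix j assume j: "j \<noteq> (nat (int k + m), l + n)"
  obtain k' l' where [simp]: "j = (k', l')" by (cases j)
  have "entry T j (k, l) = 0"
  proof (rule ccontr)
    assume "entry T j (k, l) \<noteq> 0"
    then have "int k' = int k + m \<and> l' = l + n"
      using T by (simp add: homogeneous_def)
    then have "k' = nat (int k + m) \<and> l' = l + n" by linarith
    then show False using j by simp
  qed
  then show "entry S i j * entry T j (k, l) = 0" by simp
qed

lemma homogeneous_comp:
  assumes S: "homogeneous m n S" and T: "homogeneous m' n' T"
  shows "homogeneous (m + m') (n + n') (S o\<^sub>L T)"
  unfolding homogeneous_def
proof (intro conjI allI impI)
  fix k l k' l'
  assume "entry (S o\<^sub>L T) (k', l') (k, l) \<noteq> 0"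
  then have *: "entry S (k', l') (nat (int k + m'), l + n') \<noteq> 0" "entry T (nat (int k + m'), l + n') (k, l) \<noteq> 0"
    using homogeneous_entry_comp[OF homogeneous_BH[OF S] T, of "(k', l')" k l] by auto
  have "int (nat (int k + m')) = int k + m'"
    using T *(2) unfolding homogeneous_def by blast
  moreover have "int k' = int (nat (int k + m')) + m \<and> l' = l + n' + n"
    using S *(1) unfolding homogeneous_def by blast
  ultimately show "int k' = int k + (m + m')" "l' = l + (n + n')" by auto
qed (use S T in \<open>auto simp: homogeneous_def\<close>)

lemma homogeneous_adj: "homogeneous m n T \<Longrightarrow> homogeneous (- m) (- n) (op_adj T)"
  unfolding homogeneous_def by (fastforce simp: entry_adj)

context suq2_representation
begin

text \<open>The two degrees are those of the gauge actions on \<open>a\<close> and \<open>b\<close>. In an algebra element every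
  component of nonzero \<open>b\<close>-degree contains a factor \<open>b\<close> or \<open>b\<^sup>*\<close>, hence decays like \<open>q\<^sup>k\<close>.\<close>

definition graded_elements :: "(nat \<times> int) op set" where
  "graded_elements = {T. \<exists>m n C. homogeneous m n T \<and>
     (n \<noteq> 0 \<longrightarrow> (\<forall>i k l. cmod (entry T i (k, l)) \<le> C * q ^ k))}"

text \<open>The rate \<open>s\<close> will count commutator factors; \<open>L\<close> confines the
  nonzero columns to a strip of finitely many \<open>l\<close>.\<close>

definition decaying :: "nat \<Rightarrow> (nat \<times> int) op set" where
  "decaying s = {T. \<exists>m n C L. homogeneous m n T \<and>
     (\<forall>i k l. cmod (entry T i (k, l)) \<le> C * q ^ (s * k) \<and> (entry T i (k, l) \<noteq> 0 \<longrightarrow> \<bar>l\<bar> \<le> L))}"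

lemma graded_BH: "graded_elements \<subseteq> BH"
  by (auto simp: graded_elements_def homogeneous_BH)

lemma decaying_BH: "decaying s \<subseteq> BH"
  by (auto simp: decaying_def homogeneous_BH)

text \<open>Moving by at most \<open>M\<close> levels costs the decay only a constant
  factor.\<close>

lemma power_shift_le:
  assumes "k \<le> k' + M"
  shows "q ^ (s * k') \<le> q ^ (s * k) / q ^ (s * M)"
proof -
  have "s * k \<le> s * k' + s * M"
    using mult_le_mono2[OF assms, of s] by (simp only: add_mult_distrib2)
  then have "q ^ (s * k' + s * M) \<le> q ^ (s * k)"
    using q_pos q_less_1 by (intro power_decreasing) auto
  then show ?thesis
    using q_pos by (simp only: power_add pos_le_divide_eq zero_less_power)
qed

text \<open>\<open>T\<close> moves column \<open>k\<close> to level \<open>k + m\<close>, where the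
  decay of \<open>S\<close> is read off at the cost of a constant; then the rates add. Rate 0 covers
  a factor that is merely bounded.\<close>

lemma homogeneous_decay_comp:
  assumes S: "S \<in> BH" and T: "homogeneous m n T"
    and dS: "\<And>i k l. cmod (entry S i (k, l)) \<le> C * q ^ (s * k)"
    and dT: "\<And>i k l. cmod (entry T i (k, l)) \<le> D * q ^ (t * k)"
  shows "cmod (entry (S o\<^sub>L T) i (k, l)) \<le> (C / q ^ (s * nat \<bar>m\<bar>) * D) * q ^ ((s + t) * k)"
proof -
  have C: "0 \<le> C" using order_trans[OF norm_ge_zero dS[of undefined 0 undefined]] by simp
  have "cmod (entry S i (nat (int k + m), l + n)) \<le> C * q ^ (s * nat (int k + m))"
    by (rule dS)
  also have "\<dots> \<le> C * (q ^ (s * k) / q ^ (s * nat \<bar>m\<bar>))"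
    using C by (intro mult_left_mono power_shift_le) auto
  finally have "cmod (entry S i (nat (int k + m), l + n)) * cmod (entry T (nat (int k + m), l + n) (k, l))
      \<le> C * (q ^ (s * k) / q ^ (s * nat \<bar>m\<bar>)) * (D * q ^ (t * k))"
    using C q_pos by (intro mult_mono dT) auto
  then show ?thesis
    by (simp add: homogeneous_entry_comp[OF S T] norm_mult power_add distrib_right distrib_left mult_ac)
qed

lemma homogeneous_decay_adj:
  assumes T: "homogeneous m n T" and dT: "\<And>i k l. cmod (entry T i (k, l)) \<le> C * q ^ (s * k)"
  shows "cmod (entry (op_adj T) i (k, l)) \<le> (C / q ^ (s * nat \<bar>m\<bar>)) * q ^ (s * k)"
proof -
  have C: "0 \<le> C" using order_trans[OF norm_ge_zero dT[of undefined 0 undefined]] by simp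
  obtain k' l' where i: "i = (k', l')" by (cases i)
  have e: "entry (op_adj T) i (k, l) = cnj (entry T (k, l) (k', l'))"
    unfolding i by (rule entry_adj[OF homogeneous_BH[OF T]])
  show ?thesis
  proof (cases "entry T (k, l) (k', l') = 0")
    case True
    then show ?thesis using C q_pos by (simp add: e)
  next
    case False
    then have "int k = int k' + m"
      using T unfolding homogeneous_def by blast
    then have "C * q ^ (s * k') \<le> C * (q ^ (s * k) / q ^ (s * nat \<bar>m\<bar>))"
      using C by (intro mult_left_mono power_shift_le) auto
    then show ?thesis
      using dT[of "(k, l)" k' l'] by (simp add: e)
  qed
qed

text \<open>If \<open>n + n'\<close> is nonzero, one of the factors has nonzero degree and decays;
  the other is bounded by its norm.\<close>

lemma graded_comp:
  assumes "S \<in> graded_elements" "T \<in> graded_elements"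
  shows "S o\<^sub>L T \<in> graded_elements"
proof -
  obtain m n C where S: "homogeneous m n S" and dS: "n \<noteq> 0 \<Longrightarrow> cmod (entry S i (k, l)) \<le> C * q ^ k" for i k l
    using assms(1) unfolding graded_elements_def by blast
  obtain m' n' D where T: "homogeneous m' n' T" and dT: "n' \<noteq> 0 \<Longrightarrow> cmod (entry T i (k, l)) \<le> D * q ^ k" for i k l
    using assms(2) unfolding graded_elements_def by blast
  have "\<exists>E. \<forall>i k l. cmod (entry (S o\<^sub>L T) i (k, l)) \<le> E * q ^ k" if "n + n' \<noteq> 0"
  proof (cases "n = 0")
    case False
    then have "cmod (entry (S o\<^sub>L T) i (k, l)) \<le> (C / q ^ nat \<bar>m'\<bar> * norm T) * q ^ k" for i k l
      using homogeneous_decay_comp[OF homogeneous_BH[OF S] T, of C 1 "norm T" 0 i k l] dS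
      by (simp add: cmod_entry_le)
    then show ?thesis by blast
  next
    case True
    then have "cmod (entry (S o\<^sub>L T) i (k, l)) \<le> (norm S * D) * q ^ k" for i k l
      using homogeneous_decay_comp[OF homogeneous_BH[OF S] T, of "norm S" 0 D 1 i k l] that dT
      by (simp add: cmod_entry_le)
    then show ?thesis by blast
  qed
  then show ?thesis
    using homogeneous_comp[OF S T] unfolding graded_elements_def by blast
qed

lemma graded_adj:
  assumes "T \<in> graded_elements"
  shows "op_adj T \<in> graded_elements"
proof -
  obtain m n C where T: "homogeneous m n T" and dT: "n \<noteq> 0 \<Longrightarrow> cmod (entry T i (k, l)) \<le> C * q ^ k" for i k l
    using assms unfolding graded_elements_def by blast
  have "\<exists>E. \<forall>i k l. cmod (entry (op_adj T) i (k, l)) \<le> E * q ^ k" if "- n \<noteq> 0"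
  proof -
    have "cmod (entry (op_adj T) i (k, l)) \<le> (C / q ^ nat \<bar>m\<bar>) * q ^ k" for i k l
      using homogeneous_decay_adj[OF T, of C 1 i k l] that dT by simp
    then show ?thesis by blast
  qed
  then show ?thesis
    using homogeneous_adj[OF T] unfolding graded_elements_def by blast
qed

lemma graded_generators:
  "op_a q \<in> graded_elements" "op_b q \<in> graded_elements" "id_blinfun \<in> graded_elements"
proof -
  have "homogeneous 1 0 (op_a q)"
    by (auto simp: homogeneous_def entry_op_a split: if_splits)
  then show "op_a q \<in> graded_elements"
    unfolding graded_elements_def by blast
  have "homogeneous 0 0 id_blinfun"
    by (auto simp: homogeneous_def split: if_splits)
  then show "id_blinfun \<in> graded_elements"
    unfolding graded_elements_def by blast
  have "homogeneous 0 1 (op_b q)"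
    by (auto simp: homogeneous_def entry_op_b split: if_splits)
  moreover have "cmod (entry (op_b q) i (k, l)) \<le> 1 * q ^ k" for i k l
    using q_pos by (cases i) (simp add: entry_op_b norm_power)
  ultimately show "op_b q \<in> graded_elements"
    unfolding graded_elements_def by blast
qed

lemma pi0_term_graded: "pi0_term q x \<in> op_module.span graded_elements"
proof (induction x)
  case (Tm_times x y)
  then show ?case
    unfolding pi0_term.simps
    by (rule span_comp[OF _ _ graded_BH]) (intro op_module.span_base graded_comp)
next
  case (Tm_star x)
  then show ?case
    unfolding pi0_term.simps
    by (rule span_adj[OF _ graded_BH]) (intro op_module.span_base graded_adj)
qed (auto intro: graded_generators op_module.span_base op_module.span_zero op_module.span_add op_module.span_scale)

section \<open>The commutators with the phase\<close>

lemma entry_op_F: "entry op_F i j = (if i = j then if 0 \<le> snd i then 1 else - 1 else 0)"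
  using op_F(2)[of "fst j" "snd j"] by (auto simp: entry_def)

lemma op_F_square: "op_F o\<^sub>L op_F = id_blinfun"
  by (rule BH_eqI) (auto simp: op_F BH_scaleC[OF op_F(1)] scaleC_simps)

lemma op_adj_F: "op_adj op_F = op_F"
  by (rule op_adj_eq_entryI) (auto simp: op_F(1) entry_op_F)

lemma homogeneous_F: "homogeneous 0 0 op_F"
  by (auto simp: homogeneous_def entry_op_F op_F(1) split: if_splits)

lemma entry_commutator_F:
  assumes T: "T \<in> BH"
  shows "entry (op_commutator op_F T) i j =
    ((if 0 \<le> snd i then 1 else - 1) - (if 0 \<le> snd j then 1 else - 1)) * entry T i j"
proof -
  have "entry (op_F o\<^sub>L T) i j = entry op_F i i * entry T i j"
    by (rule has_sum_single[OF entry_comp_has_sum[OF op_F(1)]]) (simp add: entry_op_F)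
  moreover have "entry (T o\<^sub>L op_F) i j = entry T i j * entry op_F j j"
    by (rule has_sum_single[OF entry_comp_has_sum[OF T]]) (simp add: entry_op_F)
  ultimately show ?thesis
    by (simp add: op_commutator_def entry_op_F)
qed

lemma commutator_graded:
  assumes "T \<in> graded_elements"
  shows "op_commutator op_F T \<in> decaying 1"
proof -
  obtain m n C where T: "homogeneous m n T" and dT: "n \<noteq> 0 \<Longrightarrow> cmod (entry T i (k, l)) \<le> C * q ^ k" for i k l
    using assms unfolding graded_elements_def by blast
  note e = entry_commutator_F[OF homogeneous_BH[OF T]]
  have h: "homogeneous m n (op_commutator op_F T)"
    using T by (auto simp: homogeneous_def e) (auto simp: op_commutator_def op_F(1))
  have supp: "n \<noteq> 0 \<and> \<bar>l\<bar> \<le> \<bar>n\<bar>" if "entry (op_commutator op_F T) i (k, l) \<noteq> 0" for i k l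
  proof -
    obtain k' l' where i: "i = (k', l')" by (cases i)
    have "l' = l + n" "(0 \<le> l') \<noteq> (0 \<le> l)"
      using that T unfolding e i by (auto simp: homogeneous_def split: if_splits)
    then show ?thesis by auto
  qed
  \<comment> \<open>For \<open>n = 0\<close> nothing is known about \<open>C\<close>, not even its
    sign; the commutator is zero then, and the absolute value keeps the bound valid.\<close>
  have "cmod (entry (op_commutator op_F T) i (k, l)) \<le> (2 * \<bar>C\<bar>) * q ^ (1 * k)" for i k l
  proof (cases "entry (op_commutator op_F T) i (k, l) = 0")
    case True
    then show ?thesis using q_pos by simp
  next
    case False
    have "cmod (entry (op_commutator op_F T) i (k, l)) \<le> 2 * cmod (entry T i (k, l))"
      by (simp add: e norm_mult)
    also have "\<dots> \<le> 2 * (C * q ^ k)"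
      using dT supp[OF False] by simp
    also have "\<dots> \<le> (2 * \<bar>C\<bar>) * q ^ (1 * k)"
      using q_pos by (simp add: mult_right_mono)
    finally show ?thesis .
  qed
  then show ?thesis
    using h supp unfolding decaying_def by blast
qed

lemma commutator_span:
  assumes "x \<in> op_module.span graded_elements"
  shows "op_commutator op_F x \<in> op_module.span (decaying 1)"
  using assms
proof (induction rule: op_module.span_induct_alt)
  case base
  have "op_commutator op_F 0 = 0"
    by (rule blinfun_eqI) (simp add: op_commutator_def blinfun.diff_left)
  then show ?case by (simp add: op_module.span_zero)
next
  case (step c T x)
  have "op_commutator op_F (op_scale c T + x) = op_scale c (op_commutator op_F T) + op_commutator op_F x"
    by (simp add: op_commutator_def comp_add op_scale_comp op_F(1) op_module.scale_right_diff_distrib)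
  moreover have "op_commutator op_F T \<in> op_module.span (decaying 1)"
    using step by (intro op_module.span_base commutator_graded)
  then have "op_scale c (op_commutator op_F T) + op_commutator op_F x \<in> op_module.span (decaying 1)"
    using step by (intro op_module.span_add op_module.span_scale)
  ultimately show ?case by simp
qed

text \<open>The columns of a product vanish where those of its right factor do, so the strip of
  \<open>T\<close> serves.\<close>

lemma decaying_comp:
  assumes "S \<in> decaying s" "T \<in> decaying t"
  shows "S o\<^sub>L T \<in> decaying (s + t)"
proof -
  obtain m n C where S: "homogeneous m n S" and dS: "cmod (entry S i (k, l)) \<le> C * q ^ (s * k)" for i k l
    using assms(1) unfolding decaying_def by blast
  obtain m' n' D L where T: "homogeneous m' n' T" and dT: "cmod (entry T i (k, l)) \<le> D * q ^ (t * k)"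
      and L: "entry T i (k, l) \<noteq> 0 \<Longrightarrow> \<bar>l\<bar> \<le> L" for i k l
    using assms(2) unfolding decaying_def by blast
  have "entry (S o\<^sub>L T) i (k, l) \<noteq> 0 \<Longrightarrow> \<bar>l\<bar> \<le> L" for i k l
    using L unfolding homogeneous_entry_comp[OF homogeneous_BH[OF S] T] by auto
  then show ?thesis
    using homogeneous_comp[OF S T] homogeneous_decay_comp[OF homogeneous_BH[OF S] T dS dT]
    unfolding decaying_def by blast
qed

lemma commutator_cube:
  assumes "x \<in> op_module.span graded_elements"
  shows "op_power (op_commutator op_F x) 3 \<in> op_module.span (decaying 3)"
proof -
  let ?c = "op_commutator op_F x"
  have c: "?c \<in> op_module.span (decaying 1)"
    by (rule commutator_span[OF assms])
  have "?c o\<^sub>L ?c \<in> op_module.span (decaying (1 + 1))"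
    by (rule span_comp[OF c c decaying_BH]) (intro op_module.span_base decaying_comp)
  then have "?c o\<^sub>L (?c o\<^sub>L ?c) \<in> op_module.span (decaying (1 + (1 + 1)))"
    by (rule span_comp[OF c _ decaying_BH]) (intro op_module.span_base decaying_comp)
  then show ?thesis
    by (simp add: op_power_def numeral_3_eq_3)
qed

end

section \<open>The weight of \<open>K\<close> and its domain\<close>

lemma K_eigenvalue_eq: "K_eigenvalue q (k, l) = inverse (q ^ (2 * k))"
proof -
  have "- 2 * int k = - int (2 * k)" by simp
  then show ?thesis
    unfolding K_eigenvalue_def prod.case by (simp only: power_int_minus power_int_of_nat)
qed

text \<open>The two square roots are real and come out of the form by real linearity alone, so the
  weights agree as functions on the whole type, not just on \<open>BH\<close>.\<close>

lemma weight_K_eq: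
  assumes "0 < q"
  shows "weight_K q = diag_weight (K_eigenvalue q)"
proof
  fix T :: "(nat \<times> int) op"
  have "Re (cinner (op_sqrt_K q (ket i)) (T (op_sqrt_K q (ket i)))) = K_eigenvalue q i * Re (entry T i i)" for i
  proof -
    have "0 \<le> K_eigenvalue q i"
      using assms by (cases i) (simp add: K_eigenvalue_eq)
    then show ?thesis
      unfolding op_sqrt_K_ket scaleR_ell2_def[symmetric] blinfun.scaleR_right inner_ell2_def[symmetric]
      by (simp add: entry_eq_cinner inner_ell2_def[symmetric] mult.assoc[symmetric])
  qed
  then show "weight_K q T = diag_weight (K_eigenvalue q) T"
    by (simp add: weight_K_def diag_weight_def)
qed

context suq2_representation
begin

sublocale diagonal_weight "K_eigenvalue q"
proof
  show "0 < K_eigenvalue q i" for i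
    using q_pos by (cases i) (simp add: K_eigenvalue_eq)
qed

lemma ln_K_eigenvalue: "ln (K_eigenvalue q (k, l)) = - (2 * real k * ln q)"
  using q_pos by (simp add: K_eigenvalue_eq ln_inverse ln_realpow)

lemma summable_strip: "(\<lambda>(k::nat, l::int). C * q ^ k * (if \<bar>l\<bar> \<le> L then 1 else 0)) summable_on UNIV"
proof -
  have fin: "(\<lambda>l. if \<bar>l\<bar> \<le> L then 1 else 0 :: real) summable_on UNIV"
    by (rule finite_nonzero_values_imp_summable_on, rule finite_subset[of _ "{- L..L}"]) (auto split: if_splits)
  have geo: "(\<lambda>k. q ^ k) summable_on UNIV"
    using q_pos q_less_1 by (intro summable_nonneg_imp_summable_on summable_geometric) auto
  have "(\<lambda>(k::nat, l::int). q ^ k * (if \<bar>l\<bar> \<le> L then 1 else 0)) summable_on UNIV \<times> UNIV"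
  proof (rule summable_on_SigmaI)
    show "((\<lambda>l. case (k, l) of (k, l) \<Rightarrow> q ^ k * (if \<bar>l\<bar> \<le> L then 1 else 0)) has_sum
        q ^ k * (\<Sum>\<^sub>\<infinity>l. if \<bar>l\<bar> \<le> L then 1 else 0)) UNIV" for k
      unfolding prod.case by (intro has_sum_cmult_right has_sum_infsum fin)
    show "(\<lambda>k. q ^ k * (\<Sum>\<^sub>\<infinity>l. if \<bar>l\<bar> \<le> L then 1 else 0)) summable_on UNIV"
      by (intro summable_on_cmult_left geo)
  qed (use q_pos in auto)
  then have "(\<lambda>p. C * (case p of (k, l) \<Rightarrow> q ^ k * (if \<bar>l\<bar> \<le> L then 1 else 0))) summable_on UNIV"
    by (intro summable_on_cmult_right) simp
  then show ?thesis
    by (simp add: case_prod_unfold mult.assoc)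
qed

text \<open>Against the eigenvalue \<open>q^(-2 k)\<close> a squared norm of order
  \<open>q^(3 k)\<close> leaves \<open>q^k\<close>, a geometric series in \<open>k\<close> over
  finitely many \<open>l\<close>.\<close>

lemma ideal_of_decay:
  assumes X: "X \<in> BH" and bound: "\<And>k l. (norm (X (ket (k, l))))\<^sup>2 \<le> C * q ^ (3 * k)"
    and supp: "\<And>k l. \<bar>l\<bar> > L \<Longrightarrow> X (ket (k, l)) = 0"
  shows "X \<in> \<LL>"
proof -
  have "K_eigenvalue q p * (norm (X (ket p)))\<^sup>2 \<le> (case p of (k, l) \<Rightarrow> C * q ^ k * (if \<bar>l\<bar> \<le> L then 1 else 0))" for p
  proof -
    obtain k l where p: "p = (k, l)" by (cases p)
    have "inverse (q ^ (2 * k)) * (norm (X (ket (k, l))))\<^sup>2 \<le> inverse (q ^ (2 * k)) * (C * q ^ (3 * k))"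
      using q_pos by (intro mult_left_mono bound) auto
    also have "\<dots> = C * q ^ k"
      using q_pos by (simp add: field_simps power_add[symmetric])
    finally show ?thesis
      using supp[of l k] by (simp add: p K_eigenvalue_eq)
  qed
  then have "(\<lambda>p. K_eigenvalue q p * (norm (X (ket p)))\<^sup>2) summable_on UNIV"
    by (rule summable_on_comparison_test[OF summable_strip]) simp
  then show ?thesis
    using X by (simp add: square_summable_ideal_def)
qed

text \<open>An operator decaying like \<open>q\<^bsup>3k\<^esup>\<close> is a product of two operators decaying like \<open>q\<^bsup>3k/2\<^esup>\<close>, and these
  are square-summable for the weight \<open>q\<^bsup>-2k\<^esup>\<close>.\<close>

lemma decaying_3_weight_dom_nonneg:
  assumes T: "homogeneous m n T" and m: "0 \<le> m"
    and dT: "\<And>i k l. cmod (entry T i (k, l)) \<le> C * q ^ (3 * k)"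
    and supp: "\<And>i k l. entry T i (k, l) \<noteq> 0 \<Longrightarrow> \<bar>l\<bar> \<le> L"
  shows "T \<in> weight_dom BH \<Phi>"
proof -
  \<comment> \<open>With this root, half of the decay, \<open>q^(3 k / 2)\<close>, is the integer
    power \<open>r^(3 k)\<close>.\<close>
  define r where "r = sqrt q"
  have r: "0 < r" "r < 1" "r ^ 2 = q"
    using q_pos q_less_1 by (auto simp: r_def)
  have qr: "q ^ (3 * k) = r ^ (3 * k) * r ^ (3 * k)" for k
    unfolding r(3)[symmetric] power_mult[symmetric] power_add[symmetric] by (simp add: mult_2 algebra_simps)
  have C: "0 \<le> C"
    using order_trans[OF norm_ge_zero dT[of undefined 0 undefined]] by simp
  define M where "M = nat m"
  have mM: "m = int M" using m by (simp add: M_def)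
  \<comment> \<open>Because \<open>m\<close> is nonnegative, the shift is total and injective on the
    index set, as a weighted shift requires.\<close>
  define p where "p = (\<lambda>(k, l). (k + M, l + n))"
  have inj: "inj p" by (auto simp: p_def inj_on_def)
  have T0: "entry T i j = 0" if "i \<noteq> p j" for i j
  proof (rule ccontr)
    assume "entry T i j \<noteq> 0"
    then have "int (fst i) = int (fst j) + int M \<and> snd i = snd j + n"
      using T unfolding homogeneous_def mM by (metis prod.collapse)
    then show False
      using that by (cases i; cases j) (auto simp: p_def)
  qed
  \<comment> \<open>\<open>Z\<close> acts after the shift by \<open>n\<close>, so its strip is
    widened by \<bar>n\<bar>.\<close>
  define e where "e = (\<lambda>(k, l). complex_of_real (if \<bar>l\<bar> \<le> L + \<bar>n\<bar> then r ^ (3 * k) else 0))"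
  \<comment> \<open>Dividing by the weight of \<open>Z\<close> at the target level
    \<open>k + M\<close> leaves the other half of the decay to \<open>Y\<close>.\<close>
  define w where "w = (\<lambda>j. entry T (p j) j / complex_of_real (r ^ (3 * (fst j + M))))"
  define Z where "Z = mult_op e"
  have e: "cmod (e j) \<le> 1" for j
    using r by (cases j) (simp add: e_def norm_power power_le_one)
  have Z: "Z \<in> BH"
    unfolding Z_def by (rule mult_op_BH[OF e])
  have Zket: "Z (ket j) = e j *\<^sub>C ket j" for j
    unfolding Z_def by (rule ell2_eqI) (simp add: coord_mult_op[OF e])
  have "cnj (e j) = e j" for j
    by (simp add: e_def split_beta)
  then have Z_adj: "op_adj Z = Z"
    by (intro op_adj_eq_entryI) (use Z in \<open>auto simp: Z_def entry_mult_op[OF e]\<close>)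
  have wb: "cmod (w (k, l)) \<le> C / r ^ (3 * M) * r ^ (3 * k)" for k l
  proof -
    have "cmod (w (k, l)) = cmod (entry T (p (k, l)) (k, l)) / r ^ (3 * (k + M))"
      using r by (simp add: w_def norm_divide norm_power)
    also have "\<dots> \<le> C * (r ^ (3 * k) * r ^ (3 * k)) / r ^ (3 * (k + M))"
      using r dT unfolding qr[symmetric] by (intro divide_right_mono) auto
    also have "\<dots> = C / r ^ (3 * M) * r ^ (3 * k)"
      using r by (simp add: power_add distrib_left)
    finally show ?thesis .
  qed
  have wb1: "cmod (w j) \<le> C / r ^ (3 * M)" for j
  proof -
    have "C / r ^ (3 * M) * r ^ (3 * fst j) \<le> C / r ^ (3 * M) * 1"
      using C r by (intro mult_left_mono power_le_one) auto
    then show ?thesis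
      using wb[of "fst j" "snd j"] by simp
  qed
  obtain Y where Y: "Y \<in> BH" "\<forall>j. blinfun_apply Y (ket j) = w j *\<^sub>C ket (p j)"
    by (rule bexE[OF ex_wshift[where w = w, OF inj wb1]])
  have supp': "\<bar>l\<bar> \<le> L" if "w (k, l) \<noteq> 0" for k l
    using that supp[of "p (k, l)" k l] by (auto simp: w_def)
  have "T = Z o\<^sub>L Y"
  proof (rule op_eqI)
    fix i j :: "nat \<times> int"
    obtain k l where j: "j = (k, l)" by (cases j)
    have "entry (Z o\<^sub>L Y) i j = w j * e (p j) * (if i = p j then 1 else 0)"
      by (simp add: entry_def Y BH_scaleC[OF Z] Zket)
    also have "\<dots> = entry T i j"
    proof (cases "i = p j \<and> entry T (p j) j \<noteq> 0")
      case True
      then have "\<bar>l\<bar> \<le> L" using supp j by blast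
      then have "\<bar>l + n\<bar> \<le> L + \<bar>n\<bar>" by linarith
      then show ?thesis
        using True r by (simp add: j w_def e_def p_def)
    qed (auto simp: T0 w_def)
    finally show "entry T i j = entry (Z o\<^sub>L Y) i j" by (rule HOL.sym)
  qed (use T Y Z in \<open>auto simp: homogeneous_def\<close>)
  moreover have "Z \<in> \<LL>"
  proof (rule ideal_of_decay[OF Z])
    show "(norm (Z (ket (k, l))))\<^sup>2 \<le> 1 * q ^ (3 * k)" for k l
      using q_pos r by (simp add: Zket norm_scaleC_ell2 e_def norm_power qr power2_eq_square)
    show "Z (ket (k, l)) = 0" if "L + \<bar>n\<bar> < \<bar>l\<bar>" for k l
      using that by (simp add: Zket e_def scaleC_simps)
  qed
  moreover have "Y \<in> \<LL>"
  proof (rule ideal_of_decay[OF Y(1)])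
    show "(norm (Y (ket (k, l))))\<^sup>2 \<le> (C / r ^ (3 * M))\<^sup>2 * q ^ (3 * k)" for k l
      using power_mono[OF wb[of k l], of 2] unfolding qr
      by (simp add: Y norm_scaleC_ell2 power2_eq_square mult_ac)
    show "Y (ket (k, l)) = 0" if "L < \<bar>l\<bar>" for k l
      using that supp'[of k l] by (cases "w (k, l) = 0") (auto simp: Y scaleC_simps)
  qed
  ultimately show ?thesis
    using ideal_product_weight_dom[of Z Y] by (simp add: Z_adj)
qed

lemma decaying_3_weight_dom: "decaying 3 \<subseteq> weight_dom BH \<Phi>"
proof
  fix T assume "T \<in> decaying 3"
  then obtain m n C L where T: "homogeneous m n T" and dT: "\<And>i k l. cmod (entry T i (k, l)) \<le> C * q ^ (3 * k)"
    and supp: "\<And>i k l. entry T i (k, l) \<noteq> 0 \<Longrightarrow> \<bar>l\<bar> \<le> L"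
    unfolding decaying_def by blast
  have B: "T \<in> BH" using T by (rule homogeneous_BH)
  show "T \<in> weight_dom BH \<Phi>"
  proof (cases "0 \<le> m")
    case True
    then show ?thesis
      by (rule decaying_3_weight_dom_nonneg[OF T _ dT, where L = L]) (use supp in auto)
  next
    case False
    \<comment> \<open>For negative \<open>m\<close> the adjoint raises \<open>k\<close>. Its columns
      are the rows of \<open>T\<close>, whose range in \<open>l\<close> is displaced by
      \<open>n\<close>.\<close>
    have "\<bar>l\<bar> \<le> L + \<bar>n\<bar>" if "entry (op_adj T) i (k, l) \<noteq> 0" for i k l
    proof -
      obtain k' l' where i: "i = (k', l')" by (cases i)
      have "entry T (k, l) (k', l') \<noteq> 0"
        using that entry_adj[OF B, of i "(k, l)"] i by simp
      then have "\<bar>l'\<bar> \<le> L" "l = l' + n"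
        using supp T unfolding homogeneous_def by blast+
      then show ?thesis by linarith
    qed
    then have "op_adj T \<in> weight_dom BH \<Phi>"
      using False
      by (intro decaying_3_weight_dom_nonneg[OF homogeneous_adj[OF T] _ homogeneous_decay_adj[OF T dT]]) auto
    then show ?thesis
      using weight_dom_adj[of "op_adj T"] by (simp add: op_adj_adj[OF B])
  qed
qed

lemma summability: "op_power (op_commutator op_F (pi0_term q x)) 3 \<in> weight_dom BH \<Phi>"
  using commutator_cube[OF pi0_term_graded, of x] op_module.span_minimal[OF decaying_3_weight_dom]
  unfolding weight_dom_def by (auto intro: op_module.subspace_span)

section \<open>The modular group on the algebra\<close>

text \<open>The logarithm of the eigenvalue is linear in \<open>k\<close> and independent of
  \<open>l\<close>, so all nonzero entries receive the same factor
  \<open>q^(-2 i t m)\<close>.\<close>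

lemma \<sigma>_homogeneous:
  assumes T: "homogeneous m n T"
  shows "\<sigma> t T = op_scale (cis (- 2 * t * of_int m * ln q)) T"
proof (rule op_eqI)
  have B: "T \<in> BH" using T by (rule homogeneous_BH)
  fix i j :: "nat \<times> int"
  obtain k' l' k l where ij: "i = (k', l')" "j = (k, l)" by (cases i; cases j)
  show "entry (\<sigma> t T) i j = entry (op_scale (cis (- 2 * t * of_int m * ln q)) T) i j"
  proof (cases "entry T i j = 0")
    case False
    then have "int k' = int k + m"
      using T ij unfolding homogeneous_def by blast
    then have k': "real k' = real k + of_int m" by linarith
    have "t * (ln (K_eigenvalue q i) - ln (K_eigenvalue q j)) = - 2 * t * of_int m * ln q"
      unfolding ij ln_K_eigenvalue k' by (simp add: algebra_simps)
    then show ?thesis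
      by (simp add: entry_\<sigma>[OF B])
  qed (simp add: entry_\<sigma>[OF B])
qed (use homogeneous_BH[OF T] in auto)

lemma \<sigma>_simps:
  "\<sigma> t (x + y) = \<sigma> t x + \<sigma> t y" "\<sigma> t (op_scale c x) = op_scale c (\<sigma> t x)"
  "\<sigma> t (x o\<^sub>L y) = \<sigma> t x o\<^sub>L \<sigma> t y" "\<sigma> t 0 = 0" "\<sigma> t id_blinfun = id_blinfun"
  by (auto intro!: blinfun_eqI
      simp: \<sigma>_apply blinfun.bilinear_simps op_scale_apply BH_scaleC U_apply_apply U_zero)

text \<open>Generators are homogeneous, so \<open>op_a q\<close> is multiplied by a phase and
  \<open>op_b q\<close> is fixed; the automorphism property carries this through all terms.\<close>

lemma \<sigma>_range: "\<sigma> t (pi0_term q x) \<in> range (pi0_term q)"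
proof (induction x)
  case Gen_a
  have "homogeneous 1 0 (op_a q)"
    by (auto simp: homogeneous_def entry_op_a split: if_splits)
  then have "\<sigma> t (pi0_term q Gen_a) = pi0_term q (Tm_scale (cis (- 2 * t * of_int 1 * ln q)) Gen_a)"
    by (simp add: \<sigma>_homogeneous)
  then show ?case by blast
next
  case Gen_b
  have "homogeneous 0 1 (op_b q)"
    by (auto simp: homogeneous_def entry_op_b split: if_splits)
  then have "\<sigma> t (pi0_term q Gen_b) = pi0_term q (Tm_scale (cis (- 2 * t * of_int 0 * ln q)) Gen_b)"
    by (simp add: \<sigma>_homogeneous)
  then show ?case by blast
next
  case Tm_zero
  have "\<sigma> t (pi0_term q Tm_zero) = pi0_term q Tm_zero" by (simp add: \<sigma>_simps)
  then show ?case by blast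
next
  case Tm_one
  have "\<sigma> t (pi0_term q Tm_one) = pi0_term q Tm_one" by (simp add: \<sigma>_simps)
  then show ?case by blast
next
  case (Tm_plus x y)
  then obtain x' y' where "\<sigma> t (pi0_term q x) = pi0_term q x'" "\<sigma> t (pi0_term q y) = pi0_term q y'" by blast
  then have "\<sigma> t (pi0_term q (Tm_plus x y)) = pi0_term q (Tm_plus x' y')" by (simp add: \<sigma>_simps)
  then show ?case by blast
next
  case (Tm_times x y)
  then obtain x' y' where "\<sigma> t (pi0_term q x) = pi0_term q x'" "\<sigma> t (pi0_term q y) = pi0_term q y'" by blast
  then have "\<sigma> t (pi0_term q (Tm_times x y)) = pi0_term q (Tm_times x' y')" by (simp add: \<sigma>_simps)
  then show ?case by blast
next
  case (Tm_scale c x)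
  then obtain x' where "\<sigma> t (pi0_term q x) = pi0_term q x'" by blast
  then have "\<sigma> t (pi0_term q (Tm_scale c x)) = pi0_term q (Tm_scale c x')" by (simp add: \<sigma>_simps)
  then show ?case by blast
next
  case (Tm_star x)
  then obtain x' where "\<sigma> t (pi0_term q x) = pi0_term q x'" by blast
  then have "\<sigma> t (pi0_term q (Tm_star x)) = pi0_term q (Tm_star x')" by (simp add: \<sigma>_adj)
  then show ?case by blast
qed

lemma \<sigma>_image: "\<sigma> t ` range (pi0_term q) = range (pi0_term q)"
proof
  show "\<sigma> t ` range (pi0_term q) \<subseteq> range (pi0_term q)"
    using \<sigma>_range by blast
  have "pi0_term q x = \<sigma> t (\<sigma> (- t) (pi0_term q x))" for x
    by (rule blinfun_eqI) (simp add: \<sigma>_apply U_apply_apply U_zero)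
  then show "range (pi0_term q) \<subseteq> \<sigma> t ` range (pi0_term q)"
    using \<sigma>_range by blast
qed

lemma analytic_homogeneous:
  assumes T: "homogeneous m n T"
  shows "analytic_vector BH \<sigma> T"
  unfolding analytic_vector_def
\<comment> \<open>The witness continues the character by which the group acts from real
  \<open>t\<close> to complex \<open>z\<close>.\<close>
proof (intro exI[of _ "\<lambda>z. op_scale (exp (\<i> * z * of_real (- 2 * of_int m * ln q))) T"] conjI allI)
  have B: "T \<in> BH" using T by (rule homogeneous_BH)
  then show "op_scale (exp (\<i> * z * of_real (- 2 * of_int m * ln q))) T \<in> BH" for z
    by simp
  show "op_scale (exp (\<i> * of_real t * of_real (- 2 * of_int m * ln q))) T = \<sigma> t T" for t
    by (simp add: \<sigma>_homogeneous[OF T] cis_conv_exp mult_ac)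
  show "(\<lambda>z. cinner \<xi> (op_scale (exp (\<i> * z * of_real (- 2 * of_int m * ln q))) T \<eta>)) holomorphic_on UNIV" for \<xi> \<eta>
    unfolding op_scale_apply cinner_scaleC_right by (intro holomorphic_intros)
qed

lemma analytic_add_scale:
  assumes x: "analytic_vector BH \<sigma> x" and y: "analytic_vector BH \<sigma> y"
  shows "analytic_vector BH \<sigma> (op_scale c x + y)"
proof -
  obtain f where f: "\<And>z. f z \<in> BH" "\<And>t. f (of_real t) = \<sigma> t x"
      "\<And>\<xi> \<eta>. (\<lambda>z. cinner \<xi> (blinfun_apply (f z) \<eta>)) holomorphic_on UNIV"
    using x unfolding analytic_vector_def by auto
  obtain g where g: "\<And>z. g z \<in> BH" "\<And>t. g (of_real t) = \<sigma> t y"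
      "\<And>\<xi> \<eta>. (\<lambda>z. cinner \<xi> (blinfun_apply (g z) \<eta>)) holomorphic_on UNIV"
    using y unfolding analytic_vector_def by auto
  show ?thesis
    unfolding analytic_vector_def
  proof (intro exI[of _ "\<lambda>z. op_scale c (f z) + g z"] conjI allI)
    show "(\<lambda>z. cinner \<xi> ((op_scale c (f z) + g z) \<eta>)) holomorphic_on UNIV" for \<xi> \<eta>
      unfolding blinfun.add_left op_scale_apply cinner_add_right cinner_scaleC_right
      by (intro holomorphic_intros f g)
  qed (use f g in \<open>auto simp: \<sigma>_simps\<close>)
qed

lemma analytic_pi0: "analytic_vector BH \<sigma> (pi0_term q x)"
  using pi0_term_graded
proof (induction rule: op_module.span_induct_alt)
  case base
  have "homogeneous 0 0 0" by (simp add: homogeneous_def)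
  then show ?case by (rule analytic_homogeneous)
next
  case (step c T x)
  then show ?case
    by (intro analytic_add_scale) (auto simp: graded_elements_def intro: analytic_homogeneous)
qed

text \<open>A diagonal operator has degree \<open>(0, 0)\<close>, for which the character is
  trivial.\<close>

lemma F_fixed: "op_F \<in> fixed_point_algebra BH \<sigma>"
proof -
  have "\<sigma> t op_F = op_F" for t
    using \<sigma>_homogeneous[OF homogeneous_F] by (simp add: op_module.scale_one)
  then show ?thesis
    by (simp add: fixed_point_algebra_def op_F(1))
qed

end

theorem lemma3:
  fixes q :: real
  assumes "0 < q" and "q < 1"
  shows "modular_fredholm_module 3 BH (weight_K q) (suq2 q) (pi0 q) op_F"
proof -
  interpret suq2_representation q
    by unfold_locales (use assms in auto)
  show ?thesis
    unfolding modular_fredholm_module_def weight_K_eq[OF assms(1)] pi0_image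
    using von_neumann_algebra_BH fns_weight_diag star_representation_pi0 unital_star_subalgebra_pi0
      separable_pi0 modular_group_diag \<sigma>_image analytic_pi0 F_fixed op_adj_F op_F_square summability
    by auto
qed

end
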